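(* Let $(R,\mathfrak m)$ be a regular local ring with $\dim R\leq 3$ and let $I$ be an ideal of $R$. Then $\operatorname{astab}(I)=\operatorname{dstab}(I)$. The same holds for a graded ideal $I$ in a polynomial ring $R$ over a field in at most $3$ variables.
   Context: For an ideal $I$ of a Noetherian ring $R$: $\operatorname{astab}(I)$ is the smallest positive integer $k_0$ such that $\operatorname{Ass}(R/I^k)=\operatorname{Ass}(R/I^{k_0})$ for all $k\geq k_0$; $\operatorname{dstab}(I)$ is the smallest positive integer $k_0$ such that $\operatorname{depth} R/I^k=\operatorname{depth} R/I^{k_0}$ for all $k\geq k_0$ (in the graded case depth is taken with respect to the graded maximal ideal). *)

theory Defs
  imports "HOL-Algebra.Algebra" "HOL-Library.Poly_Mapping" "HOL-Library.Extended_Nat"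
begin

primrec ideal_pow :: "('a, 'b) ring_scheme \<Rightarrow> 'a set \<Rightarrow> nat \<Rightarrow> 'a set" where
  "ideal_pow R I 0 = carrier R"
| "ideal_pow R I (Suc k) = ideal_prod R (ideal_pow R I k) I"

definition colon :: "('a, 'b) ring_scheme \<Rightarrow> 'a set \<Rightarrow> 'a \<Rightarrow> 'a set" where
  "colon R J x = {r \<in> carrier R. r \<otimes>\<^bsub>R\<^esub> x \<in> J}"

text \<open>Ass(R/J): prime ideals of the form Ann(x + J) = (J : x).\<close>
definition Ass :: "('a, 'b) ring_scheme \<Rightarrow> 'a set \<Rightarrow> 'a set set" where
  "Ass R J = {P. primeideal P R \<and> (\<exists>x \<in> carrier R. P = colon R J x)}"

text \<open>xs is an (R/J)-regular sequence contained in the ideal M.\<close>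
definition regular_seq :: "('a, 'b) ring_scheme \<Rightarrow> 'a set \<Rightarrow> 'a set \<Rightarrow> 'a list \<Rightarrow> bool" where
  "regular_seq R M J xs \<longleftrightarrow>
     set xs \<subseteq> M \<and>
     (\<forall>i < length xs. colon R (Idl\<^bsub>R\<^esub> (J \<union> set (take i xs))) (xs ! i)
                        = Idl\<^bsub>R\<^esub> (J \<union> set (take i xs))) \<and>
     Idl\<^bsub>R\<^esub> (J \<union> set xs) \<noteq> carrier R"

text \<open>depth of R/J with respect to the ideal M (the M-grade of R/J);
  it is \<infinity> when M(R/J) = R/J, i.e. J + M = R (in particular for R/J = 0).\<close>
definition depth :: "('a, 'b) ring_scheme \<Rightarrow> 'a set \<Rightarrow> 'a set \<Rightarrow> enat" where
  "depth R M J = (if Idl\<^bsub>R\<^esub> (J \<union> M) = carrier R then \<infinity>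
                  else Sup {enat (length xs) | xs. regular_seq R M J xs})"

definition astab :: "('a, 'b) ring_scheme \<Rightarrow> 'a set \<Rightarrow> nat" where
  "astab R I = (LEAST k0. 0 < k0 \<and>
      (\<forall>k \<ge> k0. Ass R (ideal_pow R I k) = Ass R (ideal_pow R I k0)))"

text \<open>dstab, with depth taken with respect to the ideal M
  (the maximal ideal in the local case, the graded maximal ideal in the graded case).\<close>
definition dstab :: "('a, 'b) ring_scheme \<Rightarrow> 'a set \<Rightarrow> 'a set \<Rightarrow> nat" where
  "dstab R M I = (LEAST k0. 0 < k0 \<and>
      (\<forall>k \<ge> k0. depth R M (ideal_pow R I k) = depth R M (ideal_pow R I k0)))"

definition krull_dim :: "('a, 'b) ring_scheme \<Rightarrow> enat" where
  "krull_dim R = Sup {enat n | n. \<exists>P. (\<forall>i \<le> n. primeideal (P i) R) \<and>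
                                      (\<forall>i < n. P i \<subset> P (Suc i))}"

definition local_ring :: "('a, 'b) ring_scheme \<Rightarrow> 'a set \<Rightarrow> bool" where
  "local_ring R m \<longleftrightarrow> cring R \<and> noetherian_ring R \<and> maximalideal m R \<and>
     (\<forall>N. maximalideal N R \<longrightarrow> N = m)"

definition regular_local_ring :: "('a, 'b) ring_scheme \<Rightarrow> 'a set \<Rightarrow> bool" where
  "regular_local_ring R m \<longleftrightarrow> local_ring R m \<and> krull_dim R \<noteq> \<infinity> \<and>
     (\<exists>xs. set xs \<subseteq> carrier R \<and> enat (length xs) = krull_dim R \<and> m = Idl\<^bsub>R\<^esub> (set xs))"

type_synonym 'k mpoly = "(nat \<Rightarrow>\<^sub>0 nat) \<Rightarrow>\<^sub>0 'k"

definition mpoly_ring :: "nat \<Rightarrow> ('k::field) mpoly ring" where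
  "mpoly_ring n = \<lparr> carrier = {p. \<forall>u \<in> Poly_Mapping.keys p. Poly_Mapping.keys u \<subseteq> {..<n}},
                    monoid.mult = (*), one = 1, ring.zero = 0, add = (+) \<rparr>"

definition mon_deg :: "(nat \<Rightarrow>\<^sub>0 nat) \<Rightarrow> nat" where
  "mon_deg u = (\<Sum>i \<in> Poly_Mapping.keys u. Poly_Mapping.lookup u i)"

definition hom_comp :: "nat \<Rightarrow> ('k::field) mpoly \<Rightarrow> 'k mpoly" where
  "hom_comp d p = Poly_Mapping.mapp (\<lambda>u c. if mon_deg u = d then c else 0) p"

definition graded_ideal :: "nat \<Rightarrow> ('k::field) mpoly set \<Rightarrow> bool" where
  "graded_ideal n I \<longleftrightarrow> ideal I (mpoly_ring n) \<and> (\<forall>p \<in> I. \<forall>d. hom_comp d p \<in> I)"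

definition graded_max :: "nat \<Rightarrow> ('k::field) mpoly set" where
  "graded_max n = {p \<in> carrier (mpoly_ring n). Poly_Mapping.lookup p 0 = 0}"

end

theory Submission
  imports Defs "HOL-Computational_Algebra.Polynomial_Factorial"
    "HOL-Computational_Algebra.Field_as_Ring"
begin

text \<open>Write \<open>I = f J\<close> with \<open>J\<close> contained in no proper principal ideal; this is possible because the
  ring is factorial. An associated prime of \<open>I\<^sup>k\<close> other than the maximal ideal \<open>m\<close> is either principal
  and contains \<open>f\<close>, or minimal over \<open>J\<close> because the dimension is at most three; both conditions are
  independent of \<open>k\<close>. So \<open>Ass(R/I\<^sup>k)\<close> is determined by whether it contains \<open>m\<close>, that is by whether
  the depth is zero. When it is not, the depth is one if \<open>J\<close> is proper, and that of \<open>R/f\<close> otherwise.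
  Hence for \<open>k, l \<ge> 1\<close> the sets of associated primes agree exactly when the depths do, and the two
  stability indices are defined by equivalent conditions.

  Factoriality of a regular local ring of dimension three: the syzygies of a colon ideal \<open>(a : b)\<close>
  are free, because a regular system of parameters is a regular sequence on them, so Hilbert--Burch
  expresses \<open>(a : b)\<close> by maximal minors, and McCoy's theorem makes it principal. That the parameters
  generate successive primes follows from Krull's principal ideal theorem.\<close>

section \<open>Ideals of a quotient ring\<close>

text \<open>Dimension three enters twice. As far as the dimension allows, a colon ideal
  \<open>(a : b)\<close> in a domain has depth at least two, so its syzygies have depth at least
  three, and only up to dimension three does this make them free. Moreover a prime over
  \<open>J\<close> has height at least two, so a prime \<open>P\<close> strictly inside
  \<open>M\<close> leaves no room for another prime over \<open>J\<close> strictly below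
  \<open>P\<close>. The obstacle is that the polynomial ring is not local. No localization is
  formed: an equation in the localization at \<open>M\<close> is an equation after multiplication by
  some element outside \<open>M\<close>. All that remains of locality in the comparison of
  associated primes with depths is that every \<open>(I^k : x)\<close> with \<open>x\<close> outside
  \<open>I^k\<close> lies in \<open>M\<close>. This is immediate in a local ring and follows from
  the grading in the other case. Factoriality is used only in the form that \<open>(a : b)\<close>
  is principal for single elements \<open>a\<close> and \<open>b\<close>, which makes sense without
  fractions and without irreducible elements.\<close>

text \<open>Rings are treated as quotients \<open>T/K\<close> of a type-class ring \<open>T\<close>, and their ideals as the ideals
  of \<open>T\<close> containing \<open>K\<close>. Every commutative ring arises in this way from a free one.\<close>

interpretation idl: Modules.module "(*) :: 'a::comm_ring_1 \<Rightarrow> 'a \<Rightarrow> 'a"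
  by unfold_locales (simp_all add: algebra_simps)

(* Here scale_scale is the converse of mult.assoc, so as a simp rule it makes rewriting loop. *)
declare idl.scale_scale [simp del] idl.span_eq_iff [simp del]

text \<open>A ring is a module over itself; its subspaces are the ideals and its spans the ideals
  generated, so module theory serves as ideal theory. Throughout, \<open>gen (insert a K)\<close> is
  the preimage in \<open>T\<close> of the principal ideal of \<open>a\<close> in \<open>T/K\<close>,
  for an ideal \<open>K\<close>.\<close>

abbreviation is_ideal :: "'a::comm_ring_1 set \<Rightarrow> bool" where
  "is_ideal \<equiv> idl.subspace"

abbreviation gen :: "'a::comm_ring_1 set \<Rightarrow> 'a set" where
  "gen \<equiv> idl.span"

text \<open>The colon ideal \<open>(A : x)\<close>, that is, the annihilator of \<open>x\<close> in
  \<open>T/A\<close>.\<close>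

definition quot :: "'a::comm_ring_1 set \<Rightarrow> 'a \<Rightarrow> 'a set" where
  "quot A x = {r. r * x \<in> A}"

definition prime_ideal :: "'a::comm_ring_1 set \<Rightarrow> bool" where
  "prime_ideal P \<longleftrightarrow> is_ideal P \<and> 1 \<notin> P \<and> (\<forall>a b. a * b \<in> P \<longrightarrow> a \<in> P \<or> b \<in> P)"

text \<open>\<open>T/K\<close> is Noetherian, in the form of the maximal condition. It is relative
  to \<open>K\<close> because \<open>T\<close> may be a polynomial ring in infinitely many
  variables.\<close>

definition acc_above :: "'a::comm_ring_1 set \<Rightarrow> bool" where
  "acc_above K \<longleftrightarrow> (\<forall>\<S>. \<S> \<noteq> {} \<and> (\<forall>A\<in>\<S>. is_ideal A \<and> K \<subseteq> A)
     \<longrightarrow> (\<exists>A\<in>\<S>. \<forall>B\<in>\<S>. A \<subseteq> B \<longrightarrow> B = A))"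

definition mult_set :: "'a::comm_ring_1 set \<Rightarrow> bool" where
  "mult_set S \<longleftrightarrow> 1 \<in> S \<and> (\<forall>a\<in>S. \<forall>b\<in>S. a * b \<in> S)"

lemma ideal_mult_right: "is_ideal A \<Longrightarrow> a \<in> A \<Longrightarrow> a * b \<in> A"
  using idl.subspace_scale[of A a b] by (simp add: mult.commute)

lemma ideal_mult_left: "is_ideal A \<Longrightarrow> a \<in> A \<Longrightarrow> b * a \<in> A"
  using idl.subspace_scale[of A a b] by simp

lemmas ideal_add = idl.subspace_add
lemmas ideal_diff = idl.subspace_diff
lemmas ideal_zero = idl.subspace_0

lemma ideal_add_iff:
  assumes "is_ideal A" "a \<in> A" shows "a + b \<in> A \<longleftrightarrow> b \<in> A"
  using assms ideal_add[of A a b] ideal_diff[of A "a + b" a] by auto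

lemma ideal_minus_cancel: "is_ideal A \<Longrightarrow> u \<in> A \<Longrightarrow> u - v \<in> A \<Longrightarrow> v \<in> A"
  using ideal_diff[of A u "u - v"] by simp

lemma ideal_eq_UNIV: "is_ideal A \<Longrightarrow> 1 \<in> A \<Longrightarrow> A = UNIV"
  using ideal_mult_left[of A 1] by auto

lemma quot_ideal: assumes "is_ideal A" shows "is_ideal (quot A x)"
proof (rule idl.subspaceI)
  show "0 \<in> quot A x" using ideal_zero[OF assms] by (simp add: quot_def)
next
  fix a b assume "a \<in> quot A x" "b \<in> quot A x"
  then show "a + b \<in> quot A x" using ideal_add[OF assms] by (simp add: quot_def distrib_right)
next
  fix c a assume "a \<in> quot A x"
  then have "c * (a * x) \<in> A" using ideal_mult_left[OF assms, of "a * x" c] by (simp add: quot_def)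
  then show "c * a \<in> quot A x" by (simp add: quot_def mult.assoc)
qed

lemma quot_superset: "is_ideal A \<Longrightarrow> A \<subseteq> quot A x"
  by (auto simp: quot_def ideal_mult_right)

lemma quot_mult: assumes "is_ideal A" shows "quot A x \<subseteq> quot A (t * x)"
proof
  fix r assume "r \<in> quot A x"
  then have "t * (r * x) \<in> A" using ideal_mult_left[OF assms, of "r * x" t] by (simp add: quot_def)
  then show "r \<in> quot A (t * x)" by (simp add: quot_def mult.left_commute)
qed

lemma quot_one [simp]: "quot A 1 = A"
  by (auto simp: quot_def)

lemma gen_insert_iff: "is_ideal A \<Longrightarrow> y \<in> gen (insert x A) \<longleftrightarrow> (\<exists>r. y - r * x \<in> A)"
  by (simp add: idl.span_breakdown_eq idl.span_eq_iff[THEN iffD2])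

lemma gen_insert_superset: "A \<subseteq> gen (insert x A)"
  using idl.span_superset[of "insert x A"] by blast

lemma gen_insert_mem: "x \<in> gen (insert x A)"
  by (rule idl.span_base) simp

lemma gen_insert_minimal: "is_ideal B \<Longrightarrow> A \<subseteq> B \<Longrightarrow> x \<in> B \<Longrightarrow> gen (insert x A) \<subseteq> B"
  by (rule idl.span_minimal) auto

lemma gen_ideal_eq [simp]: "is_ideal A \<Longrightarrow> gen A = A"
  by (simp add: idl.span_eq_iff)

lemma prime_idealD:
  assumes "prime_ideal P"
  shows "is_ideal P" "1 \<notin> P" "a * b \<in> P \<Longrightarrow> a \<in> P \<or> b \<in> P"
  using assms by (auto simp: prime_ideal_def)

lemma prime_mult_iff: "prime_ideal P \<Longrightarrow> a * b \<in> P \<longleftrightarrow> a \<in> P \<or> b \<in> P"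
  by (meson prime_idealD ideal_mult_left ideal_mult_right)

lemma prime_mult_set: "prime_ideal P \<Longrightarrow> mult_set (- P)"
  by (auto simp: mult_set_def prime_mult_iff prime_idealD)

lemma acc_above_mono: "acc_above K \<Longrightarrow> K \<subseteq> L \<Longrightarrow> acc_above L"
  unfolding acc_above_def by (meson order.trans)

lemma acc_above_maximal:
  assumes "acc_above K" "A0 \<in> \<S>" "\<And>A. A \<in> \<S> \<Longrightarrow> is_ideal A \<and> K \<subseteq> A"
  shows "\<exists>A\<in>\<S>. \<forall>B\<in>\<S>. A \<subseteq> B \<longrightarrow> B = A"
  using assms unfolding acc_above_def by (metis empty_iff)

text \<open>Noetherian induction: above a maximal counterexample there are no further ones.\<close>

lemma acc_above_induct [consumes 3, case_names step]:
  assumes acc: "acc_above K" and A: "is_ideal A" "K \<subseteq> A"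
    and step: "\<And>A. is_ideal A \<Longrightarrow> K \<subseteq> A \<Longrightarrow> (\<And>B. is_ideal B \<Longrightarrow> A \<subset> B \<Longrightarrow> P B) \<Longrightarrow> P A"
  shows "P A"
proof (rule ccontr)
  assume "\<not> P A"
  then have "A \<in> {B. is_ideal B \<and> K \<subseteq> B \<and> \<not> P B}" using A by simp
  from acc_above_maximal[OF acc this]
  obtain M where M: "is_ideal M" "K \<subseteq> M" "\<not> P M"
    and max: "\<And>B. is_ideal B \<Longrightarrow> K \<subseteq> B \<Longrightarrow> \<not> P B \<Longrightarrow> M \<subseteq> B \<Longrightarrow> B = M"
    by auto
  have "P M"
  proof (rule step)
    fix B assume "is_ideal B" "M \<subset> B"
    then show "P B" using max[of B] M(2) by blast
  qed (use M in auto)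
  with M show False by simp
qed

lemma acc_above_chain:
  assumes acc: "acc_above K" and F: "\<And>n. is_ideal (F n)" "\<And>n. K \<subseteq> F n" "\<And>n::nat. F n \<subseteq> F (Suc n)"
  shows "\<exists>n. F (Suc n) = F n"
proof -
  have "F 0 \<in> range F" "\<And>A. A \<in> range F \<Longrightarrow> is_ideal A \<and> K \<subseteq> A" using F by auto
  from acc_above_maximal[OF acc this]
  obtain n where "\<forall>B\<in>range F. F n \<subseteq> B \<longrightarrow> B = F n" by blast
  then show ?thesis using F(3)[of n] by blast
qed

text \<open>An ideal maximal among the \<open>quot A (t * x)\<close> that avoid \<open>S\<close> is
  prime. With \<open>S = {1}\<close> this yields an associated prime; with the complement of a prime
  \<open>M\<close> it yields one inside \<open>M\<close>, which survives localization at
  \<open>M\<close>.\<close>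

lemma exists_prime_quot:
  assumes acc: "acc_above K" and A: "is_ideal A" "K \<subseteq> A" and S: "mult_set S"
    and x: "quot A x \<inter> S = {}"
  obtains t where "prime_ideal (quot A (t * x))" "quot A (t * x) \<inter> S = {}"
    "quot A x \<subseteq> quot A (t * x)"
proof -
  define \<S> where "\<S> = {B. \<exists>t. B = quot A (t * x) \<and> B \<inter> S = {}}"
  have "quot A (1 * x) \<in> \<S>" using x unfolding \<S>_def by (auto intro!: exI[of _ 1])
  moreover have "\<And>B. B \<in> \<S> \<Longrightarrow> is_ideal B \<and> K \<subseteq> B"
    using A quot_ideal quot_superset unfolding \<S>_def by fastforce
  ultimately obtain B where B: "B \<in> \<S>" and max: "\<And>C. C \<in> \<S> \<Longrightarrow> B \<subseteq> C \<Longrightarrow> C = B"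
    using acc_above_maximal[OF acc, of "quot A (1 * x)" \<S>] by metis
  then obtain t where t: "B = quot A (t * x)" "B \<inter> S = {}" by (auto simp: \<S>_def)
  have idB: "is_ideal B" using t quot_ideal A by auto
  have "1 \<in> S" using S by (simp add: mult_set_def)
  have memS: "quot A (u * x) \<inter> S = {} \<Longrightarrow> quot A (u * x) \<in> \<S>" for u
    by (auto simp: \<S>_def)
  have "prime_ideal B"
    unfolding prime_ideal_def
  proof (intro conjI allI impI idB)
    show "1 \<notin> B" using t \<open>1 \<in> S\<close> by auto
    fix a b assume ab: "a * b \<in> B"
    show "a \<in> B \<or> b \<in> B"
    proof (cases "quot A (b * (t * x)) \<inter> S = {}")
      case True
      then have "quot A (b * (t * x)) = B"
        using max[of "quot A (b * (t * x))"] quot_mult[OF A(1), of "t * x" b] t memS[of "b * t"]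
        by (simp add: mult.assoc)
      moreover have "a \<in> quot A (b * (t * x))" using ab by (simp add: quot_def t mult.assoc)
      ultimately show ?thesis by simp
    next
      case False
      \<comment> \<open>Maximality cannot be used for the multiplier \<open>b\<close>, so the
        element \<open>s\<close> of \<open>S\<close> that kills \<open>b * (t * x)\<close> replaces
        it: \<open>quot A (s * (t * x))\<close> contains \<open>b\<close> and still avoids
        \<open>S\<close>, since \<open>S\<close> is multiplicative.\<close>
      then obtain s where s: "s \<in> S" "s * (b * (t * x)) \<in> A" by (auto simp: quot_def)
      have *: "quot A (s * (t * x)) \<inter> S = {}"
      proof (rule ccontr)
        assume "quot A (s * (t * x)) \<inter> S \<noteq> {}"
        then obtain u where "u \<in> S" "u * (s * (t * x)) \<in> A" by (auto simp: quot_def)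
        then have "u * s \<in> B \<inter> S" using S s(1) by (auto simp: t quot_def mult_set_def mult.assoc)
        then show False using t by auto
      qed
      then have "quot A (s * (t * x)) = B"
        using max[of "quot A (s * (t * x))"] quot_mult[OF A(1), of "t * x" s] t memS[of "s * t"]
        by (simp add: mult.assoc)
      moreover have "b \<in> quot A (s * (t * x))"
        using s(2) by (simp add: quot_def algebra_simps)
      ultimately show ?thesis by simp
    qed
  qed
  then show ?thesis using that[of t] t quot_mult[OF A(1), of x t] by auto
qed

lemma exists_prime_quot_below:
  assumes "acc_above K" "is_ideal A" "K \<subseteq> A" "prime_ideal M" "quot A x \<subseteq> M"
  obtains t where "prime_ideal (quot A (t * x))" "quot A (t * x) \<subseteq> M"
    "quot A x \<subseteq> quot A (t * x)"
  using exists_prime_quot[OF assms(1-3) prime_mult_set[OF assms(4)], of x] assms(5)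
  by (metis Diff_Compl Diff_eq_empty_iff Int_commute disjoint_eq_subset_Compl double_compl)

text \<open>Nakayama's lemma for multiplication by a single element; it needs no finite generation
  because the successive quotients \<open>c = x c\<^sub>1 = x\<^sup>2 c\<^sub>2 = \<dots>\<close> generate an ascending chain.\<close>

lemma principal_nakayama:
  assumes acc: "acc_above K" and A: "is_ideal A" "K \<subseteq> A" and S: "mult_set S"
    and Sx: "\<And>s w. s \<in> S \<Longrightarrow> s - w * x \<in> S"
    and step: "\<And>c. c \<in> C \<Longrightarrow> \<exists>s\<in>S. \<exists>c'\<in>C. s * c - x * c' \<in> A"
    and c: "c \<in> C"
  shows "\<exists>s\<in>S. s * c \<in> A"
proof -
  have "\<exists>f. \<forall>n::nat. (f n \<in> C \<and> (n = 0 \<longrightarrow> f n = c)) \<and> (\<exists>s\<in>S. s * f n - x * f (Suc n) \<in> A)"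
    by (rule dependent_nat_choice) (use c step in blast)+
  then obtain f where f: "\<And>n. f n \<in> C" "f 0 = c" "\<And>n. \<exists>s\<in>S. s * f n - x * f (Suc n) \<in> A"
    by blast
  \<comment> \<open>\<open>F n\<close> is the ideal of \<open>f n\<close> in the localization of
    \<open>T/A\<close> at \<open>S\<close>, written without fractions.\<close>
  define F where "F n = {y. \<exists>s\<in>S. \<exists>w. s * y - w * f n \<in> A}" for n
  have S1: "1 \<in> S" and Sm: "\<And>a b. a \<in> S \<Longrightarrow> b \<in> S \<Longrightarrow> a * b \<in> S" using S by (auto simp: mult_set_def)
  have idF: "is_ideal (F n)" for n
  proof (rule idl.subspaceI)
    have "1 * 0 - 0 * f n \<in> A" using ideal_zero[OF A(1)] by simp
    then show "0 \<in> F n" using S1 unfolding F_def by blast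
    fix y assume "y \<in> F n"
    then obtain s w where y: "s \<in> S" "s * y - w * f n \<in> A" by (auto simp: F_def)
    {
      fix z assume "z \<in> F n"
      then obtain s' w' where z: "s' \<in> S" "s' * z - w' * f n \<in> A" by (auto simp: F_def)
      have "s' * (s * y - w * f n) + s * (s' * z - w' * f n) \<in> A"
        using y z A by (intro ideal_add ideal_mult_left) auto
      also have "s' * (s * y - w * f n) + s * (s' * z - w' * f n) = (s * s') * (y + z) - (s' * w + s * w') * f n"
        by (simp add: algebra_simps)
      finally show "y + z \<in> F n" unfolding F_def using Sm y z by blast
    }
    fix r
    have "r * (s * y - w * f n) \<in> A" using y A ideal_mult_left by blast
    also have "r * (s * y - w * f n) = s * (r * y) - (r * w) * f n" by (simp add: algebra_simps)
    finally show "r * y \<in> F n" unfolding F_def using y by blast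
  qed
  have "\<exists>n. F (Suc n) = F n"
  proof (rule acc_above_chain[OF acc idF])
    fix n
    show "K \<subseteq> F n"
    proof
      fix y assume "y \<in> K"
      then have "1 * y - 0 * f n \<in> A" using A by auto
      then show "y \<in> F n" using S1 unfolding F_def by blast
    qed
    show "F n \<subseteq> F (Suc n)"
    proof
      fix y assume "y \<in> F n"
      then obtain s w where y: "s \<in> S" "s * y - w * f n \<in> A" by (auto simp: F_def)
      obtain s' where s': "s' \<in> S" "s' * f n - x * f (Suc n) \<in> A" using f(3) by blast
      have "s' * (s * y - w * f n) + w * (s' * f n - x * f (Suc n)) \<in> A"
        using y s' A by (intro ideal_add ideal_mult_left) auto
      also have "s' * (s * y - w * f n) + w * (s' * f n - x * f (Suc n)) = (s' * s) * y - (w * x) * f (Suc n)"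
        by (simp add: algebra_simps)
      finally show "y \<in> F (Suc n)" unfolding F_def using Sm y s' by blast
    qed
  qed
  then obtain n where n: "F (Suc n) = F n" by blast
  have "1 * f (Suc n) - 1 * f (Suc n) \<in> A" using ideal_zero[OF A(1)] by simp
  then have "f (Suc n) \<in> F (Suc n)" using S1 unfolding F_def by blast
  then have "f (Suc n) \<in> F n" using n by simp
  \<comment> \<open>\<open>f n\<close> is locally a multiple of \<open>x * f (Suc n)\<close>, and
    \<open>f (Suc n)\<close> one of \<open>f n\<close>. So \<open>s' * s - w * x\<close> kills
    \<open>f (Suc n)\<close>, and this factor is in \<open>S\<close> by \<open>Sx\<close>. The
    vanishing then travels down the chain to \<open>f 0 = c\<close>.\<close>
  then obtain s w where sw: "s \<in> S" "s * f (Suc n) - w * f n \<in> A" by (auto simp: F_def)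
  obtain s' where s': "s' \<in> S" "s' * f n - x * f (Suc n) \<in> A" using f(3) by blast
  have "s' * (s * f (Suc n) - w * f n) + w * (s' * f n - x * f (Suc n)) \<in> A"
    using sw s' A by (intro ideal_add ideal_mult_left) auto
  also have "s' * (s * f (Suc n) - w * f n) + w * (s' * f n - x * f (Suc n)) = (s' * s - w * x) * f (Suc n)"
    by (simp add: algebra_simps)
  finally have top: "\<exists>t\<in>S. t * f (Suc n) \<in> A" using Sx Sm sw s' by blast
  have "\<exists>t\<in>S. t * f k \<in> A" if "k \<le> Suc n" for k
    using that
  proof (induction k rule: inc_induct)
    case base then show ?case by (rule top)
  next
    case (step k)
    obtain t where t: "t \<in> S" "t * f (Suc k) \<in> A" using step.IH by blast
    obtain s where s: "s \<in> S" "s * f k - x * f (Suc k) \<in> A" using f(3) by blast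
    have "t * (s * f k - x * f (Suc k)) + x * (t * f (Suc k)) \<in> A"
      by (rule ideal_add[OF A(1) ideal_mult_left[OF A(1) s(2)] ideal_mult_left[OF A(1) t(2)]])
    also have "t * (s * f k - x * f (Suc k)) + x * (t * f (Suc k)) = (t * s) * f k"
      by (simp add: algebra_simps)
    finally show ?case using Sm t s by blast
  qed
  from this[of 0] f(2) show ?thesis by simp
qed

lemma prime_diff_not_mem:
  assumes "prime_ideal M" "x \<in> M" "s \<notin> M"
  shows "s - w * x \<notin> M"
  using assms ideal_add[of M "s - w * x" "w * x"] prime_idealD(1) ideal_mult_left by fastforce

lemma principal_nakayama_prime:
  assumes acc: "acc_above K" and A: "is_ideal A" "K \<subseteq> A" and M: "prime_ideal M" "x \<in> M"
    and step: "\<And>c. c \<in> C \<Longrightarrow> \<exists>s. s \<notin> M \<and> (\<exists>c'\<in>C. s * c - x * c' \<in> A)"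
    and c: "c \<in> C"
  shows "\<exists>s. s \<notin> M \<and> s * c \<in> A"
  using principal_nakayama[OF acc A prime_mult_set[OF M(1)], of x C c] step c
    prime_diff_not_mem[OF M] by blast

section \<open>Krull's principal ideal theorem and regular sequences of primes\<close>

definition saturated :: "'a::comm_ring_1 set \<Rightarrow> 'a set \<Rightarrow> bool" where
  "saturated M A \<longleftrightarrow> is_ideal A \<and> (\<forall>s r. s \<notin> M \<and> s * r \<in> A \<longrightarrow> r \<in> A)"

definition satur :: "'a::comm_ring_1 set \<Rightarrow> 'a set \<Rightarrow> 'a set" where
  "satur M A = {r. \<exists>s. s \<notin> M \<and> s * r \<in> A}"

lemma saturatedD: "saturated M A \<Longrightarrow> s \<notin> M \<Longrightarrow> s * r \<in> A \<Longrightarrow> r \<in> A"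
  by (auto simp: saturated_def)

lemma saturI: "s \<notin> M \<Longrightarrow> s * r \<in> A \<Longrightarrow> r \<in> satur M A"
  by (auto simp: satur_def)

lemma satur_superset: "prime_ideal M \<Longrightarrow> A \<subseteq> satur M A"
  by (auto simp: satur_def intro!: exI[of _ 1] prime_idealD)

lemma satur_ideal:
  assumes M: "prime_ideal M" and A: "is_ideal A" shows "is_ideal (satur M A)"
proof (rule idl.subspaceI)
  show "0 \<in> satur M A" using satur_superset[OF M, of A] ideal_zero[OF A] by auto
next
  fix x y assume "x \<in> satur M A" "y \<in> satur M A"
  then obtain s t where st: "s \<notin> M" "s * x \<in> A" "t \<notin> M" "t * y \<in> A" by (auto simp: satur_def)
  have "t * (s * x) + s * (t * y) \<in> A"
    by (rule ideal_add[OF A ideal_mult_left[OF A st(2)] ideal_mult_left[OF A st(4)]])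
  then have "(s * t) * (x + y) \<in> A" by (simp add: algebra_simps)
  then show "x + y \<in> satur M A" using st prime_mult_iff[OF M] by (intro saturI[of "s * t"]) auto
next
  fix c x assume "x \<in> satur M A"
  then obtain s where s: "s \<notin> M" "s * x \<in> A" by (auto simp: satur_def)
  have "s * (c * x) \<in> A" using ideal_mult_left[OF A s(2), of c] by (simp add: algebra_simps)
  then show "c * x \<in> satur M A" by (rule saturI[OF s(1)])
qed

lemma satur_saturated:
  assumes M: "prime_ideal M" and A: "is_ideal A" shows "saturated M (satur M A)"
  unfolding saturated_def
proof (intro conjI allI impI satur_ideal assms)
  fix s r assume "s \<notin> M \<and> s * r \<in> satur M A"
  then obtain t where "s \<notin> M" "t \<notin> M" "t * (s * r) \<in> A" by (auto simp: satur_def)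
  then show "r \<in> satur M A"
    using prime_mult_iff[OF M] by (intro saturI[of "t * s"]) (auto simp: mult.assoc)
qed

lemma satur_minimal: "saturated M B \<Longrightarrow> A \<subseteq> B \<Longrightarrow> satur M A \<subseteq> B"
  by (auto simp: satur_def dest: saturatedD)

lemma satur_mono: "A \<subseteq> B \<Longrightarrow> satur M A \<subseteq> satur M B"
  by (auto simp: satur_def)

text \<open>Saturated ideals are the ideals of the localization at \<open>M\<close>; the hypothesis makes that
  localization of \<open>T/A\<close> Artinian. Induct on \<open>A\<close> along \<open>A \<subset> A + (x)\<close> with simple quotient.\<close>

lemma dcc_saturated:
  assumes acc: "acc_above K" and M: "prime_ideal M" and A: "is_ideal A" "K \<subseteq> A"
    and sat: "saturated M A"
    and min: "\<And>P. prime_ideal P \<Longrightarrow> A \<subseteq> P \<Longrightarrow> P \<subseteq> M \<Longrightarrow> P = M"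
    and J: "\<And>n. saturated M (J n)" "\<And>n. A \<subseteq> J n" "\<And>n::nat. J (Suc n) \<subseteq> J n"
  shows "\<exists>N. \<forall>n\<ge>N. J n = J N"
  using acc A sat min J
proof (induction A arbitrary: J rule: acc_above_induct)
  case (step A)
  note A = step.hyps(1,2) and sat = step.prems(1) and min = step.prems(2) and J = step.prems(3-5)
  have Jid: "is_ideal (J n)" for n using J(1) by (auto simp: saturated_def)
  have anti: "m \<le> n \<Longrightarrow> J n \<subseteq> J m" for m n
    using J(3) by (rule lift_Suc_antimono_le)
  show ?case
  proof (cases "1 \<in> A")
    case True
    then have "J n = UNIV" for n using J(2)[of n] ideal_eq_UNIV[OF Jid[of n]] by auto
    then show ?thesis by simp
  next
    case False
    have "A \<subseteq> M"
    proof
      fix s assume "s \<in> A"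
      then show "s \<in> M" using saturatedD[OF sat, of s 1] False by auto
    qed
    then obtain x where x: "prime_ideal (quot A x)" "A \<subseteq> quot A x" "quot A x \<subseteq> M"
      using exists_prime_quot_below[OF acc A M, of 1] by (metis mult.right_neutral quot_one)
    \<comment> \<open>So \<open>x\<close> spans a copy of the residue field of the localization at
      \<open>M\<close>, and no saturated ideal lies strictly between \<open>A\<close> and
      \<open>A'\<close>; the fact \<open>simple\<close> expresses this.\<close>
    have qM: "quot A x = M" using min[OF x] .
    have xA: "x \<notin> A" using prime_idealD(2)[OF x(1)] by (auto simp: quot_def)
    define A' where "A' = satur M (gen (insert x A))"
    have A': "is_ideal A'" "saturated M A'" "A \<subset> A'"
      using satur_ideal[OF M] satur_saturated[OF M] satur_superset[OF M, of "gen (insert x A)"]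
        gen_insert_superset[of A x] gen_insert_mem[of x A] xA by (auto simp: A'_def)
    have simple: "A' \<subseteq> B" if B: "saturated M B" "A \<subseteq> B" "b \<in> B" "b \<in> A'" "b \<notin> A" for B b
    proof -
      have Bid: "is_ideal B" using B by (auto simp: saturated_def)
      obtain s r where s: "s \<notin> M" "s * b - r * x \<in> A"
        using B(4) by (auto simp: A'_def satur_def gen_insert_iff[OF A(1)])
      have "r \<notin> M"
      proof
        assume "r \<in> M"
        then have "r * x \<in> A" using qM by (auto simp: quot_def)
        then have "s * b \<in> A" using ideal_add[OF A(1) s(2)] by fastforce
        then show False using saturatedD[OF sat s(1)] B by auto
      qed
      moreover have "r * x \<in> B"
        using ideal_diff[OF Bid ideal_mult_left[OF Bid B(3), of s], of "s * b - r * x"] s B(2) by auto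
      ultimately have "x \<in> B" using saturatedD[OF B(1)] by blast
      then have "gen (insert x A) \<subseteq> B" using gen_insert_minimal[OF Bid B(2)] by auto
      then show ?thesis unfolding A'_def by (rule satur_minimal[OF B(1)])
    qed
    define J' where "J' n = satur M (gen (J n \<union> A'))" for n
    have "\<exists>N. \<forall>n\<ge>N. J' n = J' N"
    proof (rule step.IH[OF A'(1,3,2)])
      fix n
      show "saturated M (J' n)" unfolding J'_def by (rule satur_saturated[OF M]) auto
      show "A' \<subseteq> J' n"
        unfolding J'_def using satur_superset[OF M, of "gen (J n \<union> A')"] idl.span_superset[of "J n \<union> A'"]
        by blast
      show "J' (Suc n) \<subseteq> J' n" unfolding J'_def
        using J(3)[of n] by (intro satur_mono idl.span_mono) auto
    next
      fix P assume "prime_ideal P" "A' \<subseteq> P" "P \<subseteq> M"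
      then show "P = M" using min[of P] A'(3) by blast
    qed
    then obtain N1 where N1: "\<forall>n\<ge>N1. J' n = J' N1" by blast
    have "\<exists>N. \<forall>n\<ge>N. J n \<inter> A' = J N \<inter> A'"
    proof (cases "\<forall>n. A' \<subseteq> J n")
      case True then show ?thesis by (metis inf.absorb2)
    next
      case False
      then obtain n0 where n0: "\<not> A' \<subseteq> J n0" by blast
      have "J n \<inter> A' = A" if "n \<ge> n0" for n
        using simple[OF J(1) J(2), of _ n] n0 anti[OF that] J(2)[of n] A'(3) by blast
      then show ?thesis by (intro exI[of _ n0]) auto
    qed
    then obtain N2 where N2: "\<forall>n\<ge>N2. J n \<inter> A' = J N2 \<inter> A'" by blast
    \<comment> \<open>By the modular law a descending sequence is constant once its sums with
      \<open>A'\<close> and its intersections with \<open>A'\<close> are. The sums are settled by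
      induction, the intersections by \<open>simple\<close>.\<close>
    define N where "N = max N1 N2"
    have "J N \<subseteq> J n" if n: "n \<ge> N" for n
    proof
      fix j assume j: "j \<in> J N"
      then have "j \<in> J' N" unfolding J'_def
        using satur_superset[OF M, of "gen (J N \<union> A')"] idl.span_superset[of "J N \<union> A'"] by blast
      also have "J' N = J' n" using N1 n unfolding N_def by (metis max.bounded_iff order_refl)
      finally obtain s where s: "s \<notin> M" "s * j \<in> gen (J n \<union> A')" by (auto simp: J'_def satur_def)
      then obtain a b where ab: "s * j = a + b" "a \<in> J n" "b \<in> A'"
        using Jid[of n] A'(1) by (auto simp: idl.span_Un gen_ideal_eq)
      have "b \<in> J N"
      proof -
        have "a \<in> J N" using anti[OF n] ab by auto
        then have "s * j - a \<in> J N" using ideal_diff[OF Jid ideal_mult_left[OF Jid j]] by blast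
        then show ?thesis using ab by simp
      qed
      moreover have "J n \<inter> A' = J N2 \<inter> A'" "J N \<inter> A' = J N2 \<inter> A'"
        using N2 n unfolding N_def by (metis max.bounded_iff order_refl)+
      ultimately have "b \<in> J n" using ab(3) by blast
      then have "s * j \<in> J n" using ab ideal_add[OF Jid] by simp
      then show "j \<in> J n" using saturatedD[OF J(1) s(1)] by blast
    qed
    then show ?thesis using anti by (intro exI[of _ N]) blast
  qed
qed

text \<open>Krull's principal ideal theorem, in the form: between \<open>P0\<close> and \<open>P2\<close> the middle prime can be
  exchanged for one through \<open>x\<close>. The proof compares symbolic powers of a single element \<open>y\<close>.\<close>

lemma prime_exchange:
  assumes acc: "acc_above K" and KP0: "K \<subseteq> P0"
    and P: "prime_ideal P0" "prime_ideal P1" "prime_ideal P2" "P0 \<subset> P1" "P1 \<subset> P2"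
    and x: "x \<in> P2" "x \<notin> P0"
  obtains P' where "prime_ideal P'" "x \<in> P'" "P0 \<subset> P'" "P' \<subset> P2"
proof (cases "\<exists>P'. prime_ideal P' \<and> x \<in> P' \<and> P0 \<subset> P' \<and> P' \<subset> P2")
  case True then show ?thesis using that by blast
next
  case no: False
  then have xP1: "x \<notin> P1" using P by blast
  \<comment> \<open>If no exchange is possible, \<open>P2\<close> is minimal over \<open>x\<close>
    and \<open>P0\<close>, which is what \<open>dcc_saturated\<close> asks for.\<close>
  have min: "P' = P2" if "prime_ideal P'" "gen (insert x P0) \<subseteq> P'" "P' \<subseteq> P2" for P'
    using no that gen_insert_superset[of P0 x] gen_insert_mem[of x P0] x by blast
  have id0: "is_ideal P0" using P(1) by (rule prime_idealD)
  obtain y where y: "y \<in> P1" "y \<notin> P0" using P by blast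
  have yn: "y ^ n \<notin> P0" for n
    by (induction n) (auto simp: prime_idealD(2)[OF P(1)] prime_mult_iff[OF P(1)] y)
  define Y where "Y n = satur P1 (gen (insert (y ^ n) P0))" for n
  have Yid: "is_ideal (Y n)" for n unfolding Y_def by (rule satur_ideal[OF P(2)]) auto
  have Ysat: "saturated P1 (Y n)" for n unfolding Y_def by (rule satur_saturated[OF P(2)]) auto
  have P0Y: "P0 \<subseteq> Y n" for n unfolding Y_def
    using satur_superset[OF P(2)] gen_insert_superset[of P0] by blast
  have "y ^ n \<in> gen (insert (y ^ n) P0)" for n by (rule gen_insert_mem)
  then have "gen (insert (y ^ Suc n) P0) \<subseteq> gen (insert (y ^ n) P0)" for n
    by (intro gen_insert_minimal gen_insert_superset) (auto intro: ideal_mult_left)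
  then have Ydec: "Y (Suc n) \<subseteq> Y n" for n unfolding Y_def by (intro satur_mono)
  define A where "A = satur P2 (gen (insert x P0))"
  define J where "J n = satur P2 (gen (insert x (Y n)))" for n
  have K': "K \<subseteq> A" unfolding A_def
    using KP0 gen_insert_superset[of P0 x] satur_superset[OF P(3), of "gen (insert x P0)"] by blast
  have "\<exists>N. \<forall>n\<ge>N. J n = J N"
  proof (rule dcc_saturated[OF acc P(3) _ K'])
    show "is_ideal A" "saturated P2 A" unfolding A_def
      using satur_ideal[OF P(3)] satur_saturated[OF P(3)] by auto
    show "P' = P2" if "prime_ideal P'" "A \<subseteq> P'" "P' \<subseteq> P2" for P'
      using min[OF that(1) _ that(3)] that(2) satur_superset[OF P(3), of "gen (insert x P0)"]
      unfolding A_def by blast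
    show "saturated P2 (J n)" for n unfolding J_def by (rule satur_saturated[OF P(3)]) auto
    show "A \<subseteq> J n" for n unfolding A_def J_def
      using P0Y[of n] by (intro satur_mono idl.span_mono) auto
    show "J (Suc n) \<subseteq> J n" for n unfolding J_def
      using Ydec[of n] by (intro satur_mono idl.span_mono) auto
  qed
  \<comment> \<open>Now \<open>Y n\<close> lies in \<open>Y (Suc n) + (x)\<close> locally at
    \<open>P2\<close>. Since \<open>x\<close> is outside \<open>P1\<close>, the coefficient of
    \<open>x\<close> is again in \<open>Y n\<close>, so \<open>Y n = Y (Suc n) + x Y n\<close>
    locally, and Nakayama removes the second summand.\<close>
  then obtain n where n: "J n = J (Suc n)" by (metis le_SucI order_refl)
  have "\<exists>s. s \<notin> P2 \<and> s * c \<in> Y (Suc n)" if c: "c \<in> Y n" for c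
  proof (rule principal_nakayama_prime[OF acc Yid _ P(3) x(1) _ c])
    show "K \<subseteq> Y (Suc n)" using KP0 P0Y by blast
    fix c assume c: "c \<in> Y n"
    then have "c \<in> J n" unfolding J_def
      using satur_superset[OF P(3), of "gen (insert x (Y n))"] gen_insert_superset[of "Y n" x] by blast
    then obtain s r where s: "s \<notin> P2" "s * c - r * x \<in> Y (Suc n)"
      unfolding n by (auto simp: J_def satur_def gen_insert_iff[OF Yid])
    have "s * c - r * x \<in> Y n" using s(2) Ydec[of n] by blast
    then have "s * c - (s * c - r * x) \<in> Y n"
      by (rule ideal_diff[OF Yid ideal_mult_left[OF Yid c]])
    then have "x * r \<in> Y n" by (simp add: mult.commute)
    then have "r \<in> Y n" using saturatedD[OF Ysat xP1] by blast
    then show "\<exists>s. s \<notin> P2 \<and> (\<exists>c'\<in>Y n. s * c - x * c' \<in> Y (Suc n))"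
      using s by (auto simp: mult.commute intro!: exI[of _ s])
  qed
  moreover have "y ^ n \<in> Y n" unfolding Y_def
    using satur_superset[OF P(2)] gen_insert_mem by blast
  ultimately obtain s where s: "s \<notin> P2" "s * y ^ n \<in> Y (Suc n)" by blast
  \<comment> \<open>Locally at \<open>P1\<close> the power \<open>y ^ n\<close> is thus a multiple
    of \<open>y ^ Suc n\<close> modulo the prime \<open>P0\<close>. Cancelling \<open>y ^ n\<close>
    would make \<open>y\<close>, an element of \<open>P1\<close>, a unit there.\<close>
  then have "y ^ n \<in> Y (Suc n)" using saturatedD[OF Ysat] P(5) by blast
  then obtain t r where t: "t \<notin> P1" "t * y ^ n - r * y ^ Suc n \<in> P0"
    by (auto simp: Y_def satur_def gen_insert_iff[OF id0])
  have "(t - r * y) * y ^ n \<in> P0" using t(2) by (simp add: algebra_simps)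
  then have "t - r * y \<in> P0" using prime_mult_iff[OF P(1)] yn by blast
  then have "t - r * y \<in> P1" using P(4) by blast
  then show ?thesis using prime_diff_not_mem[OF P(2) y(1) t(1)] by blast
qed

lemma insert_set_remove1: "x \<in> set xs \<Longrightarrow> insert x (set (remove1 x xs)) = set xs"
  by (induction xs) auto

lemma chain_strict:
  assumes "\<And>i. i < n \<Longrightarrow> P i \<subset> P (Suc i)" shows "n = 0 \<or> P 0 \<subset> P n"
  using assms
proof (induction n)
  case (Suc n)
  then have "n = 0 \<or> P 0 \<subset> P n" by simp
  moreover have "P n \<subset> P (Suc n)" using Suc.prems by simp
  ultimately show ?case by auto
qed simp

text \<open>The exchange works from the top down: the chain from \<open>P 1\<close> on is first
  replaced by one whose lowest prime \<open>Q 0\<close> contains \<open>x\<close>, and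
  \<open>prime_exchange\<close> between \<open>P 0\<close> and \<open>Q 0\<close> then trades
  \<open>P 1\<close> for a prime through \<open>x\<close>. The top is kept and only the bottom is
  lost.\<close>

lemma prime_exchange_chain:
  assumes acc: "acc_above K" and K: "K \<subseteq> P 0"
    and P: "\<And>i. i \<le> Suc n \<Longrightarrow> prime_ideal (P i)" "\<And>i. i < Suc n \<Longrightarrow> P i \<subset> P (Suc i)"
    and x: "x \<in> P (Suc n)" "x \<notin> P 0"
  shows "\<exists>Q. (\<forall>i\<le>n. prime_ideal (Q i)) \<and> (\<forall>i<n. Q i \<subset> Q (Suc i)) \<and> Q n = P (Suc n)
     \<and> x \<in> Q 0 \<and> P 0 \<subset> Q 0"
  using K P x
proof (induction n arbitrary: P)
  case 0
  then show ?case by (intro exI[of _ "\<lambda>i. P (Suc i)"]) auto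
next
  case (Suc n)
  note P = Suc.prems(2,3)
  show ?case
  proof (cases "x \<in> P 1")
    case True
    then show ?thesis using P P(2)[of 0] by (intro exI[of _ "\<lambda>i. P (Suc i)"]) auto
  next
    case False
    have "\<exists>Q. (\<forall>i\<le>n. prime_ideal (Q i)) \<and> (\<forall>i<n. Q i \<subset> Q (Suc i)) \<and> Q n = P (Suc (Suc n))
       \<and> x \<in> Q 0 \<and> P (Suc 0) \<subset> Q 0"
      using Suc.prems P(2)[of 0] False by (intro Suc.IH[of "\<lambda>i. P (Suc i)"]) auto
    then obtain Q where Q: "\<And>i. i \<le> n \<Longrightarrow> prime_ideal (Q i)" "\<And>i. i < n \<Longrightarrow> Q i \<subset> Q (Suc i)"
      "Q n = P (Suc (Suc n))" "x \<in> Q 0" "P 1 \<subset> Q 0" by auto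
    obtain P' where P': "prime_ideal P'" "x \<in> P'" "P 0 \<subset> P'" "P' \<subset> Q 0"
      using prime_exchange[OF acc Suc.prems(1) P(1)[of 0] P(1)[of 1] Q(1)[of 0] _ Q(5,4) Suc.prems(5)]
        P(2)[of 0] by auto
    define R where "R i = (case i of 0 \<Rightarrow> P' | Suc j \<Rightarrow> Q j)" for i
    have "\<forall>i\<le>Suc n. prime_ideal (R i)" using P' Q by (auto simp: R_def split: nat.split)
    moreover have "\<forall>i<Suc n. R i \<subset> R (Suc i)"
    proof (intro allI impI)
      fix i assume "i < Suc n"
      then show "R i \<subset> R (Suc i)" using P'(4) Q(2) by (cases i) (auto simp: R_def)
    qed
    ultimately show ?thesis using P' Q(3) by (intro exI[of _ R]) (auto simp: R_def)
  qed
qed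

text \<open>Krull's height theorem: some generator \<open>x\<close> is outside \<open>P 0\<close>,
  and the chain exchanged to start above \<open>x\<close> is shorter by one and needs one generator
  less.\<close>

lemma chain_length_bound:
  assumes acc: "acc_above K" and K: "K \<subseteq> P 0"
    and P: "\<And>i. i \<le> n \<Longrightarrow> prime_ideal (P i)" "\<And>i. i < n \<Longrightarrow> P i \<subset> P (Suc i)"
    and gen: "P n = gen (P 0 \<union> set xs)"
  shows "n \<le> length xs"
  using K P gen
proof (induction "length xs" arbitrary: n xs P rule: less_induct)
  case less
  note P = less.prems(2,3)
  show ?case
  proof (cases n)
    case (Suc k)
    have "P 0 \<subset> P n"
      using chain_strict[of n P] P(2) Suc by auto
    then have "\<exists>x\<in>set xs. x \<notin> P 0"
      using less.prems(4) gen_ideal_eq[OF prime_idealD(1)[OF P(1)[of 0]]]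
      by (metis Un_absorb2 le0 psubset_eq subsetI)
    then obtain x where x: "x \<in> set xs" "x \<notin> P 0" by blast
    have "x \<in> P n" using x less.prems(4) idl.span_superset[of "P 0 \<union> set xs"] by blast
    then obtain Q where Q: "\<And>i. i \<le> k \<Longrightarrow> prime_ideal (Q i)" "\<And>i. i < k \<Longrightarrow> Q i \<subset> Q (Suc i)"
      "Q k = P n" "x \<in> Q 0" "P 0 \<subset> Q 0"
      using prime_exchange_chain[of K P k x, OF acc less.prems(1)] P x unfolding Suc by metis
    have "Q 0 \<subseteq> Q k" using chain_strict[of k Q] Q(2) by auto
    have "Q k = gen (Q 0 \<union> set (remove1 x xs))"
    proof
      have idn: "is_ideal (P n)" using P(1) prime_idealD by blast
      show "gen (Q 0 \<union> set (remove1 x xs)) \<subseteq> Q k"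
        unfolding Q(3) using \<open>Q 0 \<subseteq> Q k\<close> idn idl.span_superset[of "P 0 \<union> set xs"] set_remove1_subset[of x xs]
        by (intro idl.span_minimal) (auto simp: Q(3) less.prems(4))
      have "insert x (set (remove1 x xs)) \<supseteq> set xs" by (metis insertCI in_set_remove1 subsetI)
      then have "P 0 \<union> set xs \<subseteq> Q 0 \<union> set (remove1 x xs)" using Q(4,5) by blast
      then show "Q k \<subseteq> gen (Q 0 \<union> set (remove1 x xs))"
        unfolding Q(3) less.prems(4) by (rule idl.span_mono)
    qed
    moreover have "length (remove1 x xs) < length xs" using x by (simp add: length_remove1)
        (metis One_nat_def diff_less length_pos_if_in_set zero_less_one)
    moreover have "K \<subseteq> Q 0" using Q(5) less.prems(1) by blast
    ultimately have "k \<le> length (remove1 x xs)" using less.hyps[of "remove1 x xs" Q k] Q by blast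
    then show ?thesis using Suc \<open>length (remove1 x xs) < length xs\<close> by simp
  qed simp
qed

lemma local_cancel:
  assumes loc: "\<And>s. s \<notin> M \<Longrightarrow> \<exists>u. 1 - u * s \<in> K" and A: "is_ideal A" "K \<subseteq> A"
    and s: "s \<notin> M" "s * c \<in> A"
  shows "c \<in> A"
proof -
  obtain u where u: "1 - u * s \<in> K" using loc s(1) by blast
  have "c * (1 - u * s) + u * (s * c) \<in> A"
    using u A(2) by (intro ideal_add[OF A(1)] ideal_mult_left[OF A(1)] s(2)) auto
  then show ?thesis by (simp add: algebra_simps)
qed

text \<open>The dimension of a regular local ring forces the generators of its maximal ideal,
  suitably ordered, to generate primes one after the other.\<close>

lemma regular_local_primes:
  assumes acc: "acc_above K" and loc: "\<And>s. s \<notin> M \<Longrightarrow> \<exists>u. 1 - u * s \<in> K"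
    and A: "is_ideal A" "K \<subseteq> A" "A \<subseteq> P 0"
    and P: "\<And>i. i \<le> length xs \<Longrightarrow> prime_ideal (P i)" "\<And>i. i < length xs \<Longrightarrow> P i \<subset> P (Suc i)"
    and M: "P (length xs) = M" "M = gen (A \<union> set xs)"
  shows "A = P 0 \<and> (\<exists>ys. length ys = length xs \<and> M = gen (A \<union> set ys)
     \<and> (\<forall>i\<le>length ys. prime_ideal (gen (A \<union> set (take i ys))))
     \<and> (\<forall>i<length ys. ys ! i \<notin> gen (A \<union> set (take i ys))))"
  using A P M
proof (induction "length xs" arbitrary: xs A P)
  case 0
  have "M = A" using 0(1,2,8) by simp
  moreover have "M = P 0" using 0(1,7) by simp
  ultimately show ?case using 0(1,2) 0(5)[of 0] by (auto intro!: exI[of _ "[]"])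
next
  case (Suc n)
  note A = Suc.prems(1-3) and P = Suc.prems(4,5) and M = Suc.prems(6,7)
  have len: "length xs = Suc n" using Suc.hyps(2) by simp
  have PM: "prime_ideal M" using P(1) M(1) by blast
  have "P 0 \<subset> P (length xs)"
    using chain_strict[of "length xs" P] P(2) len by auto
  then have ne: "P 0 \<subset> M" using M by simp
  have id0: "is_ideal (P 0)" using P(1)[of 0] prime_idealD by blast
  have "\<not> set xs \<subseteq> P 0"
  proof
    assume "set xs \<subseteq> P 0"
    then have "M \<subseteq> P 0" unfolding M(2) using A(3) by (intro idl.span_minimal id0) auto
    then show False using ne by blast
  qed
  then obtain x where x: "x \<in> set xs" "x \<notin> P 0" by blast
  have xM: "x \<in> M" using x M(2) idl.span_superset[of "A \<union> set xs"] by blast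
  \<comment> \<open>The exchanged chain has one prime less, and over \<open>A'\<close> the ideal
    \<open>M\<close> needs one generator less. The induction hypothesis therefore identifies
    \<open>A'\<close> with the prime \<open>Q 0\<close>.\<close>
  obtain Q where Q: "\<And>i. i \<le> n \<Longrightarrow> prime_ideal (Q i)" "\<And>i. i < n \<Longrightarrow> Q i \<subset> Q (Suc i)"
      "Q n = M" "x \<in> Q 0" "P 0 \<subset> Q 0"
    using prime_exchange_chain[OF acc, of P n x] A P x xM M(1) unfolding len by (metis order.trans)
  define A' where "A' = gen (insert x A)"
  have genA': "gen (A' \<union> S) = gen (A \<union> insert x S)" for S
  proof
    show "gen (A' \<union> S) \<subseteq> gen (A \<union> insert x S)"
      unfolding A'_def using idl.span_superset[of "A \<union> insert x S"]
        idl.span_mono[of "insert x A" "A \<union> insert x S"]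
      by (intro idl.span_minimal) auto
    show "gen (A \<union> insert x S) \<subseteq> gen (A' \<union> S)"
      unfolding A'_def using gen_insert_superset[of A x] gen_insert_mem[of x A]
      by (intro idl.span_mono) auto
  qed
  have A': "is_ideal A'" "A \<subseteq> A'" "x \<in> A'"
    unfolding A'_def using gen_insert_superset[of A x] gen_insert_mem[of x A] by auto
  have A'Q: "A' \<subseteq> Q 0"
    unfolding A'_def using A(3) Q(4,5) prime_idealD(1)[OF Q(1)[of 0]]
    by (intro gen_insert_minimal) auto
  have len': "length (remove1 x xs) = n" using x len by (simp add: length_remove1)
  have "insert x (set (remove1 x xs)) = set xs"
    using x insert_set_remove1 by metis
  then have M': "M = gen (A' \<union> set (remove1 x xs))" unfolding genA' M(2) by simp
  have "K \<subseteq> A'" using A(2) A'(2) by blast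
  then have IH: "A' = Q 0 \<and> (\<exists>ys. length ys = length (remove1 x xs) \<and> M = gen (A' \<union> set ys)
     \<and> (\<forall>i\<le>length ys. prime_ideal (gen (A' \<union> set (take i ys))))
     \<and> (\<forall>i<length ys. ys ! i \<notin> gen (A' \<union> set (take i ys))))"
    using Q(1,2,3) by (intro Suc.hyps(1)[of "remove1 x xs" A' Q] A'(1) A'Q M') (auto simp: len')
  then obtain ys where ys: "length ys = n" "M = gen (A' \<union> set ys)"
    "\<And>i. i \<le> n \<Longrightarrow> prime_ideal (gen (A' \<union> set (take i ys)))"
    "\<And>i. i < n \<Longrightarrow> ys ! i \<notin> gen (A' \<union> set (take i ys))" by (auto simp: len')
  \<comment> \<open>\<open>P 0\<close> lies in \<open>A + (x)\<close> and \<open>x\<close> is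
    outside the prime \<open>P 0\<close>, hence \<open>P 0 = A + x P 0\<close>, and Nakayama gives
    \<open>P 0 = A\<close>.\<close>
  have "P 0 \<subseteq> A"
  proof
    fix c assume c: "c \<in> P 0"
    have "\<exists>s. s \<notin> M \<and> s * c \<in> A"
    proof (rule principal_nakayama_prime[OF acc A(1,2) PM xM _ c])
      fix c assume c: "c \<in> P 0"
      then have "c \<in> A'" using IH Q(5) by blast
      then obtain r where r: "c - r * x \<in> A" by (auto simp: A'_def gen_insert_iff[OF A(1)])
      then have "c - r * x \<in> P 0" using A(3) by blast
      then have "c - (c - r * x) \<in> P 0" by (rule ideal_diff[OF id0 c])
      then have "r \<in> P 0" using prime_mult_iff[OF P(1)[of 0]] x by simp
      then show "\<exists>s. s \<notin> M \<and> (\<exists>c'\<in>P 0. s * c - x * c' \<in> A)"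
        using r prime_idealD(2)[OF PM] by (intro exI[of _ 1]) (auto simp: mult.commute)
    qed
    then show "c \<in> A" using local_cancel[OF loc A(1,2)] by blast
  qed
  then have AP: "A = P 0" using A(3) by blast
  have "prime_ideal (gen (A \<union> set (take i (x # ys))))" if "i \<le> Suc n" for i
  proof (cases i)
    case 0
    then show ?thesis using AP P(1)[of 0] id0 by simp
  next
    case (Suc j)
    then show ?thesis using ys(3)[of j] that by (simp add: genA')
  qed
  moreover have "(x # ys) ! i \<notin> gen (A \<union> set (take i (x # ys)))" if "i < Suc n" for i
  proof (cases i)
    case 0
    then show ?thesis using AP x id0 by simp
  next
    case (Suc j)
    then show ?thesis using ys(4)[of j] that by (simp add: genA')
  qed
  ultimately show ?case
    using AP ys(1,2) by (intro conjI exI[of _ "x # ys"]) (auto simp: len genA')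
qed

section \<open>Minors and McCoy's theorem\<close>

text \<open>Determinant of the submatrix with the listed rows and the given columns, by Laplace
  expansion along the first row. Lists with repeated rows are allowed on purpose: McCoy's argument
  below then needs no alternation.\<close>

primrec minor :: "('i \<Rightarrow> nat \<Rightarrow> 'a::comm_ring_1) \<Rightarrow> 'i list \<Rightarrow> nat set \<Rightarrow> 'a" where
  "minor V [] C = 1"
| "minor V (i # is) C = (\<Sum>k\<in>C. (-1) ^ card {c\<in>C. c < k} * (V i k * minor V is (C - {k})))"

text \<open>The pairs \<open>(k, l)\<close> and \<open>(l, k)\<close> cancel; peeling off one index
  at a time avoids a division by two.\<close>

lemma sum_off_diagonal_zero:
  fixes f :: "nat \<Rightarrow> nat \<Rightarrow> 'a::comm_ring_1"
  assumes "finite C" "\<And>k l. k \<in> C \<Longrightarrow> l \<in> C \<Longrightarrow> k \<noteq> l \<Longrightarrow> f k l + f l k = 0"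
  shows "(\<Sum>k\<in>C. \<Sum>l\<in>C - {k}. f k l) = 0"
  using assms
proof (induction C rule: finite_induct)
  case (insert x C)
  have *: "(\<Sum>l\<in>insert x C - {k}. f k l) = f k x + (\<Sum>l\<in>C - {k}. f k l)" if "k \<in> C" for k
  proof -
    have "insert x C - {k} = insert x (C - {k})" using that insert.hyps by auto
    then show ?thesis using insert.hyps by simp
  qed
  have "insert x C - {x} = C" using insert.hyps by auto
  then have "(\<Sum>k\<in>insert x C. \<Sum>l\<in>insert x C - {k}. f k l)
      = (\<Sum>l\<in>C. f x l) + (\<Sum>k\<in>C. f k x + (\<Sum>l\<in>C - {k}. f k l))"
    using insert.hyps * by simp
  also have "\<dots> = (\<Sum>l\<in>C. f x l + f l x) + (\<Sum>k\<in>C. \<Sum>l\<in>C - {k}. f k l)"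
    by (simp add: sum.distrib add.assoc)
  also have "(\<Sum>l\<in>C. f x l + f l x) = 0"
    using insert by (intro sum.neutral) auto
  finally show ?case using insert by simp
qed simp

text \<open>Deleting the smaller column moves the larger one down by one position, but not
  conversely, so the sign of a double expansion changes when the two columns are exchanged.\<close>

lemma sign_exchange:
  fixes C :: "nat set"
  assumes "finite C" "k \<in> C" "l \<in> C" "k < l"
  shows "(-1) ^ card {c\<in>C. c < k} * (-1) ^ card {c\<in>C - {k}. c < l}
     = - ((-1) ^ card {c\<in>C. c < l} * (-1) ^ card {c\<in>C - {l}. c < k} :: 'a::comm_ring_1)"
proof -
  have "{c\<in>C. c < l} = insert k {c\<in>C - {k}. c < l}" using assms by auto
  then have "card {c\<in>C. c < l} = Suc (card {c\<in>C - {k}. c < l})" using assms by simp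
  moreover have "{c\<in>C - {l}. c < k} = {c\<in>C. c < k}"
    by (rule Collect_cong) (use assms(4) in auto)
  ultimately show ?thesis by simp
qed

lemma double_expansion_zero:
  fixes h :: "nat \<Rightarrow> nat \<Rightarrow> 'a::comm_ring_1"
  assumes C: "finite C" and h: "\<And>k l. h k l = h l k"
  shows "(\<Sum>k\<in>C. \<Sum>l\<in>C - {k}.
     ((-1) ^ card {c\<in>C. c < k} * (-1) ^ card {c\<in>C - {k}. c < l}) * h k l) = 0"
proof (rule sum_off_diagonal_zero[OF C])
  fix k l assume kl: "k \<in> C" "l \<in> C" "k \<noteq> l"
  then consider "k < l" | "l < k" by linarith
  then show "((-1) ^ card {c\<in>C. c < k} * (-1) ^ card {c\<in>C - {k}. c < l}) * h k l
     + ((-1) ^ card {c\<in>C. c < l} * (-1) ^ card {c\<in>C - {l}. c < k}) * h l k = 0"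
  proof cases
    case 1 then show ?thesis using sign_exchange[OF C kl(1,2) 1, where 'a='a] h[of k l] by simp
  next
    case 2 then show ?thesis using sign_exchange[OF C kl(2,1) 2, where 'a='a] h[of k l] by simp
  qed
qed

lemma minor_two_rows:
  "minor V (i # j # is) C = (\<Sum>k\<in>C. \<Sum>l\<in>C - {k}.
     ((-1) ^ card {c\<in>C. c < k} * (-1) ^ card {c\<in>C - {k}. c < l}) * (V i k * V j l * minor V is (C - {k, l})))"
proof -
  have "C - {k} - {l} = C - {k, l}" for k l by auto
  then show ?thesis by (simp add: sum_distrib_left algebra_simps)
qed

lemma minor_repeat_adjacent:
  assumes "finite C" shows "minor V (i # i # is) C = 0"
  unfolding minor_two_rows
  by (rule double_expansion_zero[OF assms]) (simp add: mult.commute insert_commute)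

lemma minor_swap:
  assumes C: "finite C" shows "minor V (i # j # is) C = - minor V (j # i # is) C"
proof -
  have "minor V (i # j # is) C + minor V (j # i # is) C = (\<Sum>k\<in>C. \<Sum>l\<in>C - {k}.
     ((-1) ^ card {c\<in>C. c < k} * (-1) ^ card {c\<in>C - {k}. c < l})
       * ((V i k * V j l + V j k * V i l) * minor V is (C - {k, l})))"
    unfolding minor_two_rows by (simp add: sum.distrib distrib_left distrib_right mult.assoc)
  also have "\<dots> = 0"
    by (rule double_expansion_zero[OF C]) (simp add: mult.commute add.commute insert_commute)
  finally show ?thesis by (simp add: eq_neg_iff_add_eq_0)
qed

lemma minor_repeat:
  "finite C \<Longrightarrow> \<not> distinct is \<Longrightarrow> minor V is C = 0"
proof (induction "length is" arbitrary: "is" C rule: less_induct)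
  case less
  obtain i js where is_eq: "is = i # js" using less.prems(2) by (cases "is") auto
  show ?case
  proof (cases "distinct js")
    case False
    then have "minor V js (C - {k}) = 0" for k using less.hyps[of js "C - {k}"] less.prems is_eq by simp
    then show ?thesis by (simp add: is_eq)
  next
    case True
    then have "i \<in> set js" using less.prems is_eq by auto
    then obtain j ks where js: "js = j # ks" by (cases js) auto
    show ?thesis
    proof (cases "i = j")
      case True
      show ?thesis unfolding is_eq js True by (rule minor_repeat_adjacent[OF less.prems(1)])
    next
      case False
      then have nd: "\<not> distinct (i # ks)" using \<open>i \<in> set js\<close> js by auto
      have "minor V (i # ks) (C - {k}) = 0" for k
        using less.hyps[of "i # ks" "C - {k}"] less.prems nd is_eq js by simp
      then have "minor V (j # i # ks) C = 0" by (simp only: minor.simps(2)[of V j]) simp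
      then show ?thesis using minor_swap[OF less.prems(1), of V i j ks] is_eq js by simp
    qed
  qed
qed

text \<open>The sign is the same for all column sets \<open>C\<close>, which lets the induction pass
  through an expansion along the first row. Its value never matters, as ideals are closed under
  negation.\<close>

lemma minor_bring_to_front:
  "i \<in> set is \<Longrightarrow> \<exists>js (\<sigma>::'a::comm_ring_1). mset (i # js) = mset is \<and> (\<sigma> = 1 \<or> \<sigma> = -1)
     \<and> (\<forall>C. finite C \<longrightarrow> minor V is C = \<sigma> * minor V (i # js) C)"
proof (induction "is")
  case (Cons j "is")
  show ?case
  proof (cases "i = j")
    case True then show ?thesis by (intro exI[of _ "is"] exI[of _ 1]) auto
  next
    case False
    then obtain js \<sigma> where js: "mset (i # js) = mset is" "\<sigma> = 1 \<or> \<sigma> = -1"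
      "\<And>C. finite C \<Longrightarrow> minor V is C = \<sigma> * minor V (i # js) C"
      using Cons by auto
    have "minor V (j # is) C = - \<sigma> * minor V (i # j # js) C" if C: "finite C" for C
    proof -
      have "minor V (j # is) C = \<sigma> * minor V (j # i # js) C"
        using C by (simp only: minor.simps(2)[of V j] js(3)[OF finite_Diff[OF C]] sum_distrib_left)
          (simp add: mult.left_commute)
      then show ?thesis using minor_swap[OF C, of V i j js] by simp
    qed
    moreover have "mset (i # j # js) = mset (j # is)" using js(1) by simp
    moreover have "- \<sigma> = 1 \<or> - \<sigma> = -1" using js(2) by auto
    ultimately show ?thesis by blast
  qed
qed simp

lemma minor_perm:
  "mset xs = mset ys \<Longrightarrow> \<exists>\<sigma>::'a::comm_ring_1. (\<sigma> = 1 \<or> \<sigma> = -1)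
     \<and> (\<forall>C. finite C \<longrightarrow> minor V xs C = \<sigma> * minor V ys C)"
proof (induction xs arbitrary: ys)
  case Nil
  then show ?case by (intro exI[of _ 1]) auto
next
  case (Cons x xs)
  then have "x \<in> set ys" by (metis list.set_intros(1) set_mset_mset)
  from minor_bring_to_front[OF this, of V]
  obtain js \<sigma> where js: "mset (x # js) = mset ys" "\<sigma> = 1 \<or> \<sigma> = -1"
    "\<And>C. finite C \<Longrightarrow> minor V ys C = \<sigma> * minor V (x # js) C" by blast
  then have "mset xs = mset js"
    using Cons.prems by (metis mset.simps(2) add_mset_remove_trivial)
  from Cons.IH[OF this]
  obtain \<tau> where \<tau>: "\<tau> = 1 \<or> \<tau> = -1" "\<And>C. finite C \<Longrightarrow> minor V xs C = \<tau> * minor V js C" by blast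
  have "minor V (x # xs) C = (\<tau> * \<sigma>) * minor V ys C" if C: "finite C" for C
  proof -
    have "minor V (x # xs) C = \<tau> * minor V (x # js) C"
      using C by (simp add: \<tau>(2)[OF finite_Diff[OF C]] sum_distrib_left mult.left_commute)
    moreover have "minor V (x # js) C = \<sigma> * minor V ys C"
      using js(2) js(3)[OF C] by auto
    ultimately show ?thesis by (simp add: mult.assoc)
  qed
  moreover have "\<tau> * \<sigma> = 1 \<or> \<tau> * \<sigma> = -1" using \<tau>(1) js(2) by auto
  ultimately show ?case by blast
qed

lemma minor_row_combination:
  "finite C \<Longrightarrow> (\<Sum>i\<in>I. g i * minor V (i # is) C)
     = (\<Sum>k\<in>C. (-1) ^ card {c\<in>C. c < k} * ((\<Sum>i\<in>I. g i * V i k) * minor V is (C - {k})))"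
proof -
  have "(\<Sum>i\<in>I. g i * minor V (i # is) C)
     = (\<Sum>i\<in>I. \<Sum>k\<in>C. (-1) ^ card {c\<in>C. c < k} * ((g i * V i k) * minor V is (C - {k})))"
    by (simp add: sum_distrib_left algebra_simps)
  also have "\<dots> = (\<Sum>k\<in>C. \<Sum>i\<in>I. (-1) ^ card {c\<in>C. c < k} * ((g i * V i k) * minor V is (C - {k})))"
    by (rule sum.swap)
  finally show ?thesis by (simp add: sum_distrib_left sum_distrib_right)
qed

lemma ideal_sign_iff: "is_ideal E \<Longrightarrow> \<sigma> = 1 \<or> \<sigma> = -1 \<Longrightarrow> \<sigma> * x \<in> E \<longleftrightarrow> x \<in> E"
  using idl.subspace_neg[of E x] idl.subspace_neg[of E "- x"] by auto

text \<open>An element that is nonzero modulo \<open>E\<close> cannot annihilate all maximal minors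
  of a matrix that is injective over \<open>T/E\<close>. The size \<open>r\<close> of a minor that
  \<open>h\<close> does not kill is raised one step at a time.\<close>

lemma mccoy:
  fixes V :: "'i \<Rightarrow> nat \<Rightarrow> 'a::comm_ring_1"
  assumes E: "is_ideal E" and C: "finite C"
    and inj: "\<And>w. (\<And>i. i \<in> I \<Longrightarrow> (\<Sum>j\<in>C. V i j * w j) \<in> E) \<Longrightarrow> \<forall>j\<in>C. w j \<in> E"
    and h: "h \<notin> E"
  shows "\<exists>is. set is \<subseteq> I \<and> length is = card C \<and> h * minor V is C \<notin> E"
proof -
  have "r \<le> card C \<Longrightarrow> \<exists>is D. set is \<subseteq> I \<and> length is = r \<and> D \<subseteq> C \<and> card D = r \<and> h * minor V is D \<notin> E" for r
  proof (induction r)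
    case 0
    then show ?case using h by (intro exI[of _ "[]"] exI[of _ "{}"]) auto
  next
    case (Suc r)
    then obtain "is" D where D: "set is \<subseteq> I" "length is = r" "D \<subseteq> C" "card D = r" "h * minor V is D \<notin> E"
      by auto
    have fD: "finite D" using D C finite_subset by blast
    obtain c where c: "c \<in> C" "c \<notin> D"
      using D(3,4) Suc.prems by (metis Suc_n_not_le_n subsetI subset_antisym)
    define D' where "D' = insert c D"
    \<comment> \<open>\<open>w\<close> is \<open>h\<close> times the cofactors of a row put in front
      of \<open>is\<close> on the columns \<open>D'\<close>. Its product with row \<open>i\<close>
      is \<open>h * minor V (i # is) D'\<close>, also when \<open>i\<close> occurs in
      \<open>is\<close> already, and its entry at \<open>c\<close> is
      \<open>h * minor V is D\<close> up to sign, which is not in \<open>E\<close>. If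
      \<open>h\<close> killed all larger minors, \<open>w\<close> would contradict
      injectivity.\<close>
    define w where "w j = (if j \<in> D' then h * ((-1) ^ card {k\<in>D'. k < j} * minor V is (D' - {j})) else 0)" for j
    have D': "finite D'" "D' \<subseteq> C" "card D' = Suc r" "D' - {c} = D"
      using c D fD by (auto simp: D'_def)
    have exp: "(\<Sum>j\<in>C. V i j * w j) = h * minor V (i # is) D'" for i
    proof -
      have "(\<Sum>j\<in>C. V i j * w j) = (\<Sum>j\<in>D'. V i j * w j)"
        using D' C by (intro sum.mono_neutral_right) (auto simp: w_def)
      also have "\<dots> = (\<Sum>j\<in>D'. h * ((-1) ^ card {k\<in>D'. k < j} * (V i j * minor V is (D' - {j}))))"
        by (rule sum.cong) (auto simp: w_def algebra_simps)
      finally show ?thesis by (simp add: sum_distrib_left)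
    qed
    show ?case
    proof (rule ccontr)
      assume no: "\<not> ?case"
      have "(\<Sum>j\<in>C. V i j * w j) \<in> E" if "i \<in> I" for i
        using no D D' that unfolding exp by (metis insert_subset length_Cons list.simps(15))
      then have "w c \<in> E" using inj[of w] c by blast
      moreover have "w c = (-1) ^ card {k\<in>D'. k < c} * (h * minor V is D)"
      proof -
        have "c \<in> D'" by (simp add: D'_def)
        then show ?thesis by (simp add: w_def D'(4) mult.left_commute)
      qed
      moreover have "(-1::'a) ^ n = 1 \<or> (-1::'a) ^ n = -1" for n by (induction n) auto
      ultimately show False using D(5) ideal_sign_iff[OF E] by metis
    qed
  qed
  from this[of "card C"] show ?thesis using card_subset_eq[OF C] by auto
qed

text \<open>With more columns than rows every list of \<open>card C\<close> rows has a repetition,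
  so all maximal minors vanish and McCoy's theorem with \<open>h = 1\<close> excludes
  injectivity.\<close>

lemma wide_matrix_kernel:
  fixes V :: "'i \<Rightarrow> nat \<Rightarrow> 'a::comm_ring_1"
  assumes K: "prime_ideal K" and fin: "finite C" "finite I" and card: "card I < card C"
  shows "\<exists>w. (\<exists>j\<in>C. w j \<notin> K) \<and> (\<forall>i\<in>I. (\<Sum>j\<in>C. V i j * w j) \<in> K)"
proof (rule ccontr)
  assume no: "\<not> ?thesis"
  have "\<exists>is. set is \<subseteq> I \<and> length is = card C \<and> 1 * minor V is C \<notin> K"
    using no prime_idealD[OF K] fin by (intro mccoy) auto
  then obtain "is" where "is": "set is \<subseteq> I" "length is = card C" "minor V is C \<notin> K" by auto
  then have "distinct is" using minor_repeat[OF fin(1)] ideal_zero[OF prime_idealD(1)[OF K]] by metis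
  then have "card C \<le> card I" using "is" card_mono[OF fin(2) "is"(1)] by (simp add: distinct_card)
  with card show False by simp
qed

section \<open>Factoriality of regular local rings of dimension at most three\<close>

text \<open>Injectivity of \<open>V\<close> survives reduction modulo \<open>e\<close>, because
  \<open>g\<close> embeds the cokernel of \<open>V\<close> into the domain \<open>T/K\<close>, so
  that it is torsion-free. In elements: \<open>V w = e u\<close> forces \<open>g u = 0\<close>,
  hence \<open>u = V \<rho>\<close> and \<open>w = e \<rho>\<close>.\<close>

lemma scaled_basis_reflects:
  fixes g :: "nat \<Rightarrow> 'a::comm_ring_1" and V :: "nat \<Rightarrow> nat \<Rightarrow> 'a"
  assumes K: "prime_ideal K"
    and rel: "\<And>j. j < s \<Longrightarrow> (\<Sum>i<t. g i * V i j) \<in> K"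
    and ex: "\<And>u. (\<Sum>i<t. g i * u i) \<in> K \<Longrightarrow> \<exists>\<rho>. \<forall>i<t. u i - (\<Sum>j<s. V i j * \<rho> j) \<in> K"
    and ind: "\<And>\<rho>. (\<And>i. i < t \<Longrightarrow> (\<Sum>j<s. V i j * \<rho> j) \<in> K) \<Longrightarrow> \<forall>j<s. \<rho> j \<in> K"
    and e: "e \<notin> K"
    and w: "\<And>i. i < t \<Longrightarrow> (\<Sum>j<s. V i j * w j) \<in> gen (insert e K)" and j: "j < s"
  shows "w j \<in> gen (insert e K)"
proof -
  have idK: "is_ideal K" using prime_idealD(1)[OF K] .
  have "\<forall>i. \<exists>u. i < t \<longrightarrow> (\<Sum>j<s. V i j * w j) - u * e \<in> K"
    using w gen_insert_iff[OF idK] by blast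
  then obtain u where u: "\<And>i. i < t \<Longrightarrow> (\<Sum>j<s. V i j * w j) - u i * e \<in> K" by metis
  have "(\<Sum>i<t. g i * (\<Sum>j<s. V i j * w j)) = (\<Sum>j<s. w j * (\<Sum>i<t. g i * V i j))"
  proof -
    have "(\<Sum>i<t. g i * (\<Sum>j<s. V i j * w j)) = (\<Sum>i<t. \<Sum>j<s. g i * V i j * w j)"
      by (simp add: sum_distrib_left mult.assoc)
    also have "\<dots> = (\<Sum>j<s. \<Sum>i<t. g i * V i j * w j)" by (rule sum.swap)
    finally show ?thesis by (simp add: sum_distrib_left mult_ac)
  qed
  also have "\<dots> \<in> K" by (rule idl.subspace_sum[OF idK], rule ideal_mult_left[OF idK rel]) simp
  finally have 1: "(\<Sum>i<t. g i * (\<Sum>j<s. V i j * w j)) \<in> K" .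
  have 2: "(\<Sum>i<t. g i * ((\<Sum>j<s. V i j * w j) - u i * e)) \<in> K"
    using u by (intro idl.subspace_sum[OF idK] ideal_mult_left[OF idK]) auto
  have "(\<Sum>i<t. g i * (\<Sum>j<s. V i j * w j)) - (\<Sum>i<t. g i * ((\<Sum>j<s. V i j * w j) - u i * e))
      = e * (\<Sum>i<t. g i * u i)"
    by (simp add: sum_subtractf[symmetric] sum_distrib_left algebra_simps)
  then have "e * (\<Sum>i<t. g i * u i) \<in> K" using ideal_diff[OF idK 1 2] by simp
  then have "(\<Sum>i<t. g i * u i) \<in> K" using prime_mult_iff[OF K] e by blast
  then obtain \<rho> where \<rho>: "\<And>i. i < t \<Longrightarrow> u i - (\<Sum>j<s. V i j * \<rho> j) \<in> K" using ex by blast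
  have "(\<Sum>j<s. V i j * (w j - \<rho> j * e)) \<in> K" if i: "i < t" for i
  proof -
    have "((\<Sum>j<s. V i j * w j) - u i * e) + e * (u i - (\<Sum>j<s. V i j * \<rho> j)) \<in> K"
      by (rule ideal_add[OF idK u[OF i] ideal_mult_left[OF idK \<rho>[OF i]]])
    also have "((\<Sum>j<s. V i j * w j) - u i * e) + e * (u i - (\<Sum>j<s. V i j * \<rho> j))
        = (\<Sum>j<s. V i j * (w j - \<rho> j * e))"
      by (simp add: sum_subtractf sum_distrib_left algebra_simps)
    finally show ?thesis .
  qed
  then have "\<forall>j<s. w j - \<rho> j * e \<in> K" by (rule ind)
  then have "w j - \<rho> j * e \<in> K" using j by blast
  then show ?thesis using gen_insert_iff[OF idK] by blast
qed

text \<open>Hilbert--Burch for a colon ideal \<open>J = (a : b)\<close> whose syzygy module is free: the ideal of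
  maximal minors is a multiple of \<open>J\<close> and, by McCoy, lies in no proper principal ideal;
  since \<open>J\<close> is divisorial it must be principal.\<close>

lemma colon_principal_of_free_syzygies:
  fixes g :: "nat \<Rightarrow> 'a::comm_ring_1" and V :: "nat \<Rightarrow> nat \<Rightarrow> 'a"
  assumes K: "prime_ideal K" and a: "a \<notin> K"
    and J: "quot (gen (insert a K)) b = gen (K \<union> g ` {..<t})"
    and rel: "\<And>j. j < s \<Longrightarrow> (\<Sum>i<t. g i * V i j) \<in> K"
    and ex: "\<And>u. (\<Sum>i<t. g i * u i) \<in> K \<Longrightarrow> \<exists>\<rho>. \<forall>i<t. u i - (\<Sum>j<s. V i j * \<rho> j) \<in> K"
    and ind: "\<And>\<rho>. (\<And>i. i < t \<Longrightarrow> (\<Sum>j<s. V i j * \<rho> j) \<in> K) \<Longrightarrow> \<forall>j<s. \<rho> j \<in> K"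
  shows "\<exists>c. quot (gen (insert a K)) b = gen (insert c K)"
proof -
  have idK: "is_ideal K" using prime_idealD(1)[OF K] .
  have nz: "1 \<notin> K" using prime_idealD(2)[OF K] .
  let ?C = "{..<s}"
  have aJ: "a \<in> gen (K \<union> g ` {..<t})" unfolding J[symmetric]
    using gen_insert_mem[of a K] by (auto simp: quot_def intro: ideal_mult_right)
  have "\<exists>p<t. g p \<notin> K"
  proof (rule ccontr)
    assume "\<not> ?thesis"
    then have "gen (K \<union> g ` {..<t}) \<subseteq> K" by (intro idl.span_minimal idK) auto
    then show False using aJ a by blast
  qed
  then obtain p where p: "p < t" "g p \<notin> K" by blast
  have rowrel: "(\<Sum>i<t. g i * minor V (i # is) ?C) \<in> K" for "is"
    unfolding minor_row_combination[OF finite_lessThan]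
    by (rule idl.subspace_sum[OF idK], rule ideal_mult_left[OF idK ideal_mult_right[OF idK rel]]) simp
  have mcE: "\<exists>is. set is \<subseteq> {..<t} \<and> length is = s \<and> h * minor V is ?C \<notin> gen (insert e K)"
    if "h \<notin> gen (insert e K)" "e \<notin> K" for h e
    using mccoy[OF _ finite_lessThan[of s] _ that(1), of "{..<t}" V]
      scaled_basis_reflects[OF K rel ex ind that(2)] by auto
  have mcK: "\<exists>is. set is \<subseteq> {..<t} \<and> length is = s \<and> h * minor V is ?C \<notin> K"
    if "h \<notin> K" for h
    using mccoy[OF idK finite_lessThan[of s] _ that, of "{..<t}" V] ind by auto
  \<comment> \<open>The syzygies of a nonzero ideal with \<open>t\<close> generators have rank
    \<open>t - 1\<close>.\<close>
  have "Suc s = t"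
  proof -
    have "t \<le> Suc s"
    proof (rule ccontr)
      assume less: "\<not> t \<le> Suc s"
      \<comment> \<open>The vectors \<open>z i\<close> with \<open>i\<close> different from
        \<open>p\<close> are the obvious relations between \<open>g i\<close> and
        \<open>g p\<close>. They are \<open>t - 1\<close> independent syzygies, too many to be
        spanned by fewer than \<open>t - 1\<close> columns.\<close>
      define z where "z i k = (if k = i then g p else if k = p then - g i else 0)" for i k
      have "(\<Sum>k<t. g k * z i k) = 0" if "i < t" "i \<noteq> p" for i
      proof -
        have "(\<Sum>k<t. g k * z i k) = (\<Sum>k\<in>{i, p}. g k * z i k)"
          using that p by (intro sum.mono_neutral_right) (auto simp: z_def)
        then show ?thesis using that by (simp add: z_def)
      qed
      then have "\<forall>i. \<exists>\<rho>. i < t \<and> i \<noteq> p \<longrightarrow> (\<forall>k<t. z i k - (\<Sum>j<s. V k j * \<rho> j) \<in> K)"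
        using ex idl.subspace_0[OF idK] by metis
      then obtain \<rho> where \<rho>: "\<And>i k. i < t \<Longrightarrow> i \<noteq> p \<Longrightarrow> k < t \<Longrightarrow> z i k - (\<Sum>j<s. V k j * \<rho> i j) \<in> K"
        by metis
      have "card ({..<t} - {p}) = t - 1" using p by simp
      then have "card {..<s} < card ({..<t} - {p})" using less by simp
      from wide_matrix_kernel[OF K _ _ this, of "\<lambda>j i. \<rho> i j"]
      obtain w where w: "\<exists>i\<in>{..<t} - {p}. w i \<notin> K"
        "\<And>j. j < s \<Longrightarrow> (\<Sum>i\<in>{..<t} - {p}. \<rho> i j * w i) \<in> K" by auto
      then obtain k where k: "k < t" "k \<noteq> p" "w k \<notin> K" by auto
      have "(\<Sum>i\<in>{..<t} - {p}. w i * (z i k - (\<Sum>j<s. V k j * \<rho> i j))) \<in> K"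
        using \<rho> k by (intro idl.subspace_sum[OF idK] ideal_mult_left[OF idK]) auto
      moreover have "(\<Sum>j<s. V k j * (\<Sum>i\<in>{..<t} - {p}. \<rho> i j * w i)) \<in> K"
        by (rule idl.subspace_sum[OF idK], rule ideal_mult_left[OF idK w(2)]) simp
      ultimately have "(\<Sum>i\<in>{..<t} - {p}. w i * (z i k - (\<Sum>j<s. V k j * \<rho> i j)))
          + (\<Sum>j<s. V k j * (\<Sum>i\<in>{..<t} - {p}. \<rho> i j * w i)) \<in> K" by (rule ideal_add[OF idK])
      also have "(\<Sum>j<s. V k j * (\<Sum>i\<in>{..<t} - {p}. \<rho> i j * w i))
          = (\<Sum>i\<in>{..<t} - {p}. w i * (\<Sum>j<s. V k j * \<rho> i j))"
      proof -
        have "(\<Sum>j<s. V k j * (\<Sum>i\<in>{..<t} - {p}. \<rho> i j * w i))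
           = (\<Sum>j<s. \<Sum>i\<in>{..<t} - {p}. V k j * \<rho> i j * w i)"
          by (simp add: sum_distrib_left mult.assoc)
        also have "\<dots> = (\<Sum>i\<in>{..<t} - {p}. \<Sum>j<s. V k j * \<rho> i j * w i)" by (rule sum.swap)
        finally show ?thesis by (simp add: sum_distrib_left mult_ac)
      qed
      also have "(\<Sum>i\<in>{..<t} - {p}. w i * (z i k - (\<Sum>j<s. V k j * \<rho> i j)))
          + (\<Sum>i\<in>{..<t} - {p}. w i * (\<Sum>j<s. V k j * \<rho> i j)) = (\<Sum>i\<in>{..<t} - {p}. w i * z i k)"
        by (simp add: sum.distrib[symmetric] algebra_simps)
      also have "\<dots> = (\<Sum>i\<in>{k}. w i * z i k)"
        using k by (intro sum.mono_neutral_right) (auto simp: z_def)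
      finally show False using k p prime_mult_iff[OF K] by (simp add: z_def)
    qed
    moreover obtain is0 where is0: "set is0 \<subseteq> {..<t}" "length is0 = s" "minor V is0 ?C \<notin> K"
      using mcK[OF nz] by auto
    have d0: "distinct is0" using minor_repeat[OF finite_lessThan] is0(3) ideal_zero[OF idK] by metis
    then have cs: "card (set is0) = s" using is0 by (simp add: distinct_card)
    then have "s \<le> t" using card_mono[OF _ is0(1)] by simp
    \<comment> \<open>For a square \<open>V\<close>, Cramer's rule applied to the relation
      \<open>g V = 0\<close> would make \<open>g p\<close> times the determinant vanish, although
      neither factor does.\<close>
    moreover have "s \<noteq> t"
    proof
      assume st: "s = t"
      then have all: "set is0 = {..<t}" using card_subset_eq[OF _ is0(1)] cs by simp
      define js where "js = remove1 p is0"
      have js: "mset (p # js) = mset is0" "set js = {..<t} - {p}"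
        using all p d0 by (auto simp: js_def)
      have "g i * minor V (i # js) ?C = 0" if "i \<in> {..<t} - {p}" for i
        using that js minor_repeat[of ?C "i # js" V] by (simp del: minor.simps)
      then have "(\<Sum>i<t. g i * minor V (i # js) ?C) = g p * minor V (p # js) ?C"
        using p by (subst sum.remove[of _ p]) (auto simp del: minor.simps)
      then have "minor V (p # js) ?C \<in> K" using rowrel[of js] prime_mult_iff[OF K] p by metis
      then show False using minor_perm[OF js(1), of V] is0(3) ideal_sign_iff[OF idK] by (metis finite_lessThan)
    qed
    ultimately show ?thesis by simp
  qed
  define R where "R i = sorted_list_of_set ({..<t} - {i})" for i
  define \<Delta> where "\<Delta> i = minor V (R i) ?C" for i
  have to_\<Delta>: "\<exists>i<t. \<exists>\<sigma>. (\<sigma> = 1 \<or> \<sigma> = -1) \<and> minor V is ?C = \<sigma> * \<Delta> i"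
    if "is": "set is \<subseteq> {..<t}" "length is = s" "distinct is" for "is"
  proof -
    have "card ({..<t} - set is) = 1"
      using "is" \<open>Suc s = t\<close> by (simp add: card_Diff_subset distinct_card)
    then obtain i where i: "{..<t} - set is = {i}" by (auto simp: card_1_singleton_iff)
    then have "set is = {..<t} - {i}" using "is" by blast
    then have "mset is = mset (R i)" using "is"(3) by (simp add: R_def set_eq_iff_mset_eq_distinct[symmetric])
    then show ?thesis using minor_perm[of "is" "R i" V] i unfolding \<Delta>_def by blast
  qed
  have mc\<Delta>: "\<exists>i<t. h * \<Delta> i \<notin> E" if E: "is_ideal E"
    and ex_is: "\<exists>is. set is \<subseteq> {..<t} \<and> length is = s \<and> h * minor V is ?C \<notin> E" for h E
  proof -
    obtain "is" where "is": "set is \<subseteq> {..<t}" "length is = s" "h * minor V is ?C \<notin> E" using ex_is by blast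
    then have "distinct is" using minor_repeat[OF finite_lessThan] ideal_zero[OF E] by (metis mult_zero_right)
    then obtain i \<sigma> where "i < t" "\<sigma> = 1 \<or> \<sigma> = -1" "minor V is ?C = \<sigma> * \<Delta> i" using to_\<Delta> "is" by blast
    then show ?thesis using "is"(3) ideal_sign_iff[OF E] by (metis mult.left_commute)
  qed
  \<comment> \<open>Expanding \<open>g V = 0\<close> against the rows other than \<open>i\<close>
    and \<open>k\<close> leaves just two terms, so \<open>g\<close> is proportional to the vector of
    signed maximal minors.\<close>
  have propor: "\<exists>\<sigma>. (\<sigma> = 1 \<or> \<sigma> = -1) \<and> g i * \<Delta> k - g k * (\<sigma> * \<Delta> i) \<in> K" if ik: "i < t" "k < t" for i k
  proof (cases "i = k")
    case True then show ?thesis using ideal_zero[OF idK] by (intro exI[of _ 1]) auto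
  next
    case False
    define js where "js = sorted_list_of_set ({..<t} - {i, k})"
    have js: "set js = {..<t} - {i, k}" "distinct js" by (auto simp: js_def)
    have "mset (i # js) = mset (R k)" "mset (k # js) = mset (R i)"
      using js ik False by (auto simp: R_def set_eq_iff_mset_eq_distinct[symmetric] simp del: mset.simps)
    then obtain \<sigma> \<tau> where \<sigma>: "\<sigma> = 1 \<or> \<sigma> = -1" "minor V (i # js) ?C = \<sigma> * \<Delta> k"
      and \<tau>: "\<tau> = 1 \<or> \<tau> = -1" "minor V (k # js) ?C = \<tau> * \<Delta> i"
      using minor_perm[of "i # js" "R k" V] minor_perm[of "k # js" "R i" V] unfolding \<Delta>_def
      by (metis finite_lessThan)
    have "g l * minor V (l # js) ?C = 0" if "l \<in> {..<t} - {i, k}" for l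
      using that js minor_repeat[of ?C "l # js" V] by (simp del: minor.simps)
    then have "(\<Sum>l<t. g l * minor V (l # js) ?C) = (\<Sum>l\<in>{i, k}. g l * minor V (l # js) ?C)"
      using ik by (intro sum.mono_neutral_right) (auto simp del: minor.simps)
    then have "g i * (\<sigma> * \<Delta> k) + g k * (\<tau> * \<Delta> i) \<in> K"
      using rowrel[of js] False \<sigma>(2) \<tau>(2) by (simp del: minor.simps)
    then have "\<sigma> * (g i * (\<sigma> * \<Delta> k) + g k * (\<tau> * \<Delta> i)) \<in> K" by (rule ideal_mult_left[OF idK])
    also have "\<sigma> * (g i * (\<sigma> * \<Delta> k) + g k * (\<tau> * \<Delta> i)) = g i * \<Delta> k - g k * ((- (\<sigma> * \<tau>)) * \<Delta> i)"
      using \<sigma>(1) by (auto simp: algebra_simps)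
    finally show ?thesis using \<sigma>(1) \<tau>(1) by (intro exI[of _ "- (\<sigma> * \<tau>)"]) auto
  qed
  obtain k where k: "k < t" "\<Delta> k \<notin> K" using mc\<Delta>[OF idK mcK[OF nz]] by auto
  obtain \<sigma> where \<sigma>: "\<And>i. i < t \<Longrightarrow> \<sigma> i = 1 \<or> \<sigma> i = -1"
    "\<And>i. i < t \<Longrightarrow> g i * \<Delta> k - g k * (\<sigma> i * \<Delta> i) \<in> K" using propor[OF _ k(1)] by metis
  define D where "D i = \<sigma> i * \<Delta> i" for i
  have gD: "g i * \<Delta> k - g k * D i \<in> K" if "i < t" for i using \<sigma>(2)[OF that] by (simp add: D_def)
  let ?E = "gen (insert (\<Delta> k) K)"
  have idE: "is_ideal ?E" by simp
  have KE: "K \<subseteq> ?E" by (rule gen_insert_superset)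
  \<comment> \<open>McCoy's theorem modulo \<open>\<Delta> k\<close>. Applied to \<open>g k\<close>,
    and later to \<open>q k\<close>, it extracts the factor \<open>\<Delta> k\<close>.\<close>
  have all_E: "h \<in> ?E" if "\<And>i. i < t \<Longrightarrow> h * D i \<in> ?E" for h
  proof (rule ccontr)
    assume "h \<notin> ?E"
    then obtain i where i: "i < t" "h * \<Delta> i \<notin> ?E" using mc\<Delta>[OF idE mcE[OF _ k(2)]] by blast
    then show False using that[OF i(1)] ideal_sign_iff[OF idE \<sigma>(1)[OF i(1)]]
      by (metis D_def mult.left_commute)
  qed
  have "g k * D i \<in> ?E" if i: "i < t" for i
  proof -
    have "g i * \<Delta> k \<in> ?E" using gen_insert_mem[of "\<Delta> k" K] ideal_mult_left[OF idE] by blast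
    moreover have "g i * \<Delta> k - g k * D i \<in> ?E" using gD[OF i] KE by blast
    ultimately show ?thesis using ideal_diff[OF idE, of "g i * \<Delta> k" "g i * \<Delta> k - g k * D i"] by simp
  qed
  then have "g k \<in> ?E" by (rule all_E)
  then obtain \<gamma> where \<gamma>: "g k - \<gamma> * \<Delta> k \<in> K" using gen_insert_iff[OF idK] by blast
  have g\<gamma>: "g i - D i * \<gamma> \<in> K" if i: "i < t" for i
  proof -
    have "(g i * \<Delta> k - g k * D i) + D i * (g k - \<gamma> * \<Delta> k) \<in> K"
      by (rule ideal_add[OF idK gD[OF i] ideal_mult_left[OF idK \<gamma>]])
    also have "(g i * \<Delta> k - g k * D i) + D i * (g k - \<gamma> * \<Delta> k) = (g i - D i * \<gamma>) * \<Delta> k"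
      by (simp add: algebra_simps)
    finally show ?thesis using prime_mult_iff[OF K] k by blast
  qed
  \<comment> \<open>Since \<open>g i\<close> is in \<open>(a : b)\<close>, there is
    \<open>q i\<close> with \<open>g i * b = q i * a\<close>. The vector \<open>q\<close> is
    proportional to the minors too, so \<open>q k\<close> is \<open>\<pi> * \<Delta> k\<close>;
    cancelling \<open>\<Delta> k\<close> leaves \<open>\<gamma> * b = \<pi> * a\<close> and puts the
    common factor \<open>\<gamma>\<close> of the \<open>g i\<close> into
    \<open>(a : b)\<close>.\<close>
  have "\<forall>i. \<exists>q. i < t \<longrightarrow> g i * b - q * a \<in> K"
  proof (intro allI)
    fix i
    show "\<exists>q. i < t \<longrightarrow> g i * b - q * a \<in> K"
    proof (cases "i < t")
      case True
      then have "g i \<in> quot (gen (insert a K)) b" unfolding J by (intro idl.span_base) auto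
      then show ?thesis by (auto simp: quot_def gen_insert_iff[OF idK])
    qed simp
  qed
  then obtain q where q: "\<And>i. i < t \<Longrightarrow> g i * b - q i * a \<in> K" by metis
  have "q k * D i \<in> ?E" if i: "i < t" for i
  proof -
    have "D i * (g k * b - q k * a) - \<Delta> k * (g i * b - q i * a) + b * (g i * \<Delta> k - g k * D i) \<in> K"
      by (intro ideal_add[OF idK] ideal_diff[OF idK] ideal_mult_left[OF idK] q gD i k)
    also have "D i * (g k * b - q k * a) - \<Delta> k * (g i * b - q i * a) + b * (g i * \<Delta> k - g k * D i)
        = a * (q i * \<Delta> k - q k * D i)" by (simp add: algebra_simps)
    finally have "q i * \<Delta> k - q k * D i \<in> ?E" using prime_mult_iff[OF K] a KE by blast
    moreover have "q i * \<Delta> k \<in> ?E" using gen_insert_mem[of "\<Delta> k" K] ideal_mult_left[OF idE] by blast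
    ultimately show ?thesis using ideal_diff[OF idE, of "q i * \<Delta> k" "q i * \<Delta> k - q k * D i"] by simp
  qed
  then have "q k \<in> ?E" by (rule all_E)
  then obtain \<pi> where \<pi>: "q k - \<pi> * \<Delta> k \<in> K" using gen_insert_iff[OF idK] by blast
  have "(g k * b - q k * a) - b * (g k - \<gamma> * \<Delta> k) + a * (q k - \<pi> * \<Delta> k) \<in> K"
    by (intro ideal_add[OF idK] ideal_diff[OF idK] ideal_mult_left[OF idK] q k \<gamma> \<pi>)
  also have "(g k * b - q k * a) - b * (g k - \<gamma> * \<Delta> k) + a * (q k - \<pi> * \<Delta> k) = \<Delta> k * (\<gamma> * b - \<pi> * a)"
    by (simp add: algebra_simps)
  finally have "\<gamma> * b - \<pi> * a \<in> K" using prime_mult_iff[OF K] k by blast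
  then have \<gamma>J: "\<gamma> \<in> quot (gen (insert a K)) b" by (auto simp: quot_def gen_insert_iff[OF idK])
  have "quot (gen (insert a K)) b = gen (insert \<gamma> K)"
  proof
    show "quot (gen (insert a K)) b \<subseteq> gen (insert \<gamma> K)"
    proof -
      have "g i \<in> gen (insert \<gamma> K)" if "i < t" for i
        using g\<gamma>[OF that] gen_insert_iff[OF idK] by blast
      then show ?thesis
        unfolding J using gen_insert_superset[of K \<gamma>] by (intro idl.span_minimal) auto
    qed
    show "gen (insert \<gamma> K) \<subseteq> quot (gen (insert a K)) b"
      using \<gamma>J gen_insert_superset[of K a] quot_superset[of "gen (insert a K)" b]
      by (intro gen_insert_minimal quot_ideal) auto
  qed
  then show ?thesis by blast
qed

section \<open>Submodules of free modules and the syzygies of a colon ideal\<close>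

definition dotp :: "nat \<Rightarrow> (nat \<Rightarrow> 'a) \<Rightarrow> (nat \<Rightarrow> 'a) \<Rightarrow> 'a::comm_ring_1" where
  "dotp n g v = (\<Sum>i<n. g i * v i)"

lemma dotp_add: "dotp n g (\<lambda>i. u i + v i) = dotp n g u + dotp n g v"
  by (simp add: dotp_def distrib_left sum.distrib)

lemma dotp_diff: "dotp n g (\<lambda>i. u i - v i) = dotp n g u - dotp n g v"
  by (simp add: dotp_def right_diff_distrib sum_subtractf)

lemma dotp_scale: "dotp n g (\<lambda>i. c * v i) = c * dotp n g v"
  by (simp add: dotp_def sum_distrib_left mult.left_commute)

lemma dotp_ideal: "is_ideal K \<Longrightarrow> (\<And>i. i < n \<Longrightarrow> v i \<in> K) \<Longrightarrow> dotp n g v \<in> K"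
  unfolding dotp_def by (rule idl.subspace_sum, assumption, rule ideal_mult_left) auto

lemma dotp_ideal_left: "is_ideal K \<Longrightarrow> (\<And>i. i < n \<Longrightarrow> g i \<in> K) \<Longrightarrow> dotp n g v \<in> K"
  unfolding dotp_def by (rule idl.subspace_sum, assumption, rule ideal_mult_right) auto

lemma gen_image_iff:
  assumes K: "is_ideal K"
  shows "y \<in> gen (K \<union> g ` {..<t}) \<longleftrightarrow> (\<exists>f. y - dotp t g f \<in> K)"
proof
  have "is_ideal {y. \<exists>f. y - dotp t g f \<in> K}"
  proof (rule idl.subspaceI)
    have "0 - dotp t g (\<lambda>i. 0) \<in> K" using ideal_zero[OF K] by (simp add: dotp_def)
    then show "0 \<in> {y. \<exists>f. y - dotp t g f \<in> K}" by blast
  next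
    fix x y assume "x \<in> {y. \<exists>f. y - dotp t g f \<in> K}" "y \<in> {y. \<exists>f. y - dotp t g f \<in> K}"
    then obtain f f' where f: "x - dotp t g f \<in> K" "y - dotp t g f' \<in> K" by blast
    have "(x + y) - dotp t g (\<lambda>i. f i + f' i) \<in> K"
      using ideal_add[OF K f] by (simp add: dotp_add algebra_simps)
    then show "x + y \<in> {y. \<exists>f. y - dotp t g f \<in> K}" by blast
  next
    fix c y assume "y \<in> {y. \<exists>f. y - dotp t g f \<in> K}"
    then obtain f where f: "y - dotp t g f \<in> K" by blast
    have "c * y - dotp t g (\<lambda>i. c * f i) \<in> K"
      using ideal_mult_left[OF K f, of c] by (simp add: dotp_scale right_diff_distrib)
    then show "c * y \<in> {y. \<exists>f. y - dotp t g f \<in> K}" by blast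
  qed
  moreover have "K \<union> g ` {..<t} \<subseteq> {y. \<exists>f. y - dotp t g f \<in> K}"
  proof -
    have "y - dotp t g (\<lambda>i. 0) \<in> K" if "y \<in> K" for y using that by (simp add: dotp_def)
    moreover have "g k - dotp t g (\<lambda>i. if i = k then 1 else 0) \<in> K" if "k < t" for k
      using that ideal_zero[OF K] by (simp add: dotp_def if_distrib[of "(*) _"] sum.delta cong: if_cong)
    ultimately show ?thesis by blast
  qed
  ultimately have "gen (K \<union> g ` {..<t}) \<subseteq> {y. \<exists>f. y - dotp t g f \<in> K}"
    by (rule idl.span_minimal[rotated])
  then show "y \<in> gen (K \<union> g ` {..<t}) \<Longrightarrow> \<exists>f. y - dotp t g f \<in> K" by blast
next
  assume "\<exists>f. y - dotp t g f \<in> K"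
  then obtain f where f: "y - dotp t g f \<in> K" by blast
  have "dotp t g f \<in> gen (K \<union> g ` {..<t})"
    by (rule dotp_ideal_left) (auto intro: idl.span_base)
  moreover have "y - dotp t g f \<in> gen (K \<union> g ` {..<t})" using f by (auto intro: idl.span_base)
  ultimately show "y \<in> gen (K \<union> g ` {..<t})"
    using ideal_add[OF idl.subspace_span, of "y - dotp t g f" "K \<union> g ` {..<t}" "dotp t g f"] by simp
qed

lemma acc_finite_generation:
  assumes acc: "acc_above K" and J: "is_ideal J" "K \<subseteq> J"
  shows "\<exists>G. finite G \<and> J = gen (K \<union> G)"
proof -
  let ?S = "{gen (K \<union> G) | G. finite G \<and> G \<subseteq> J}"
  have S0: "gen (K \<union> {}) \<in> ?S" by blast
  have "\<And>A. A \<in> ?S \<Longrightarrow> is_ideal A \<and> K \<subseteq> A"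
    using idl.span_superset by fastforce
  from acc_above_maximal[OF acc S0 this]
  obtain A where "A \<in> ?S" and max: "\<forall>B\<in>?S. A \<subseteq> B \<longrightarrow> B = A" by meson
  then obtain G where G: "finite G" "G \<subseteq> J" "A = gen (K \<union> G)" by blast
  have "J \<subseteq> A"
  proof
    fix x assume x: "x \<in> J"
    have "gen (K \<union> insert x G) \<in> ?S" using G x by blast
    moreover have "A \<subseteq> gen (K \<union> insert x G)" unfolding G by (rule idl.span_mono) auto
    ultimately have "gen (K \<union> insert x G) = A" using max by blast
    then show "x \<in> A" using idl.span_superset[of "K \<union> insert x G"] by blast
  qed
  moreover have "A \<subseteq> J" unfolding G(3) using G J by (intro idl.span_minimal) auto
  ultimately show ?thesis using G by blast
qed

text \<open>Submodules of a free module. Vectors are total functions, of which only the first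
  \<open>t\<close> entries, read modulo \<open>K\<close>, will matter.\<close>

definition closed_vectors :: "(nat \<Rightarrow> 'a::comm_ring_1) set \<Rightarrow> bool" where
  "closed_vectors N \<longleftrightarrow> (\<lambda>i. 0) \<in> N \<and> (\<forall>u\<in>N. \<forall>v\<in>N. (\<lambda>i. u i + v i) \<in> N)
     \<and> (\<forall>c. \<forall>u\<in>N. (\<lambda>i. c * u i) \<in> N)"

lemma closed_vectors_add: "closed_vectors N \<Longrightarrow> u \<in> N \<Longrightarrow> v \<in> N \<Longrightarrow> (\<lambda>i. u i + v i) \<in> N"
  by (simp add: closed_vectors_def)

lemma closed_vectors_scale: "closed_vectors N \<Longrightarrow> u \<in> N \<Longrightarrow> (\<lambda>i. c * u i) \<in> N"
  by (simp add: closed_vectors_def)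

lemma closed_vectors_sum:
  assumes N: "closed_vectors N" and B: "B \<subseteq> N"
  shows "(\<lambda>i. \<Sum>v\<in>B. \<rho> v * v i) \<in> N"
  using B
proof (induction B rule: infinite_finite_induct)
  case (insert x B)
  then have "(\<lambda>i. \<rho> x * x i + (\<Sum>v\<in>B. \<rho> v * v i)) \<in> N"
    by (intro closed_vectors_add[OF N] closed_vectors_scale[OF N]) auto
  then show ?case using insert.hyps by simp
qed (use N in \<open>auto simp: closed_vectors_def\<close>)

lemma closed_vectors_diff:
  assumes N: "closed_vectors N" and uv: "u \<in> N" "v \<in> N" shows "(\<lambda>i. u i - v i) \<in> N"
proof -
  have "(\<lambda>i. u i + (-1) * v i) \<in> N"
    by (intro closed_vectors_add[OF N] closed_vectors_scale[OF N] uv)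
  then show ?thesis by simp
qed

definition spans_mod :: "'a::comm_ring_1 set \<Rightarrow> nat \<Rightarrow> (nat \<Rightarrow> 'a) set \<Rightarrow> (nat \<Rightarrow> 'a) set \<Rightarrow> bool" where
  "spans_mod K t B N \<longleftrightarrow> finite B \<and> B \<subseteq> N
     \<and> (\<forall>u\<in>N. \<exists>\<rho>. \<forall>i<t. u i - (\<Sum>v\<in>B. \<rho> v * v i) \<in> K)"

text \<open>Induction on \<open>t\<close>: the last entries form a finitely generated ideal,
  finitely many vectors realize its generators, and subtracting a combination of these brings the
  last entry of any vector into \<open>K\<close>.\<close>

lemma vectors_finite_generation:
  assumes acc: "acc_above K" and K: "is_ideal K"
  shows "closed_vectors N \<Longrightarrow> \<exists>B. spans_mod K t B N"
proof (induction t arbitrary: N)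
  case 0
  then show ?case by (intro exI[of _ "{}"]) (auto simp: spans_mod_def)
next
  case (Suc t)
  note N = Suc.prems
  define L where "L = {x. \<exists>v\<in>N. x - v t \<in> K}"
  have "is_ideal L"
  proof (rule idl.subspaceI)
    have "(\<lambda>i. 0) \<in> N" using N by (auto simp: closed_vectors_def)
    moreover have "0 - 0 \<in> K" using ideal_zero[OF K] by simp
    ultimately show "0 \<in> L" unfolding L_def by force
  next
    fix x y assume "x \<in> L" "y \<in> L"
    then obtain u v where uv: "u \<in> N" "v \<in> N" "x - u t \<in> K" "y - v t \<in> K" by (auto simp: L_def)
    then have "(\<lambda>i. u i + v i) \<in> N" using N by (auto simp: closed_vectors_def)
    moreover have "(x + y) - (u t + v t) \<in> K" using ideal_add[OF K uv(3,4)] by (simp add: algebra_simps)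
    ultimately show "x + y \<in> L" unfolding L_def by force
  next
    fix c x assume "x \<in> L"
    then obtain u where u: "u \<in> N" "x - u t \<in> K" by (auto simp: L_def)
    then have "(\<lambda>i. c * u i) \<in> N" using N by (auto simp: closed_vectors_def)
    moreover have "c * x - c * u t \<in> K" using ideal_mult_left[OF K u(2), of c] by (simp add: algebra_simps)
    ultimately show "c * x \<in> L" unfolding L_def by force
  qed
  moreover have "K \<subseteq> L" using N unfolding L_def closed_vectors_def by force
  ultimately obtain G where G: "finite G" "L = gen (K \<union> G)" using acc_finite_generation[OF acc] by blast
  have "\<forall>x\<in>G. \<exists>v\<in>N. x - v t \<in> K" using idl.span_superset[of "K \<union> G"] G(2) by (auto simp: L_def)
  then obtain f where f: "\<And>x. x \<in> G \<Longrightarrow> f x \<in> N" "\<And>x. x \<in> G \<Longrightarrow> x - f x t \<in> K" by metis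
  define N' where "N' = {v\<in>N. v t \<in> K}"
  have "closed_vectors N'"
    using N ideal_zero[OF K] ideal_add[OF K] ideal_mult_left[OF K]
    unfolding closed_vectors_def N'_def by auto
  then obtain B' where B': "spans_mod K t B' N'" using Suc.IH by blast
  define B where "B = B' \<union> f ` G"
  have fin: "finite B" "finite B'" "finite (f ` G)" using B' G by (auto simp: B_def spans_mod_def)
  have BN: "B \<subseteq> N" using B' f by (auto simp: B_def spans_mod_def N'_def)
  have top: "\<exists>\<rho>. x - (\<Sum>v\<in>f ` G. \<rho> v * v t) \<in> K" if "x \<in> L" for x
  proof -
    let ?L = "{x. \<exists>\<rho>. x - (\<Sum>v\<in>f ` G. \<rho> v * v t) \<in> K}"
    have "is_ideal ?L"
    proof (rule idl.subspaceI)
      have "0 - (\<Sum>v\<in>f ` G. 0 * v t) \<in> K" using ideal_zero[OF K] by simp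
      then show "0 \<in> ?L" by (intro CollectI exI[of _ "\<lambda>v. 0"])
    next
      fix x y assume "x \<in> ?L" "y \<in> ?L"
      then obtain \<rho> \<sigma> where r: "x - (\<Sum>v\<in>f ` G. \<rho> v * v t) \<in> K" "y - (\<Sum>v\<in>f ` G. \<sigma> v * v t) \<in> K" by blast
      have "(x + y) - (\<Sum>v\<in>f ` G. (\<rho> v + \<sigma> v) * v t) \<in> K"
        using ideal_add[OF K r] by (simp add: distrib_right sum.distrib algebra_simps)
      then show "x + y \<in> ?L" by (intro CollectI exI[of _ "\<lambda>v. \<rho> v + \<sigma> v"])
    next
      fix c x assume "x \<in> ?L"
      then obtain \<rho> where r: "x - (\<Sum>v\<in>f ` G. \<rho> v * v t) \<in> K" by blast
      have "c * x - (\<Sum>v\<in>f ` G. (c * \<rho> v) * v t) \<in> K"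
        using ideal_mult_left[OF K r, of c] by (simp add: right_diff_distrib sum_distrib_left mult.assoc)
      then show "c * x \<in> ?L" by (intro CollectI exI[of _ "\<lambda>v. c * \<rho> v"])
    qed
    moreover have "K \<union> G \<subseteq> ?L"
    proof -
      have "x - (\<Sum>v\<in>f ` G. 0 * v t) \<in> K" if "x \<in> K" for x using that by simp
      then have "K \<subseteq> ?L" by (intro subsetI CollectI exI[of _ "\<lambda>v. 0"])
      moreover have "x \<in> ?L" if "x \<in> G" for x
      proof (intro CollectI exI[of _ "\<lambda>v. if v = f x then 1 else 0"])
        have "(\<Sum>v\<in>f ` G. (if v = f x then 1 else 0) * v t) = (\<Sum>v\<in>f ` G. if v = f x then v t else 0)"
          by (rule sum.cong) auto
        also have "\<dots> = f x t" using that G by (simp add: sum.delta)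
        finally show "x - (\<Sum>v\<in>f ` G. (if v = f x then 1 else 0) * v t) \<in> K"
          using f(2)[OF that] by simp
      qed
      ultimately show ?thesis by blast
    qed
    ultimately have "L \<subseteq> ?L" unfolding G(2) by (rule idl.span_minimal[rotated])
    then show ?thesis using that by blast
  qed
  have "\<exists>\<rho>. \<forall>i<Suc t. u i - (\<Sum>v\<in>B. \<rho> v * v i) \<in> K" if u: "u \<in> N" for u
  proof -
    have "u t \<in> L" using u ideal_zero[OF K] unfolding L_def by force
    then obtain \<rho> where \<rho>: "u t - (\<Sum>v\<in>f ` G. \<rho> v * v t) \<in> K" using top by blast
    define u' where "u' i = u i - (\<Sum>v\<in>f ` G. \<rho> v * v i)" for i
    have "u' \<in> N" unfolding u'_def
      using closed_vectors_diff[OF N u closed_vectors_sum[OF N, of "f ` G" \<rho>]] f(1) by blast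
    then have "u' \<in> N'" using \<rho> by (simp add: N'_def u'_def)
    then obtain \<sigma> where \<sigma>: "\<And>i. i < t \<Longrightarrow> u' i - (\<Sum>v\<in>B'. \<sigma> v * v i) \<in> K"
      using B' unfolding spans_mod_def by meson
    \<comment> \<open>The two generating sets may overlap; a common vector receives the sum of both
      coefficients.\<close>
    define \<tau> where "\<tau> v = (if v \<in> f ` G then \<rho> v else 0) + (if v \<in> B' then \<sigma> v else 0)" for v
    have split: "(\<Sum>v\<in>B. \<tau> v * v i) = (\<Sum>v\<in>f ` G. \<rho> v * v i) + (\<Sum>v\<in>B'. \<sigma> v * v i)" for i
    proof -
      have "(\<Sum>v\<in>B. \<tau> v * v i) = (\<Sum>v\<in>B. if v \<in> f ` G then \<rho> v * v i else 0)
          + (\<Sum>v\<in>B. if v \<in> B' then \<sigma> v * v i else 0)"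
        unfolding sum.distrib[symmetric] by (rule sum.cong) (auto simp: \<tau>_def distrib_right)
      also have "\<dots> = (\<Sum>v\<in>f ` G. \<rho> v * v i) + (\<Sum>v\<in>B'. \<sigma> v * v i)"
        using fin by (simp add: sum.inter_restrict[symmetric] B_def Int_absorb1 Int_absorb2 Int_commute)
      finally show ?thesis .
    qed
    have "u i - (\<Sum>v\<in>B. \<tau> v * v i) \<in> K" if i: "i < Suc t" for i
    proof (cases "i = t")
      case True
      have "(\<Sum>v\<in>B'. \<sigma> v * v t) \<in> K"
        using B' by (intro idl.subspace_sum[OF K]) (auto simp: spans_mod_def N'_def intro: ideal_mult_left[OF K])
      then show ?thesis using ideal_diff[OF K \<rho>] True by (simp add: split diff_diff_eq)
    next
      case False
      then show ?thesis using \<sigma>[of i] i by (simp add: split u'_def diff_diff_eq)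
    qed
    then show ?thesis by blast
  qed
  then have "spans_mod K (Suc t) B N" using fin BN by (auto simp: spans_mod_def)
  then show ?case by blast
qed

text \<open>Least cardinality is enough: a relation with a coefficient outside \<open>M\<close>,
  hence invertible modulo \<open>K\<close>, would express one generator by the others.\<close>

lemma minimal_generators:
  assumes acc: "acc_above K" and K: "is_ideal K" and N: "closed_vectors N"
    and loc: "\<And>s. s \<notin> M \<Longrightarrow> \<exists>u. 1 - u * s \<in> K"
  shows "\<exists>s V. (\<forall>j<s. (\<lambda>i. V i j) \<in> N) \<and> (\<forall>u\<in>N. \<exists>\<rho>. \<forall>i<t. u i - dotp s (V i) \<rho> \<in> K)
     \<and> (\<forall>\<rho>. (\<forall>i<t. dotp s (V i) \<rho> \<in> K) \<longrightarrow> (\<forall>j<s. \<rho> j \<in> M))"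
proof -
  obtain B0 where "spans_mod K t B0 N" using vectors_finite_generation[OF acc K N] by blast
  then obtain B where B: "spans_mod K t B N" and min: "\<And>B'. spans_mod K t B' N \<Longrightarrow> card B \<le> card B'"
    using ex_has_least_nat[of "\<lambda>B. spans_mod K t B N" B0 card] by blast
  have fin: "finite B" using B by (simp add: spans_mod_def)
  have ind: "\<rho> v \<in> M" if ker: "\<And>i. i < t \<Longrightarrow> (\<Sum>v\<in>B. \<rho> v * v i) \<in> K" and v: "v \<in> B" for \<rho> v
  proof (rule ccontr)
    assume "\<rho> v \<notin> M"
    then obtain c where c: "1 - c * \<rho> v \<in> K" using loc by blast
    let ?B = "B - {v}"
    have "\<exists>\<sigma>. \<forall>i<t. u i - (\<Sum>v\<in>?B. \<sigma> v * v i) \<in> K" if "u \<in> N" for u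
    proof -
      obtain \<tau> where \<tau>: "\<And>i. i < t \<Longrightarrow> u i - (\<Sum>v\<in>B. \<tau> v * v i) \<in> K"
        using B \<open>u \<in> N\<close> unfolding spans_mod_def by meson
      define \<sigma> where "\<sigma> w = \<tau> w - \<tau> v * c * \<rho> w" for w
      have "u i - (\<Sum>w\<in>?B. \<sigma> w * w i) \<in> K" if i: "i < t" for i
      proof -
        have e: "(\<Sum>w\<in>?B. \<sigma> w * w i) = (\<Sum>w\<in>?B. \<tau> w * w i) - \<tau> v * c * (\<Sum>w\<in>?B. \<rho> w * w i)"
          by (simp add: \<sigma>_def sum_distrib_left left_diff_distrib sum_subtractf mult.assoc)
        have "(u i - (\<Sum>w\<in>B. \<tau> w * w i)) + (\<tau> v * v i) * (1 - c * \<rho> v) + (\<tau> v * c) * (\<Sum>w\<in>B. \<rho> w * w i) \<in> K"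
          by (intro ideal_add[OF K] ideal_mult_left[OF K] \<tau>[OF i] ker[OF i] c)
        also have "(u i - (\<Sum>w\<in>B. \<tau> w * w i)) + (\<tau> v * v i) * (1 - c * \<rho> v) + (\<tau> v * c) * (\<Sum>w\<in>B. \<rho> w * w i)
           = u i - (\<Sum>w\<in>?B. \<sigma> w * w i)"
          unfolding e sum.remove[OF fin v, of "\<lambda>w. \<tau> w * w i"] sum.remove[OF fin v, of "\<lambda>w. \<rho> w * w i"]
          by (simp add: algebra_simps)
        finally show ?thesis .
      qed
      then show ?thesis by blast
    qed
    then have "spans_mod K t ?B N" using B by (auto simp: spans_mod_def)
    then have "card B \<le> card ?B" by (rule min)
    then show False using card_Diff1_less[OF fin v] by simp
  qed
  obtain h where h: "bij_betw h {..<card B} B"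
    using ex_bij_betw_nat_finite[OF fin] by (auto simp: atLeast0LessThan)
  define V where "V i j = h j i" for i j
  have dot: "dotp (card B) (V i) (\<lambda>j. \<rho> (h j)) = (\<Sum>v\<in>B. \<rho> v * v i)" for i \<rho>
    unfolding dotp_def V_def using sum.reindex_bij_betw[OF h, of "\<lambda>v. \<rho> v * v i"] by (simp add: mult.commute)
  show ?thesis
  proof (intro exI[of _ "card B"] exI[of _ V] conjI allI impI ballI)
    fix j assume "j < card B"
    then have "h j \<in> B" using h by (auto simp: bij_betw_def)
    then show "(\<lambda>i. V i j) \<in> N" using B by (auto simp: V_def spans_mod_def)
  next
    fix u assume "u \<in> N"
    then obtain \<rho> where "\<forall>i<t. u i - (\<Sum>v\<in>B. \<rho> v * v i) \<in> K"
      using B unfolding spans_mod_def by meson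
    then show "\<exists>\<rho>. \<forall>i<t. u i - dotp (card B) (V i) \<rho> \<in> K"
      by (intro exI[of _ "\<lambda>j. \<rho> (h j)"]) (simp add: dot)
  next
    fix \<rho> j assume ker: "\<forall>i<t. dotp (card B) (V i) \<rho> \<in> K" and j: "j < card B"
    define \<sigma> where "\<sigma> v = \<rho> (inv_into {..<card B} h v)" for v
    have \<sigma>: "\<sigma> (h j) = \<rho> j" if "j < card B" for j
      using that h by (simp add: \<sigma>_def bij_betw_def)
    have "dotp (card B) (V i) \<rho> = dotp (card B) (V i) (\<lambda>j. \<sigma> (h j))" for i
      unfolding dotp_def by (rule sum.cong) (auto simp: \<sigma>)
    then have "\<sigma> (h j) \<in> M" using ker j h by (intro ind) (auto simp: dot bij_betw_def)
    then show "\<rho> j \<in> M" using \<sigma>[OF j] by simp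
  qed
qed

text \<open>One step of the descent from \<open>M\<close> to \<open>K\<close> of an ideal containing the entries of all relations:
  it uses that \<open>x\<close> is regular on the module spanned by the columns of \<open>V\<close> modulo \<open>E\<close>.\<close>

lemma kernel_entries_descend:
  fixes V :: "nat \<Rightarrow> nat \<Rightarrow> 'a::comm_ring_1"
  assumes acc: "acc_above K" and M: "prime_ideal M" "x \<in> M"
    and loc: "\<And>s. s \<notin> M \<Longrightarrow> \<exists>u. 1 - u * s \<in> K"
    and E: "is_ideal E" "K \<subseteq> E"
    and ker: "\<And>\<rho>. \<forall>i<t. dotp s (V i) \<rho> \<in> K \<Longrightarrow> \<forall>j<s. \<rho> j \<in> gen (insert x E)"
    and reg: "\<And>\<rho> e. \<forall>j<s. e j \<in> E \<Longrightarrow> \<forall>i<t. x * dotp s (V i) \<rho> + dotp s (V i) e \<in> K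
       \<Longrightarrow> \<exists>e'. (\<forall>j<s. e' j \<in> E) \<and> (\<forall>i<t. dotp s (V i) \<rho> - dotp s (V i) e' \<in> K)"
    and \<rho>: "\<forall>i<t. dotp s (V i) \<rho> \<in> K" and j: "j < s"
  shows "\<rho> j \<in> E"
proof -
  \<comment> \<open>All entries of all relations are collected, so that the entry produced below,
    which belongs to a different relation, is in \<open>C\<close> again and Nakayama's lemma
    applies.\<close>
  define C where "C = {c. \<exists>\<rho> j. (\<forall>i<t. dotp s (V i) \<rho> \<in> K) \<and> j < s \<and> c = \<rho> j}"
  have "\<rho> j \<in> C" using \<rho> j unfolding C_def by blast
  have "\<exists>s. s \<notin> M \<and> s * \<rho> j \<in> E"
  proof (rule principal_nakayama_prime[OF acc E M _ \<open>\<rho> j \<in> C\<close>])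
    fix c assume "c \<in> C"
    then obtain \<rho> j where c: "\<forall>i<t. dotp s (V i) \<rho> \<in> K" "j < s" "c = \<rho> j" unfolding C_def by blast
    have "\<forall>j. \<exists>r. j < s \<longrightarrow> \<rho> j - r * x \<in> E" using ker[OF c(1)] gen_insert_iff[OF E(1)] by blast
    then obtain r where r: "\<And>j. j < s \<Longrightarrow> \<rho> j - r j * x \<in> E" by metis
    define e where "e j = \<rho> j - r j * x" for j
    have "dotp s (V i) \<rho> = x * dotp s (V i) r + dotp s (V i) e" for i
    proof -
      have "\<rho> = (\<lambda>j. x * r j + e j)" by (auto simp: e_def)
      then show ?thesis by (simp add: dotp_add dotp_scale)
    qed
    then have "\<forall>i<t. x * dotp s (V i) r + dotp s (V i) e \<in> K" using c by auto
    moreover have e: "\<forall>j<s. e j \<in> E" using r by (simp add: e_def)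
    \<comment> \<open>By \<open>reg\<close> the vector \<open>r\<close> becomes a relation once a
      vector \<open>e'\<close> with entries in \<open>E\<close> is subtracted; hence
      \<open>\<rho> j\<close> is \<open>x * (r j - e' j)\<close> modulo \<open>E\<close>.\<close>
    ultimately obtain e' where e': "\<forall>j<s. e' j \<in> E" "\<forall>i<t. dotp s (V i) r - dotp s (V i) e' \<in> K"
      using reg by blast
    have "\<forall>i<t. dotp s (V i) (\<lambda>j. r j - e' j) \<in> K" using e'(2) by (simp add: dotp_diff)
    then have C': "r j - e' j \<in> C" using c(2) unfolding C_def
      by (intro CollectI exI[of _ "\<lambda>j. r j - e' j"] exI[of _ j]) auto
    have "e j + x * e' j \<in> E" using e e' c(2) by (intro ideal_add[OF E(1)] ideal_mult_left[OF E(1)]) auto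
    also have "e j + x * e' j = 1 * c - x * (r j - e' j)" by (simp add: c(3) e_def algebra_simps)
    finally show "\<exists>s. s \<notin> M \<and> (\<exists>c'\<in>C. s * c - x * c' \<in> E)"
      using C' prime_idealD(2)[OF M(1)] by blast
  qed
  then show ?thesis using local_cancel[OF loc E] by blast
qed

lemma gen_insert_gen: "gen (insert y (gen S)) = gen (insert y S)"
proof
  show "gen (insert y (gen S)) \<subseteq> gen (insert y S)"
    using idl.span_mono[of S "insert y S"] gen_insert_mem by (intro gen_insert_minimal) auto
  show "gen (insert y S) \<subseteq> gen (insert y (gen S))"
    using idl.span_superset[of S] by (intro idl.span_mono) auto
qed

text \<open>The reason is that \<open>xs\<close> is a regular sequence on the module of syzygies.\<close>

lemma syzygies_free:
  fixes V :: "nat \<Rightarrow> nat \<Rightarrow> 'a::comm_ring_1"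
  assumes acc: "acc_above K" and K: "prime_ideal K" and M: "prime_ideal M"
    and loc: "\<And>s. s \<notin> M \<Longrightarrow> \<exists>u. 1 - u * s \<in> K"
    and xs: "length xs \<le> 3" "M = gen (K \<union> set xs)"
      "\<And>i. i \<le> length xs \<Longrightarrow> prime_ideal (gen (K \<union> set (take i xs)))"
      "\<And>i. i < length xs \<Longrightarrow> xs ! i \<notin> gen (K \<union> set (take i xs))"
    and a: "a \<notin> K" and J: "quot (gen (insert a K)) b = gen (K \<union> g ` {..<t})"
    and rel: "\<And>j. j < s \<Longrightarrow> dotp t g (\<lambda>i. V i j) \<in> K"
    and ex: "\<And>u. dotp t g u \<in> K \<Longrightarrow> \<exists>\<rho>. \<forall>i<t. u i - dotp s (V i) \<rho> \<in> K"
    and min: "\<And>\<rho>. \<forall>i<t. dotp s (V i) \<rho> \<in> K \<Longrightarrow> \<forall>j<s. \<rho> j \<in> M"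
    and \<rho>: "\<forall>i<t. dotp s (V i) \<rho> \<in> K"
  shows "\<forall>j<s. \<rho> j \<in> K"
proof -
  have idK: "is_ideal K" using prime_idealD(1)[OF K] .
  have syz: "dotp t g (\<lambda>i. dotp s (V i) \<sigma>) \<in> K" for \<sigma>
  proof -
    have "dotp t g (\<lambda>i. dotp s (V i) \<sigma>) = (\<Sum>i<t. \<Sum>j<s. g i * V i j * \<sigma> j)"
      by (simp add: dotp_def sum_distrib_left mult.assoc)
    also have "\<dots> = (\<Sum>j<s. \<Sum>i<t. g i * V i j * \<sigma> j)" by (rule sum.swap)
    also have "\<dots> = dotp s \<sigma> (\<lambda>j. dotp t g (\<lambda>i. V i j))"
      by (simp add: dotp_def sum_distrib_left mult_ac)
    finally show ?thesis using dotp_ideal[OF idK rel] by simp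
  qed
  note step = kernel_entries_descend[OF acc M _ loc]
  \<comment> \<open>\<open>x\<close> is regular on the syzygies because they lie in a free module
    over the domain \<open>T/K\<close>.\<close>
  have stepK: "\<forall>j<s. \<rho> j \<in> K" if x: "x \<in> M" "x \<notin> K" and \<rho>: "\<forall>i<t. dotp s (V i) \<rho> \<in> K"
    and ker: "\<And>\<rho>. \<forall>i<t. dotp s (V i) \<rho> \<in> K \<Longrightarrow> \<forall>j<s. \<rho> j \<in> gen (insert x K)" for x \<rho>
  proof (intro allI impI)
    fix j assume j: "j < s"
    show "\<rho> j \<in> K"
    proof (rule step[OF x(1) _ idK order.refl ker _ \<rho> j])
    fix r e assume e: "\<forall>j<s. e j \<in> K" "\<forall>i<t. x * dotp s (V i) r + dotp s (V i) e \<in> K"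
    have "dotp s (V i) r \<in> K" if i: "i < t" for i
    proof -
      have "dotp s (V i) e \<in> K" using dotp_ideal[OF idK] e(1) by blast
      then have "x * dotp s (V i) r \<in> K"
        using e(2) i ideal_add_iff[OF idK, of "dotp s (V i) e" "x * dotp s (V i) r"] by (simp add: add.commute)
      then show ?thesis using prime_mult_iff[OF K] x by blast
    qed
    then show "\<exists>e'. (\<forall>j<s. e' j \<in> K) \<and> (\<forall>i<t. dotp s (V i) r - dotp s (V i) e' \<in> K)"
      using ideal_zero[OF idK] by (intro exI[of _ "\<lambda>j. 0"]) (auto simp: dotp_def)
    qed
  qed
  have split1: "\<exists>\<epsilon>. \<forall>j<n. v j - x * \<epsilon> j \<in> K" if "\<forall>j<n. v j \<in> gen (insert x K)" for x v and n :: nat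
  proof -
    have "\<forall>j. \<exists>r. j < n \<longrightarrow> v j - x * r \<in> K"
      using that gen_insert_iff[OF idK] by (metis mult.commute)
    then show ?thesis by metis
  qed
  \<comment> \<open>\<open>y\<close> is regular on the syzygies modulo \<open>x\<close>, because a
    syzygy divisible by \<open>x\<close> as a vector is \<open>x\<close> times a syzygy.\<close>
  have stepx: "\<forall>j<s. \<rho> j \<in> gen (insert x K)" if x: "x \<notin> K" and P: "prime_ideal (gen (insert x K))"
    and y: "y \<in> M" "y \<notin> gen (insert x K)" and \<rho>: "\<forall>i<t. dotp s (V i) \<rho> \<in> K"
    and ker: "\<And>\<rho>. \<forall>i<t. dotp s (V i) \<rho> \<in> K \<Longrightarrow> \<forall>j<s. \<rho> j \<in> gen (insert y (gen (insert x K)))" for x y \<rho>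
  proof (intro allI impI)
    fix j assume j: "j < s"
    show "\<rho> j \<in> gen (insert x K)"
    proof (rule step[OF y(1) _ prime_idealD(1)[OF P] gen_insert_superset ker _ \<rho> j])
    fix r e assume e: "\<forall>j<s. e j \<in> gen (insert x K)" "\<forall>i<t. y * dotp s (V i) r + dotp s (V i) e \<in> K"
    note idP = prime_idealD(1)[OF P]
    have "dotp s (V i) r \<in> gen (insert x K)" if i: "i < t" for i
    proof -
      have "dotp s (V i) e \<in> gen (insert x K)" using dotp_ideal[OF idP] e(1) by blast
      moreover have "y * dotp s (V i) r + dotp s (V i) e \<in> gen (insert x K)"
        using e(2) i gen_insert_superset by blast
      ultimately have "y * dotp s (V i) r \<in> gen (insert x K)"
        using ideal_add_iff[OF idP, of "dotp s (V i) e" "y * dotp s (V i) r"] by (simp add: add.commute)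
      then show ?thesis using prime_mult_iff[OF P] y by blast
    qed
    then obtain w where w: "\<And>i. i < t \<Longrightarrow> dotp s (V i) r - x * w i \<in> K"
      using split1[of t "\<lambda>i. dotp s (V i) r" x] by blast
    have "dotp t g (\<lambda>i. dotp s (V i) r - x * w i) \<in> K" by (rule dotp_ideal[OF idK w])
    then have "dotp t g (\<lambda>i. dotp s (V i) r) - x * dotp t g w \<in> K" by (simp add: dotp_diff dotp_scale)
    then have "x * dotp t g w \<in> K" by (rule ideal_minus_cancel[OF idK syz])
    then have "dotp t g w \<in> K" using prime_mult_iff[OF K] x by blast
    then obtain \<epsilon> where \<epsilon>: "\<And>i. i < t \<Longrightarrow> w i - dotp s (V i) \<epsilon> \<in> K" using ex by blast
    show "\<exists>e'. (\<forall>j<s. e' j \<in> gen (insert x K)) \<and> (\<forall>i<t. dotp s (V i) r - dotp s (V i) e' \<in> K)"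
    proof (intro exI[of _ "\<lambda>j. x * \<epsilon> j"] conjI allI impI)
      fix j show "x * \<epsilon> j \<in> gen (insert x K)" by (rule ideal_mult_right[OF idP gen_insert_mem])
    next
      fix i assume i: "i < t"
      have "(dotp s (V i) r - x * w i) + x * (w i - dotp s (V i) \<epsilon>) \<in> K"
        by (rule ideal_add[OF idK w[OF i] ideal_mult_left[OF idK \<epsilon>[OF i]]])
      then show "dotp s (V i) r - dotp s (V i) (\<lambda>j. x * \<epsilon> j) \<in> K" by (simp add: dotp_scale algebra_simps)
    qed
    qed
  qed
  have split2: "\<exists>\<epsilon> \<eta>. \<forall>j<n. v j - (x * \<epsilon> j + y * \<eta> j) \<in> K"
    if "\<forall>j<n. v j \<in> gen (insert y (gen (insert x K)))" for x y v and n :: nat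
  proof -
    have "\<forall>j. \<exists>r q. j < n \<longrightarrow> v j - (x * r + y * q) \<in> K"
    proof
      fix j
      show "\<exists>r q. j < n \<longrightarrow> v j - (x * r + y * q) \<in> K"
      proof (cases "j < n")
        case True
        then have "v j \<in> gen (insert y (gen (insert x K)))" using that by simp
        then obtain q where "v j - q * y \<in> gen (insert x K)"
          using gen_insert_iff[OF idl.subspace_span, of "v j" y "insert x K"] by metis
        then obtain r where "(v j - q * y) - r * x \<in> K" using gen_insert_iff[OF idK] by blast
        then have "v j - (x * r + y * q) \<in> K" by (simp add: algebra_simps)
        then show ?thesis by blast
      qed simp
    qed
    then show ?thesis by metis
  qed
  \<comment> \<open>\<open>z\<close> is regular on the syzygies modulo \<open>x\<close> and
    \<open>y\<close>. In a syzygy \<open>w = x \<alpha> + y \<beta>\<close> the vectors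
    \<open>\<alpha>\<close> and \<open>\<beta>\<close> need not be syzygies: there is only some
    \<open>c\<close> with \<open>g \<alpha> = y c\<close> and \<open>g \<beta> = - x c\<close>. This
    obstruction can be removed if \<open>c\<close> is in the ideal of the
    \<open>g i\<close>.\<close>
  have stepxy: "\<forall>j<s. \<rho> j \<in> gen (insert y (gen (insert x K)))"
    if x: "x \<notin> K" and P: "prime_ideal (gen (insert x K))" and y: "y \<notin> gen (insert x K)"
    and Q: "prime_ideal (gen (insert y (gen (insert x K))))"
    and z: "z \<in> M" "z \<notin> gen (insert y (gen (insert x K)))" and \<rho>: "\<forall>i<t. dotp s (V i) \<rho> \<in> K"
    and ker: "\<And>\<rho>. \<forall>i<t. dotp s (V i) \<rho> \<in> K
      \<Longrightarrow> \<forall>j<s. \<rho> j \<in> gen (insert z (gen (insert y (gen (insert x K)))))" for x y z \<rho>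
  proof (intro allI impI)
    fix j assume j: "j < s"
    show "\<rho> j \<in> gen (insert y (gen (insert x K)))"
    proof (rule step[OF z(1) _ prime_idealD(1)[OF Q] _ ker _ \<rho> j])
    let ?P = "gen (insert x K)" let ?Q = "gen (insert y ?P)"
    note idP = prime_idealD(1)[OF P] and idQ = prime_idealD(1)[OF Q]
    have KP: "K \<subseteq> ?P" and PQ: "?P \<subseteq> ?Q" by (rule gen_insert_superset)+
    then show "K \<subseteq> ?Q" by blast
    have xP: "x \<in> ?P" by (rule gen_insert_mem)
    have yQ: "y \<in> ?Q" by (rule gen_insert_mem)
    \<comment> \<open>\<open>x\<close> and \<open>y\<close> form a regular sequence modulo
      \<open>K\<close>, so every relation between them is a multiple of the obvious one.\<close>
    have divx: "\<exists>h. q + x * h \<in> K \<and> p - y * h \<in> K" if pq: "x * p + y * q \<in> K" for p q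
    proof -
      have "x * p \<in> ?P" using ideal_mult_right[OF idP xP] .
      then have "y * q \<in> ?P" using pq KP ideal_add_iff[OF idP, of "x * p" "y * q"] by blast
      then have "q \<in> ?P" using prime_mult_iff[OF P] y by blast
      then obtain h where h: "q - h * x \<in> K" using gen_insert_iff[OF idK] by blast
      have "(x * p + y * q) - y * (q - h * x) \<in> K" by (rule ideal_diff[OF idK pq ideal_mult_left[OF idK h]])
      also have "(x * p + y * q) - y * (q - h * x) = x * (p - y * (- h))" by (simp add: algebra_simps)
      finally have "p - y * (- h) \<in> K" using prime_mult_iff[OF K] x by blast
      moreover have "q + x * (- h) \<in> K" using h by (simp add: algebra_simps)
      ultimately show ?thesis by blast
    qed
    fix r e assume e: "\<forall>j<s. e j \<in> ?Q" "\<forall>i<t. z * dotp s (V i) r + dotp s (V i) e \<in> K"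
    obtain \<epsilon> \<eta> where \<epsilon>: "\<And>j. j < s \<Longrightarrow> e j - (x * \<epsilon> j + y * \<eta> j) \<in> K" using split2[OF e(1)] by blast
    define w where "w i = dotp s (V i) r" for i
    define p where "p i = dotp s (V i) \<epsilon>" for i
    define q where "q i = dotp s (V i) \<eta>" for i
    have Gw: "dotp t g w \<in> K" "dotp t g p \<in> K" "dotp t g q \<in> K"
      unfolding w_def p_def q_def by (rule syz)+
    have zw: "z * w i + x * p i + y * q i \<in> K" if i: "i < t" for i
    proof -
      have "dotp s (V i) (\<lambda>j. e j - (x * \<epsilon> j + y * \<eta> j)) \<in> K" by (rule dotp_ideal[OF idK \<epsilon>])
      then have "dotp s (V i) e - (x * p i + y * q i) \<in> K"
        by (simp add: dotp_diff dotp_add dotp_scale p_def q_def)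
      from ideal_diff[OF idK e(2)[rule_format, OF i] this] show ?thesis by (simp add: w_def algebra_simps)
    qed
    have "w i \<in> ?Q" if i: "i < t" for i
    proof -
      have "x * p i + y * q i \<in> ?Q" using xP yQ PQ
        by (intro ideal_add[OF idQ] ideal_mult_right[OF idQ]) auto
      moreover have "z * w i + x * p i + y * q i \<in> ?Q" using zw[OF i] KP PQ by blast
      ultimately have "z * w i \<in> ?Q"
        using ideal_add_iff[OF idQ, of "x * p i + y * q i" "z * w i"] by (simp add: algebra_simps)
      then show ?thesis using prime_mult_iff[OF Q] z by blast
    qed
    then obtain \<alpha> \<beta> where ab: "\<And>i. i < t \<Longrightarrow> w i - (x * \<alpha> i + y * \<beta> i) \<in> K" using split2[of t w] by blast
    have "dotp t g (\<lambda>i. w i - (x * \<alpha> i + y * \<beta> i)) \<in> K" by (rule dotp_ideal[OF idK ab])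
    then have "dotp t g w - (x * dotp t g \<alpha> + y * dotp t g \<beta>) \<in> K"
      by (simp add: dotp_diff dotp_add dotp_scale)
    then have "x * dotp t g \<alpha> + y * dotp t g \<beta> \<in> K" by (rule ideal_minus_cancel[OF idK Gw(1)])
    then obtain c where c: "dotp t g \<beta> + x * c \<in> K" "dotp t g \<alpha> - y * c \<in> K" using divx by blast
    have "\<forall>i. \<exists>h. i < t \<longrightarrow> (z * \<beta> i + q i) + x * h \<in> K \<and> (z * \<alpha> i + p i) - y * h \<in> K"
    proof
      fix i show "\<exists>h. i < t \<longrightarrow> (z * \<beta> i + q i) + x * h \<in> K \<and> (z * \<alpha> i + p i) - y * h \<in> K"
      proof (cases "i < t")
        case True
        have "(z * w i + x * p i + y * q i) - z * (w i - (x * \<alpha> i + y * \<beta> i)) \<in> K"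
          by (rule ideal_diff[OF idK zw[OF True] ideal_mult_left[OF idK ab[OF True]]])
        also have "(z * w i + x * p i + y * q i) - z * (w i - (x * \<alpha> i + y * \<beta> i))
            = x * (z * \<alpha> i + p i) + y * (z * \<beta> i + q i)" by (simp add: algebra_simps)
        finally show ?thesis using divx by blast
      qed simp
    qed
    then obtain h where h: "\<And>i. i < t \<Longrightarrow> (z * \<alpha> i + p i) - y * h i \<in> K" by metis
    have "dotp t g (\<lambda>i. (z * \<alpha> i + p i) - y * h i) \<in> K" by (rule dotp_ideal[OF idK h])
    then have "z * dotp t g \<alpha> + dotp t g p - y * dotp t g h \<in> K"
      by (simp add: dotp_diff dotp_add dotp_scale)
    from ideal_diff[OF idK ideal_diff[OF idK this Gw(2)] ideal_mult_left[OF idK c(2)]]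
    have "(z * dotp t g \<alpha> + dotp t g p - y * dotp t g h) - dotp t g p - z * (dotp t g \<alpha> - y * c) \<in> K" .
    also have "(z * dotp t g \<alpha> + dotp t g p - y * dotp t g h) - dotp t g p - z * (dotp t g \<alpha> - y * c)
        = y * (z * c - dotp t g h)" by (simp add: algebra_simps)
    finally have "z * c - dotp t g h \<in> K" using prime_mult_iff[OF K] y KP by blast
    let ?J = "quot (gen (insert a K)) b"
    have ida: "is_ideal (gen (insert a K))" by simp
    have Jiff: "u \<in> ?J \<longleftrightarrow> (\<exists>f. u - dotp t g f \<in> K)" for u
      unfolding J by (rule gen_image_iff[OF idK])
    have "x * c - dotp t g (\<lambda>i. (-1) * \<beta> i) \<in> K"
      using c(1) by (simp only: dotp_scale) (simp add: add.commute)
    then have xc: "x * c \<in> ?J" unfolding Jiff by blast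
    have "- 1 * (dotp t g \<alpha> - y * c) \<in> K" by (rule ideal_mult_left[OF idK c(2)])
    then have "y * c - dotp t g \<alpha> \<in> K" by simp
    then have yc: "y * c \<in> ?J" unfolding Jiff by blast
    \<comment> \<open>Here it matters that the ideal is a colon ideal \<open>(a : b)\<close>: it
      contains every \<open>c\<close> for which it contains \<open>x c\<close> and
      \<open>y c\<close>.\<close>
    have "c \<in> ?J"
    proof -
      obtain h1 h2 where h12: "x * c * b - h1 * a \<in> K" "y * c * b - h2 * a \<in> K"
        using xc yc by (auto simp: quot_def gen_insert_iff[OF idK])
      have "y * (x * c * b - h1 * a) - x * (y * c * b - h2 * a) \<in> K"
        by (intro ideal_diff[OF idK] ideal_mult_left[OF idK] h12)
      also have "y * (x * c * b - h1 * a) - x * (y * c * b - h2 * a) = a * (x * h2 + y * (- h1))"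
        by (simp add: algebra_simps)
      finally have "x * h2 + y * (- h1) \<in> K" using prime_mult_iff[OF K] a by blast
      then obtain k where k: "- h1 + x * k \<in> K" using divx by blast
      have "(x * c * b - h1 * a) - a * (- h1 + x * k) \<in> K"
        by (rule ideal_diff[OF idK h12(1) ideal_mult_left[OF idK k]])
      also have "(x * c * b - h1 * a) - a * (- h1 + x * k) = x * (c * b - k * a)" by (simp add: algebra_simps)
      finally have "c * b - k * a \<in> K" using prime_mult_iff[OF K] x by blast
      then show ?thesis by (auto simp: quot_def gen_insert_iff[OF idK])
    qed
    then obtain f where f: "c - dotp t g f \<in> K" using Jiff by blast
    \<comment> \<open>Replacing \<open>\<alpha>\<close> by \<open>\<alpha> - y f\<close> and
      \<open>\<beta>\<close> by \<open>\<beta> + x f\<close> leaves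
      \<open>x \<alpha> + y \<beta>\<close> unchanged and makes both vectors syzygies.\<close>
    have "dotp t g (\<lambda>i. \<alpha> i - y * f i) \<in> K"
      using ideal_add[OF idK c(2) ideal_mult_left[OF idK f, of y]]
      by (simp add: dotp_diff dotp_scale algebra_simps)
    then obtain A where A: "\<And>i. i < t \<Longrightarrow> (\<alpha> i - y * f i) - dotp s (V i) A \<in> K" using ex by blast
    have "dotp t g (\<lambda>i. \<beta> i + x * f i) \<in> K"
      using ideal_diff[OF idK c(1) ideal_mult_left[OF idK f, of x]]
      by (simp add: dotp_add dotp_scale algebra_simps)
    then obtain B where B: "\<And>i. i < t \<Longrightarrow> (\<beta> i + x * f i) - dotp s (V i) B \<in> K" using ex by blast
    show "\<exists>e'. (\<forall>j<s. e' j \<in> ?Q) \<and> (\<forall>i<t. dotp s (V i) r - dotp s (V i) e' \<in> K)"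
    proof (intro exI[of _ "\<lambda>j. x * A j + y * B j"] conjI allI impI)
      fix j show "x * A j + y * B j \<in> ?Q" using xP yQ PQ
        by (intro ideal_add[OF idQ] ideal_mult_right[OF idQ]) auto
    next
      fix i assume i: "i < t"
      have "(w i - (x * \<alpha> i + y * \<beta> i)) + x * ((\<alpha> i - y * f i) - dotp s (V i) A)
          + y * ((\<beta> i + x * f i) - dotp s (V i) B) \<in> K"
        by (intro ideal_add[OF idK] ideal_mult_left[OF idK] ab A B i)
      then show "dotp s (V i) r - dotp s (V i) (\<lambda>j. x * A j + y * B j) \<in> K"
        by (simp add: dotp_add dotp_scale w_def algebra_simps)
    qed
    qed
  qed
  consider "xs = []" | x where "xs = [x]" | x y where "xs = [x, y]" | x y z where "xs = [x, y, z]"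
  proof -
    have "length xs = 0 \<or> length xs = 1 \<or> length xs = 2 \<or> length xs = 3" using xs(1) by linarith
    then show ?thesis using that by (auto simp: length_Suc_conv numeral_2_eq_2 numeral_3_eq_3)
  qed
  then show ?thesis
  proof cases
    case 1
    then show ?thesis using min[OF \<rho>] xs(2) by (simp add: idK)
  next
    case 2
    then have "x \<notin> K" "M = gen (insert x K)" using xs(2) xs(4)[of 0] by (auto simp: idK)
    then show ?thesis using stepK[OF _ _ \<rho>, of x] min gen_insert_mem[of x K] by blast
  next
    case 3
    have x: "x \<notin> K" "prime_ideal (gen (insert x K))" "y \<notin> gen (insert x K)"
      and M2: "M = gen (insert y (gen (insert x K)))"
      using 3 xs(2) xs(3)[of 1] xs(4)[of 0] xs(4)[of 1] by (auto simp: idK gen_insert_gen insert_commute)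
    have "y \<in> M" "x \<in> M" unfolding M2 using gen_insert_mem gen_insert_superset by blast+
    then show ?thesis
      using stepK[OF _ x(1) \<rho> stepx[OF x(1,2) _ x(3)]] min unfolding M2 by blast
  next
    case 4
    have x: "x \<notin> K" "prime_ideal (gen (insert x K))" "y \<notin> gen (insert x K)"
      "prime_ideal (gen (insert y (gen (insert x K))))" "z \<notin> gen (insert y (gen (insert x K)))"
      and M3: "M = gen (insert z (gen (insert y (gen (insert x K)))))"
      using 4 xs(2) xs(3)[of 1] xs(3)[of 2] xs(4)[of 0] xs(4)[of 1] xs(4)[of 2]
      by (auto simp: idK gen_insert_gen insert_commute numeral_2_eq_2)
    have "z \<in> M" "y \<in> M" "x \<in> M" unfolding M3 using gen_insert_mem gen_insert_superset by blast+
    then show ?thesis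
      using stepK[OF _ x(1) \<rho> stepx[OF x(1,2) _ x(3) _ stepxy[OF x(1-4) _ x(5)]]] min unfolding M3 by blast
  qed
qed

text \<open>This is factoriality as a statement on ideals: in a factorial ring
  \<open>(a : b)\<close> is generated by \<open>a / gcd a b\<close>.\<close>

theorem local_colon_principal:
  fixes K :: "'a::comm_ring_1 set"
  assumes acc: "acc_above K" and K: "prime_ideal K" and M: "prime_ideal M"
    and loc: "\<And>s. s \<notin> M \<Longrightarrow> \<exists>u. 1 - u * s \<in> K"
    and xs: "length xs \<le> 3" "M = gen (K \<union> set xs)"
      "\<And>i. i \<le> length xs \<Longrightarrow> prime_ideal (gen (K \<union> set (take i xs)))"
      "\<And>i. i < length xs \<Longrightarrow> xs ! i \<notin> gen (K \<union> set (take i xs))"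
  shows "\<exists>c. quot (gen (insert a K)) b = gen (insert c K)"
proof (cases "a \<in> K")
  case True
  have idK: "is_ideal K" using prime_idealD(1)[OF K] .
  have "gen (insert a K) = K" using True idK by (simp add: insert_absorb)
  moreover have "quot K b = (if b \<in> K then UNIV else K)"
    using prime_mult_iff[OF K] by (auto simp: quot_def)
  moreover have "gen (insert 1 K) = UNIV"
    using ideal_eq_UNIV[OF idl.subspace_span gen_insert_mem] by auto
  moreover have "gen (insert 0 K) = K" using idK ideal_zero[OF idK] by (simp add: insert_absorb)
  ultimately show ?thesis by metis
next
  case a: False
  have idK: "is_ideal K" using prime_idealD(1)[OF K] .
  let ?J = "quot (gen (insert a K)) b"
  have "is_ideal ?J" "K \<subseteq> ?J"
    using quot_ideal quot_superset[of "gen (insert a K)" b] gen_insert_superset[of K a] by auto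
  then obtain G where G: "finite G" "?J = gen (K \<union> G)" using acc_finite_generation[OF acc] by blast
  obtain g where "bij_betw g {..<card G} G"
    using ex_bij_betw_nat_finite[OF G(1)] by (auto simp: atLeast0LessThan)
  then have J: "?J = gen (K \<union> g ` {..<card G})" using G by (simp add: bij_betw_def)
  define t where "t = card G"
  define N where "N = {u. dotp t g u \<in> K}"
  have "closed_vectors N"
    unfolding closed_vectors_def N_def using ideal_zero[OF idK] ideal_add[OF idK] ideal_mult_left[OF idK]
    by (auto simp: dotp_add dotp_scale) (simp add: dotp_def)
  then have "\<exists>s V. (\<forall>j<s. (\<lambda>i. V i j) \<in> N) \<and> (\<forall>u\<in>N. \<exists>\<rho>. \<forall>i<t. u i - dotp s (V i) \<rho> \<in> K)
     \<and> (\<forall>\<rho>. (\<forall>i<t. dotp s (V i) \<rho> \<in> K) \<longrightarrow> (\<forall>j<s. \<rho> j \<in> M))"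
    by (rule minimal_generators[OF acc idK]) (rule loc)
  then obtain s V where V: "\<forall>j<s. (\<lambda>i. V i j) \<in> N"
     "\<forall>u\<in>N. \<exists>\<rho>. \<forall>i<t. u i - dotp s (V i) \<rho> \<in> K"
     "\<forall>\<rho>. (\<forall>i<t. dotp s (V i) \<rho> \<in> K) \<longrightarrow> (\<forall>j<s. \<rho> j \<in> M)"
    by (elim exE conjE) (rule that)
  have rel: "dotp t g (\<lambda>i. V i j) \<in> K" if "j < s" for j using V(1) that by (simp add: N_def)
  have ex: "\<exists>\<rho>. \<forall>i<t. u i - dotp s (V i) \<rho> \<in> K" if "dotp t g u \<in> K" for u
    using V(2) that by (simp add: N_def)
  have free: "\<forall>j<s. \<rho> j \<in> K" if ker: "\<forall>i<t. dotp s (V i) \<rho> \<in> K" for \<rho>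
  proof (rule syzygies_free[where K=K and M=M and xs=xs and a=a and b=b and g=g and t=t and V=V and s=s])
    show "\<exists>u. 1 - u * r \<in> K" if "r \<notin> M" for r using loc that by blast
    show "\<forall>j<s. \<sigma> j \<in> M" if "\<forall>i<t. dotp s (V i) \<sigma> \<in> K" for \<sigma>
      using V(3) that by simp
  qed (fact acc K M xs a J[folded t_def] rel ex ker)+
  show ?thesis
  proof (rule colon_principal_of_free_syzygies[OF K a J[folded t_def], of s V])
    fix j assume "j < s" then show "(\<Sum>i<t. g i * V i j) \<in> K" using rel by (simp add: dotp_def)
  next
    fix u assume "(\<Sum>i<t. g i * u i) \<in> K"
    then show "\<exists>\<rho>. \<forall>i<t. u i - (\<Sum>j<s. V i j * \<rho> j) \<in> K" using ex by (simp add: dotp_def)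
  next
    fix \<rho> assume "\<And>i. i < t \<Longrightarrow> (\<Sum>j<s. V i j * \<rho> j) \<in> K"
    then show "\<forall>j<s. \<rho> j \<in> K" using free by (simp add: dotp_def)
  qed
qed

section \<open>Powers, associated primes and depth\<close>

definition assoc_primes :: "'a::comm_ring_1 set \<Rightarrow> 'a set set" where
  "assoc_primes A = {P. prime_ideal P \<and> (\<exists>x. P = quot A x)}"

definition reg_seq :: "'a::comm_ring_1 set \<Rightarrow> 'a set \<Rightarrow> 'a list \<Rightarrow> bool" where
  "reg_seq M J ys \<longleftrightarrow> set ys \<subseteq> M
     \<and> (\<forall>i<length ys. quot (gen (J \<union> set (take i ys))) (ys ! i) = gen (J \<union> set (take i ys)))
     \<and> gen (J \<union> set ys) \<noteq> UNIV"

text \<open>The clause of \<open>depth\<close> for ideals comaximal with \<open>M\<close> is left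
  out; the two are compared only for \<open>J\<close> inside a proper \<open>M\<close>.\<close>

definition seq_depth :: "'a::comm_ring_1 set \<Rightarrow> 'a set \<Rightarrow> enat" where
  "seq_depth M J = Sup {enat (length ys) | ys. reg_seq M J ys}"

text \<open>Joining \<open>K\<close> at each step makes this the preimage of the power of
  \<open>A/K\<close> in \<open>T/K\<close>.\<close>

primrec ipow :: "'a::comm_ring_1 set \<Rightarrow> 'a set \<Rightarrow> nat \<Rightarrow> 'a set" where
  "ipow K A 0 = UNIV"
| "ipow K A (Suc k) = gen (K \<union> {a * b | a b. a \<in> ipow K A k \<and> b \<in> A})"

text \<open>For an ideal \<open>J\<close> above \<open>K\<close>, the ideal
  \<open>f J + K\<close>.\<close>

definition mult_mod :: "'a::comm_ring_1 set \<Rightarrow> 'a \<Rightarrow> 'a set \<Rightarrow> 'a set" where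
  "mult_mod K f J = {x. \<exists>j\<in>J. x - f * j \<in> K}"

lemma mult_mod_ideal:
  assumes K: "is_ideal K" and J: "is_ideal J" shows "is_ideal (mult_mod K f J)"
proof (rule idl.subspaceI)
  have "0 - f * 0 \<in> K" using ideal_zero[OF K] by simp
  then show "0 \<in> mult_mod K f J" using ideal_zero[OF J] unfolding mult_mod_def by blast
next
  fix x y assume "x \<in> mult_mod K f J" "y \<in> mult_mod K f J"
  then obtain i j where ij: "i \<in> J" "j \<in> J" "x - f * i \<in> K" "y - f * j \<in> K" by (auto simp: mult_mod_def)
  have "(x + y) - f * (i + j) \<in> K" using ideal_add[OF K ij(3,4)] by (simp add: algebra_simps)
  then show "x + y \<in> mult_mod K f J" using ideal_add[OF J ij(1,2)] unfolding mult_mod_def by blast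
next
  fix c x assume "x \<in> mult_mod K f J"
  then obtain i where i: "i \<in> J" "x - f * i \<in> K" by (auto simp: mult_mod_def)
  have "c * x - f * (c * i) \<in> K" using ideal_mult_left[OF K i(2), of c] by (simp add: algebra_simps)
  then show "c * x \<in> mult_mod K f J" using ideal_mult_left[OF J i(1)] unfolding mult_mod_def by blast
qed

lemma mult_mod_superset: "is_ideal J \<Longrightarrow> K \<subseteq> mult_mod K f J"
  unfolding mult_mod_def using ideal_zero[of J] by force

lemma mult_mod_mem: "is_ideal K \<Longrightarrow> j \<in> J \<Longrightarrow> f * j \<in> mult_mod K f J"
  unfolding mult_mod_def using ideal_zero[of K] by force

lemma mult_mod_UNIV: "is_ideal K \<Longrightarrow> mult_mod K f UNIV = gen (insert f K)"
  by (auto simp: mult_mod_def gen_insert_iff mult.commute)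

text \<open>Multiplication by \<open>f\<close> is injective on the domain \<open>T/K\<close>, so it
  embeds \<open>T/J\<close> into \<open>T/(f J + K)\<close> and preserves annihilators.\<close>

lemma quot_mult_mod:
  assumes K: "prime_ideal K" and J: "is_ideal J" "K \<subseteq> J" and f: "f \<notin> K"
  shows "quot (mult_mod K f J) (f * w) = quot J w"
proof
  show "quot (mult_mod K f J) (f * w) \<subseteq> quot J w"
  proof
    fix r assume "r \<in> quot (mult_mod K f J) (f * w)"
    then obtain j where j: "j \<in> J" "r * (f * w) - f * j \<in> K" by (auto simp: quot_def mult_mod_def)
    have "f * (r * w - j) \<in> K" using j(2) by (simp add: algebra_simps)
    then have "r * w - j \<in> J" using prime_mult_iff[OF K] f J(2) by blast
    then show "r \<in> quot J w" using ideal_add[OF J(1) j(1)] by (fastforce simp: quot_def)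
  qed
  show "quot J w \<subseteq> quot (mult_mod K f J) (f * w)"
    using mult_mod_mem[OF prime_idealD(1)[OF K]]
    by (auto simp: quot_def) (metis mult.left_commute)
qed

lemma ipow_ideal: "is_ideal (ipow K A k)"
  by (cases k) auto

lemma ipow_superset: "K \<subseteq> ipow K A k"
  using idl.span_superset by (cases k) fastforce+

lemma ipow_prod: "a \<in> ipow K A k \<Longrightarrow> b \<in> A \<Longrightarrow> a * b \<in> ipow K A (Suc k)"
  by (auto intro!: idl.span_base)

lemma ipow_subset: "is_ideal A \<Longrightarrow> K \<subseteq> A \<Longrightarrow> ipow K A (Suc k) \<subseteq> A"
  unfolding ipow.simps by (rule idl.span_minimal) (auto intro: ideal_mult_left)

lemma power_mem_ipow: "a \<in> A \<Longrightarrow> a ^ k \<in> ipow K A k"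
proof (induction k)
  case (Suc k)
  then show ?case using ipow_prod[of "a ^ k" K A k a] by (simp del: ipow.simps add: mult.commute)
qed simp

lemma prime_power_mem: "prime_ideal P \<Longrightarrow> a ^ k \<in> P \<Longrightarrow> a \<in> P"
  by (induction k) (auto simp: prime_idealD prime_mult_iff)

lemma ipow_subset_prime: "prime_ideal P \<Longrightarrow> ipow K A k \<subseteq> P \<Longrightarrow> A \<subseteq> P"
  using power_mem_ipow prime_power_mem by blast

lemma ipow_mult_mod:
  assumes K: "is_ideal K" and J: "is_ideal J" "K \<subseteq> J"
  shows "ipow K (mult_mod K f J) k = mult_mod K (f ^ k) (ipow K J k)"
proof (induction k)
  case 0
  have "x \<in> mult_mod K 1 UNIV" for x
    unfolding mult_mod_def using ideal_zero[OF K] by (intro CollectI bexI[of _ x]) auto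
  then show ?case by auto
next
  case (Suc k)
  let ?A = "mult_mod K f J"
  show ?case
  proof
    show "ipow K ?A (Suc k) \<subseteq> mult_mod K (f ^ Suc k) (ipow K J (Suc k))"
      unfolding ipow.simps(2)[of K ?A]
    proof (rule idl.span_minimal)
      show "K \<union> {a * b |a b. a \<in> ipow K ?A k \<and> b \<in> ?A} \<subseteq> mult_mod K (f ^ Suc k) (ipow K J (Suc k))"
      proof
        fix x assume "x \<in> K \<union> {a * b |a b. a \<in> ipow K ?A k \<and> b \<in> ?A}"
        then consider "x \<in> K" | a b where "x = a * b" "a \<in> ipow K ?A k" "b \<in> ?A" by blast
        then show "x \<in> mult_mod K (f ^ Suc k) (ipow K J (Suc k))"
        proof cases
          case 1
          then show ?thesis using mult_mod_superset[OF ipow_ideal] by blast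
        next
          case 2
          then obtain i j where ij: "i \<in> ipow K J k" "a - f ^ k * i \<in> K" "j \<in> J" "b - f * j \<in> K"
            unfolding Suc.IH by (auto simp: mult_mod_def)
          have "b * (a - f ^ k * i) + (f ^ k * i) * (b - f * j) \<in> K"
            by (rule ideal_add[OF K ideal_mult_left[OF K ij(2)] ideal_mult_left[OF K ij(4)]])
          then have "x - f ^ Suc k * (i * j) \<in> K" using 2(1) by (simp add: algebra_simps)
          then show ?thesis unfolding mult_mod_def
            by (intro CollectI bexI[of _ "i * j"] ipow_prod[OF ij(1,3)])
        qed
      qed
    qed (rule mult_mod_ideal[OF K ipow_ideal])
    have "is_ideal {j. f ^ Suc k * j \<in> ipow K ?A (Suc k)}"
      using ideal_zero[OF ipow_ideal] ideal_add[OF ipow_ideal] ideal_mult_left[OF ipow_ideal]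
      by (intro idl.subspaceI) (auto simp del: ipow.simps simp: distrib_left mult.left_commute)
    moreover have "K \<union> {a * b |a b. a \<in> ipow K J k \<and> b \<in> J} \<subseteq> {j. f ^ Suc k * j \<in> ipow K ?A (Suc k)}"
    proof
      fix x assume "x \<in> K \<union> {a * b |a b. a \<in> ipow K J k \<and> b \<in> J}"
      then consider "x \<in> K" | a b where "x = a * b" "a \<in> ipow K J k" "b \<in> J" by blast
      then show "x \<in> {j. f ^ Suc k * j \<in> ipow K ?A (Suc k)}"
      proof cases
        case 1
        then have "x \<in> ipow K ?A (Suc k)" using ipow_superset by blast
        then show ?thesis by (intro CollectI ideal_mult_left[OF ipow_ideal])
      next
        case 2
        have "f ^ k * a \<in> ipow K ?A k" unfolding Suc.IH by (rule mult_mod_mem[OF K 2(2)])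
        from ipow_prod[OF this mult_mod_mem[OF K 2(3)]]
        have "(f ^ k * a) * (f * b) \<in> ipow K ?A (Suc k)" .
        also have "(f ^ k * a) * (f * b) = f ^ Suc k * x" using 2(1) by (simp add: algebra_simps)
        finally show ?thesis by blast
      qed
    qed
    ultimately have *: "ipow K J (Suc k) \<subseteq> {j. f ^ Suc k * j \<in> ipow K ?A (Suc k)}"
      unfolding ipow.simps(2)[of K J] by (rule idl.span_minimal[rotated])
    show "mult_mod K (f ^ Suc k) (ipow K J (Suc k)) \<subseteq> ipow K ?A (Suc k)"
    proof
      fix x assume "x \<in> mult_mod K (f ^ Suc k) (ipow K J (Suc k))"
      then obtain j where j: "j \<in> ipow K J (Suc k)" "x - f ^ Suc k * j \<in> K" unfolding mult_mod_def by blast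
      have "f ^ Suc k * j \<in> ipow K ?A (Suc k)" using * j(1) by blast
      moreover have "x - f ^ Suc k * j \<in> ipow K ?A (Suc k)" using j(2) ipow_superset by blast
      ultimately have "(x - f ^ Suc k * j) + f ^ Suc k * j \<in> ipow K ?A (Suc k)"
        by (intro ideal_add[OF ipow_ideal])
      then show "x \<in> ipow K ?A (Suc k)" by (simp del: ipow.simps)
    qed
  qed
qed

text \<open>If \<open>quot A x\<close> is prime, \<open>x\<close> spans a copy of the domain
  \<open>T / quot A x\<close> inside \<open>T/A\<close>. This copy contributes one associated prime;
  all others come from the larger ideal \<open>gen (insert x A)\<close>.\<close>

lemma finite_assoc_primes:
  assumes acc: "acc_above K" and A: "is_ideal A" "K \<subseteq> A"
  shows "finite (assoc_primes A)"
  using acc A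
proof (induction A rule: acc_above_induct)
  case (step A)
  show ?case
  proof (cases "1 \<in> A")
    case True
    then have "quot A x = UNIV" for x using ideal_eq_UNIV[OF step.hyps(1)] by (auto simp: quot_def)
    then have "assoc_primes A = {}" by (auto simp: assoc_primes_def prime_ideal_def)
    then show ?thesis by simp
  next
    case False
    then have "quot A 1 \<inter> {1} = {}" by simp
    then obtain x where x: "prime_ideal (quot A x)"
      using exists_prime_quot[OF acc step.hyps(1,2), of "{1}" 1] by (auto simp: mult_set_def)
    have "x \<notin> A" using prime_idealD(2)[OF x] by (auto simp: quot_def)
    then have "A \<subset> gen (insert x A)" using gen_insert_superset gen_insert_mem by blast
    then have fin: "finite (assoc_primes (gen (insert x A)))" by (intro step.IH) auto
    have "assoc_primes A \<subseteq> insert (quot A x) (assoc_primes (gen (insert x A)))"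
    proof
      fix P assume "P \<in> assoc_primes A"
      then obtain y where P: "prime_ideal P" "P = quot A y" by (auto simp: assoc_primes_def)
      show "P \<in> insert (quot A x) (assoc_primes (gen (insert x A)))"
      proof (cases "quot (gen (insert x A)) y = P")
        case True then show ?thesis using P by (auto simp: assoc_primes_def)
      next
        case False
        have "P \<subseteq> quot (gen (insert x A)) y"
          using P(2) gen_insert_superset[of A x] by (auto simp: quot_def)
        \<comment> \<open>Otherwise a multiple \<open>r * y\<close> with \<open>r\<close> outside
          \<open>P\<close> has the annihilator \<open>P\<close> and falls into the span of
          \<open>x\<close>, where every nonzero element has the annihilator
          \<open>quot A x\<close>.\<close>
        then obtain r where r: "r \<notin> P" "r * y \<in> gen (insert x A)" using False by (auto simp: quot_def)
        then obtain s where s: "r * y - s * x \<in> A" using gen_insert_iff[OF step.hyps(1)] by blast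
        have P1: "P = quot A (r * y)"
        proof -
          have "u * (r * y) \<in> A \<longleftrightarrow> u * y \<in> A" for u
          proof -
            have "u * r \<in> P \<longleftrightarrow> u \<in> P" using prime_mult_iff[OF P(1)] r(1) by blast
            then show ?thesis unfolding P(2) by (simp add: quot_def mult.assoc)
          qed
          then show ?thesis unfolding P(2) by (simp add: quot_def)
        qed
        have "quot A (r * y) = quot A (s * x)"
        proof -
          have "u * (r * y) \<in> A \<longleftrightarrow> u * (s * x) \<in> A" for u
            using ideal_add_iff[OF step.hyps(1) ideal_mult_left[OF step.hyps(1) s, of u], of "u * (s * x)"]
            by (simp add: algebra_simps)
          then show ?thesis by (auto simp: quot_def)
        qed
        then have P2: "P = quot A (s * x)" using P1 by simp
        have "s \<notin> quot A x"
        proof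
          assume "s \<in> quot A x"
          then have "1 \<in> P" using P2 by (simp add: quot_def)
          then show False using prime_idealD(2)[OF P(1)] by blast
        qed
        have "u * (s * x) \<in> A \<longleftrightarrow> u * x \<in> A" for u
          using prime_mult_iff[OF x, of u s] \<open>s \<notin> quot A x\<close> by (simp add: quot_def mult.assoc)
        then have "P = quot A x" using P2 by (auto simp: quot_def)
        then show ?thesis by simp
      qed
    qed
    then show ?thesis using fin by (meson finite.insertI finite_subset)
  qed
qed

lemma prime_avoidance:
  assumes "finite \<P>" "\<And>P. P \<in> \<P> \<Longrightarrow> prime_ideal P" and I: "is_ideal I" "\<And>P. P \<in> \<P> \<Longrightarrow> \<not> I \<subseteq> P"
  shows "\<exists>x\<in>I. \<forall>P\<in>\<P>. x \<notin> P"
  using assms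
proof (induction "card \<P>" arbitrary: \<P> rule: less_induct)
  case less
  show ?case
  proof (rule ccontr)
    assume no: "\<not> ?case"
    have "\<forall>P\<in>\<P>. \<exists>x\<in>I. x \<in> P \<and> (\<forall>Q\<in>\<P> - {P}. x \<notin> Q)"
    proof
      fix P assume P: "P \<in> \<P>"
      have "card (\<P> - {P}) < card \<P>" using less.prems(1) P by (rule card_Diff1_less)
      then have "\<exists>x\<in>I. \<forall>Q\<in>\<P> - {P}. x \<notin> Q" using less.hyps[of "\<P> - {P}"] less.prems by auto
      then show "\<exists>x\<in>I. x \<in> P \<and> (\<forall>Q\<in>\<P> - {P}. x \<notin> Q)" using no by auto
    qed
    then obtain x where x: "\<And>P. P \<in> \<P> \<Longrightarrow> x P \<in> I" "\<And>P. P \<in> \<P> \<Longrightarrow> x P \<in> P"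
      "\<And>P Q. P \<in> \<P> \<Longrightarrow> Q \<in> \<P> - {P} \<Longrightarrow> x P \<notin> Q" by metis
    have "\<P> \<noteq> {}" using no ideal_zero[OF I(1)] by blast
    then obtain P where P: "P \<in> \<P>" by blast
    show False
    proof (cases "\<P> = {P}")
      case True
      then show False using no less.prems(4)[OF P] by blast
    next
      case False
      \<comment> \<open>Among the given primes \<open>x P\<close> lies in \<open>P\<close> only, and
        \<open>y\<close> in all the others only, so their sum avoids every one.\<close>
      define y where "y = (\<Prod>Q\<in>\<P> - {P}. x Q)"
      have fin: "finite (\<P> - {P})" using less.prems(1) by simp
      have yQ: "y \<in> Q" if "Q \<in> \<P> - {P}" for Q
        unfolding y_def using prod.remove[OF fin that, of x] x(2)[of Q] that
          ideal_mult_right[OF prime_idealD(1)[OF less.prems(2)]] by auto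
      have yP: "y \<notin> P"
      proof -
        have "finite S \<Longrightarrow> (\<And>Q. Q \<in> S \<Longrightarrow> x Q \<notin> P) \<Longrightarrow> (\<Prod>Q\<in>S. x Q) \<notin> P" for S
          by (induction S rule: finite_induct)
            (auto simp: prime_idealD(2)[OF less.prems(2)[OF P]] prime_mult_iff[OF less.prems(2)[OF P]])
        then show ?thesis unfolding y_def using fin x(3) P by blast
      qed
      obtain Q0 where Q0: "Q0 \<in> \<P> - {P}" using False P by blast
      have yI: "y \<in> I"
        unfolding y_def using prod.remove[OF fin Q0, of x] x(1)[of Q0] Q0 ideal_mult_right[OF I(1)] by auto
      have "x P + y \<in> I" using ideal_add[OF I(1) x(1)[OF P] yI] .
      moreover have "x P + y \<notin> Q" if Q: "Q \<in> \<P>" for Q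
      proof (cases "Q = P")
        case True
        then show ?thesis using yP ideal_add_iff[OF prime_idealD(1)[OF less.prems(2)[OF P]] x(2)[OF P]] by blast
      next
        case False
        then have "x P \<notin> Q" "y \<in> Q" using x(3)[OF P, of Q] yQ[of Q] Q by auto
        then show ?thesis using ideal_add_iff[OF prime_idealD(1)[OF less.prems(2)[OF Q]], of y "x P"]
          by (simp add: add.commute)
      qed
      ultimately show False using no by blast
    qed
  qed
qed

text \<open>Abstracts the common features of a three-dimensional regular local ring \<open>T/K\<close> and of a
  polynomial ring \<open>T/K\<close> in three variables near its graded maximal ideal \<open>M/K\<close>.
  The last axiom is the factoriality of \<open>T/K\<close>.\<close>

locale factorial_dim3 =
  fixes K M :: "'a::comm_ring_1 set"
  assumes acc: "acc_above K" and K: "prime_ideal K" and M: "prime_ideal M" and KM: "K \<subseteq> M"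
    and dim: "\<And>P Q R. prime_ideal P \<Longrightarrow> prime_ideal Q \<Longrightarrow> prime_ideal R
      \<Longrightarrow> K \<subset> P \<Longrightarrow> P \<subset> Q \<Longrightarrow> Q \<subset> R \<Longrightarrow> R \<subset> M \<Longrightarrow> False"
    and colon: "\<And>a b. \<exists>c. quot (gen (insert a K)) b = gen (insert c K)"
begin

lemma idK: "is_ideal K"
  using prime_idealD(1)[OF K] .

text \<open>\<open>f\<close> plays the greatest common divisor of \<open>A\<close>: among the
  \<open>quot A f\<close> with \<open>A\<close> inside the ideal of \<open>f\<close> a maximal one
  is taken as \<open>J\<close>. If \<open>J\<close> lies in the ideal of \<open>q\<close>, then
  \<open>q * f\<close> divides \<open>A\<close> as well, maximality gives \<open>J = q J\<close>,
  and Nakayama makes \<open>q\<close> a unit modulo \<open>K\<close>.\<close>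

lemma factor_out:
  assumes A: "is_ideal A" "K \<subset> A"
  obtains f J where "f \<notin> K" "is_ideal J" "K \<subset> J" "A = mult_mod K f J"
    "\<And>q. J \<subseteq> gen (insert q K) \<Longrightarrow> 1 \<in> gen (insert q K)"
proof -
  define \<S> where "\<S> = {quot A f | f. A \<subseteq> gen (insert f K)}"
  have "A \<subseteq> gen (insert 1 K)" using ideal_eq_UNIV[OF idl.subspace_span gen_insert_mem] by blast
  then have "quot A 1 \<in> \<S>" unfolding \<S>_def by blast
  moreover have "\<And>B. B \<in> \<S> \<Longrightarrow> is_ideal B \<and> K \<subseteq> B"
    unfolding \<S>_def using quot_ideal[OF A(1)] quot_superset[OF A(1)] A(2) by blast
  ultimately have "\<exists>J\<in>\<S>. \<forall>B\<in>\<S>. J \<subseteq> B \<longrightarrow> B = J" by (rule acc_above_maximal[OF acc])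
  then obtain f where f: "A \<subseteq> gen (insert f K)" and max: "\<And>B. B \<in> \<S> \<Longrightarrow> quot A f \<subseteq> B \<Longrightarrow> B = quot A f"
    unfolding \<S>_def by auto
  define J where "J = quot A f"
  have J: "is_ideal J" "A \<subseteq> J" unfolding J_def using quot_ideal[OF A(1)] quot_superset[OF A(1)] by blast+
  have fK: "f \<notin> K"
  proof
    assume "f \<in> K"
    then have "gen (insert f K) = K" using idK by (simp add: insert_absorb)
    then show False using f A(2) by auto
  qed
  have AJ: "A = mult_mod K f J"
  proof
    show "A \<subseteq> mult_mod K f J"
    proof
      fix x assume x: "x \<in> A"
      then obtain r where r: "x - r * f \<in> K" using f gen_insert_iff[OF idK] by blast
      then have "r * f \<in> A" using ideal_minus_cancel[OF A(1) x] A(2) by blast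
      then have "r \<in> J" by (simp add: J_def quot_def)
      then show "x \<in> mult_mod K f J" unfolding mult_mod_def using r by (auto simp: mult.commute)
    qed
    show "mult_mod K f J \<subseteq> A"
    proof
      fix x assume "x \<in> mult_mod K f J"
      then obtain j where j: "j * f \<in> A" "x - j * f \<in> K" by (auto simp: mult_mod_def J_def quot_def mult.commute)
      then have "(x - j * f) + j * f \<in> A" using A by (intro ideal_add[OF A(1)]) auto
      then show "x \<in> A" by simp
    qed
  qed
  have "1 \<in> gen (insert q K)" if q: "J \<subseteq> gen (insert q K)" for q
  proof -
    have "A \<subseteq> gen (insert (q * f) K)"
    proof
      fix x assume "x \<in> A"
      then obtain j where j: "j \<in> J" "x - f * j \<in> K" using AJ by (auto simp: mult_mod_def)
      then obtain r where r: "j - r * q \<in> K" using q gen_insert_iff[OF idK] by blast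
      have "(x - f * j) + f * (j - r * q) \<in> K" by (rule ideal_add[OF idK j(2) ideal_mult_left[OF idK r]])
      then have "x - r * (q * f) \<in> K" by (simp add: algebra_simps)
      then show "x \<in> gen (insert (q * f) K)" using gen_insert_iff[OF idK] by blast
    qed
    then have "quot A (q * f) \<in> \<S>" unfolding \<S>_def by blast
    then have Jq: "quot A (q * f) = J" unfolding J_def by (rule max[OF _ quot_mult[OF A(1)]])
    show ?thesis
    proof (rule ccontr)
      assume no: "1 \<notin> gen (insert q K)"
      obtain c where c: "c \<in> J" "c \<notin> K" using A(2) J(2) by blast
      \<comment> \<open>Nothing is local here, so Nakayama's lemma is used with the multiplicative
        set \<open>1 + (q)\<close>. An element of it that kills the nonzero \<open>c\<close>
        vanishes modulo \<open>K\<close>, which puts \<open>1\<close> into the ideal of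
        \<open>q\<close>.\<close>
      define S where "S = {s. 1 - s \<in> gen (insert q K)}"
      have idq: "is_ideal (gen (insert q K))" by simp
      have S: "mult_set S"
        unfolding mult_set_def
      proof (intro conjI ballI)
        show "1 \<in> S" using ideal_zero[OF idq] by (simp add: S_def)
        fix a b assume ab: "a \<in> S" "b \<in> S"
        have "(1 - a) + a * (1 - b) \<in> gen (insert q K)"
          using ab by (intro ideal_add[OF idq] ideal_mult_left[OF idq]) (auto simp: S_def)
        then show "a * b \<in> S" by (simp add: S_def algebra_simps)
      qed
      have "\<exists>s\<in>S. s * c \<in> K"
      proof (rule principal_nakayama[OF acc idK order.refl S _ _ c(1)])
        fix s w assume "s \<in> S"
        then have "(1 - s) + w * q \<in> gen (insert q K)"
          by (intro ideal_add[OF idq] ideal_mult_left[OF idq gen_insert_mem]) (auto simp: S_def)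
        then show "s - w * q \<in> S" by (simp add: S_def algebra_simps)
      next
        fix c assume c: "c \<in> J"
        then obtain r where r: "c - r * q \<in> K" using q gen_insert_iff[OF idK] by blast
        have "r \<in> quot A (q * f)"
        proof -
          have "f * (c - r * q) \<in> A" using r A by (intro ideal_mult_left) auto
          moreover have "f * c \<in> A" using c by (simp add: J_def quot_def mult.commute)
          ultimately have "f * (r * q) \<in> A"
            using ideal_minus_cancel[OF A(1), of "f * c" "f * (r * q)"] by (simp add: algebra_simps)
          then show ?thesis by (simp add: quot_def algebra_simps)
        qed
        then have "r \<in> J" using Jq by simp
        moreover have "1 * c - q * r \<in> K" using r by (simp add: mult.commute)
        moreover have "1 \<in> S" using S by (simp add: mult_set_def)
        ultimately show "\<exists>s\<in>S. \<exists>c'\<in>J. s * c - q * c' \<in> K" by blast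
      qed
      then obtain s where "s \<in> S" "s \<in> K" using prime_mult_iff[OF K] c(2) by blast
      then have "(1 - s) + s \<in> gen (insert q K)"
        using gen_insert_superset[of K q] by (intro ideal_add[OF idq]) (auto simp: S_def)
      then show False using no by simp
    qed
  qed
  then show ?thesis using that[OF fK J(1) _ AJ] J(2) A(2) by blast
qed

text \<open>A prime associated to the ideal of a single nonzero \<open>a\<close> in \<open>J\<close>
  is a colon ideal of that principal ideal, hence principal itself, hence cannot contain
  \<open>J\<close>.\<close>

lemma height_two:
  assumes J: "is_ideal J" "K \<subset> J" "\<And>q. J \<subseteq> gen (insert q K) \<Longrightarrow> 1 \<in> gen (insert q K)"
    and Q: "prime_ideal Q" "J \<subseteq> Q"
  obtains P where "prime_ideal P" "K \<subset> P" "P \<subset> Q"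
proof -
  obtain a where a: "a \<in> J" "a \<notin> K" using J by blast
  let ?I = "gen (insert a K)"
  have "?I \<subseteq> Q" using a J Q prime_idealD(1)[OF Q(1)] by (intro gen_insert_minimal) auto
  then obtain t where t: "prime_ideal (quot ?I (t * 1))" "quot ?I (t * 1) \<subseteq> Q" "quot ?I 1 \<subseteq> quot ?I (t * 1)"
    using exists_prime_quot_below[OF acc _ gen_insert_superset[of K a] Q(1), of 1]
    by (metis idl.subspace_span quot_one)
  obtain p where p: "quot ?I (t * 1) = gen (insert p K)" using colon by blast
  have "\<not> J \<subseteq> quot ?I (t * 1)" using J(3)[of p] prime_idealD(2)[OF t(1)] unfolding p by blast
  moreover have "K \<subset> quot ?I (t * 1)"
    using t(3) a gen_insert_superset[of K a] gen_insert_mem[of a K] by auto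
  ultimately show ?thesis using that[OF t(1)] t(2) Q(2) by blast
qed

lemma assoc_exists:
  assumes J: "is_ideal J" "K \<subseteq> J" and P: "prime_ideal P" "J \<subseteq> P"
  obtains Q where "Q \<in> assoc_primes J" "J \<subseteq> Q" "Q \<subseteq> P"
proof -
  obtain t where "prime_ideal (quot J (t * 1))" "quot J (t * 1) \<subseteq> P" "quot J 1 \<subseteq> quot J (t * 1)"
    using exists_prime_quot_below[OF acc J P(1), of 1] P(2) by (metis quot_one)
  then show ?thesis using that[of "quot J (t * 1)"] by (auto simp: assoc_primes_def)
qed

lemma assoc_primes_mult_mod:
  assumes "is_ideal J" "K \<subseteq> J" "f \<notin> K" shows "assoc_primes J \<subseteq> assoc_primes (mult_mod K f J)"
  using quot_mult_mod[OF K assms] unfolding assoc_primes_def by blast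

lemma power_notin: "f \<notin> K \<Longrightarrow> f ^ k \<notin> K"
  using prime_power_mem[OF K] by blast

lemma assoc_primes_power:
  assumes A: "is_ideal A" "K \<subset> A" and P: "P \<in> assoc_primes (ipow K A k)" "P \<subset> M" and l: "l > 0"
  shows "P \<in> assoc_primes (ipow K A l)"
proof -
  obtain f J where fJ: "f \<notin> K" "is_ideal J" "K \<subset> J" "A = mult_mod K f J"
    and nop: "\<And>q. J \<subseteq> gen (insert q K) \<Longrightarrow> 1 \<in> gen (insert q K)"
    using factor_out[OF A] by metis
  have pow: "ipow K A n = mult_mod K (f ^ n) (ipow K J n)" for n
    unfolding fJ(4) using ipow_mult_mod[OF idK fJ(2)] fJ(3) by blast
  obtain w where w: "prime_ideal P" "P = quot (ipow K A k) w" using P by (auto simp: assoc_primes_def)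
  have KP: "K \<subseteq> P" using w(2) quot_superset[OF ipow_ideal] ipow_superset by blast
  have idP: "is_ideal P" using prime_idealD(1)[OF w(1)] .
  show ?thesis
  proof (cases "J \<subseteq> P")
    case True
    \<comment> \<open>A prime over \<open>J\<close> strictly inside \<open>P\<close> would, by
      \<open>height_two\<close>, give four strict inclusions between \<open>K\<close> and
      \<open>M\<close>.\<close>
    have min: "Q = P" if Q: "prime_ideal Q" "J \<subseteq> Q" "Q \<subseteq> P" for Q
    proof (rule ccontr)
      assume "Q \<noteq> P"
      obtain P1 where "prime_ideal P1" "K \<subset> P1" "P1 \<subset> Q"
        using height_two[OF fJ(2,3) nop Q(1,2)] by metis
      then show False using dim[OF _ Q(1) w(1)] Q \<open>Q \<noteq> P\<close> P(2) by blast
    qed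
    obtain n where n: "l = Suc n" using l by (cases l) auto
    have "ipow K J l \<subseteq> P" using ipow_subset[OF fJ(2)] fJ(3) True unfolding n by blast
    then obtain Q where Q: "Q \<in> assoc_primes (ipow K J l)" "ipow K J l \<subseteq> Q" "Q \<subseteq> P"
      using assoc_exists[OF ipow_ideal ipow_superset w(1)] by metis
    then have "prime_ideal Q" by (simp add: assoc_primes_def)
    moreover have "J \<subseteq> Q" using ipow_subset_prime[OF \<open>prime_ideal Q\<close> Q(2)] .
    ultimately have "P \<in> assoc_primes (ipow K J l)" using min Q by blast
    then show ?thesis
      unfolding pow using assoc_primes_mult_mod[OF ipow_ideal ipow_superset power_notin[OF fJ(1)]] by blast
  next
    case False
    then obtain j where j: "j \<in> J" "j \<notin> P" by blast
    have jn: "j ^ n \<in> ipow K J n" "j ^ n \<notin> P" for n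
      using power_mem_ipow[OF j(1)] prime_power_mem[OF w(1)] j(2) by blast+
    \<comment> \<open>An element \<open>j\<close> of \<open>J\<close> outside the prime
      \<open>P\<close> can be cancelled, so \<open>J\<close> disappears from the colon ideal, which
      is then principal by \<open>colon\<close>.\<close>
    have "P = quot (gen (insert (f ^ k) K)) w"
    proof
      have "ipow K A k \<subseteq> gen (insert (f ^ k) K)"
        unfolding pow mult_mod_UNIV[OF idK, symmetric] by (auto simp: mult_mod_def)
      then show "P \<subseteq> quot (gen (insert (f ^ k) K)) w" unfolding w(2) by (auto simp: quot_def)
      show "quot (gen (insert (f ^ k) K)) w \<subseteq> P"
      proof
        fix r assume "r \<in> quot (gen (insert (f ^ k) K)) w"
        then obtain u where u: "r * w - u * f ^ k \<in> K" by (auto simp: quot_def gen_insert_iff[OF idK])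
        have "j ^ k * (r * w - u * f ^ k) \<in> ipow K A k" using u ipow_superset by (intro ideal_mult_left[OF ipow_ideal]) blast
        moreover have "f ^ k * (j ^ k * u) \<in> ipow K A k"
          unfolding pow using jn(1) by (intro mult_mod_mem[OF idK] ideal_mult_right[OF ipow_ideal])
        ultimately have "j ^ k * (r * w - u * f ^ k) + f ^ k * (j ^ k * u) \<in> ipow K A k"
          by (rule ideal_add[OF ipow_ideal])
        then have "(r * j ^ k) * w \<in> ipow K A k" by (simp add: algebra_simps)
        then have "r * j ^ k \<in> P" unfolding w(2) by (simp add: quot_def)
        then show "r \<in> P" using prime_mult_iff[OF w(1)] jn(2) by blast
      qed
    qed
    then obtain p where p: "P = gen (insert p K)" using colon by metis
    have "f ^ k * j ^ k \<in> ipow K A k" unfolding pow by (rule mult_mod_mem[OF idK jn(1)])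
    then have "f ^ k * j ^ k \<in> P" unfolding w(2) using quot_superset[OF ipow_ideal] by blast
    then have "f \<in> P" using prime_mult_iff[OF w(1)] jn(2) prime_power_mem[OF w(1)] by blast
    then obtain g where g: "f - g * p \<in> K" unfolding p gen_insert_iff[OF idK] by blast
    have gK: "g \<notin> K"
    proof
      assume "g \<in> K"
      then have "(f - g * p) + g * p \<in> K" by (intro ideal_add[OF idK g] ideal_mult_right[OF idK])
      then show False using fJ(1) by simp
    qed
    obtain n where n: "l = Suc n" using l by (cases l) auto
    \<comment> \<open>Since \<open>f = g p\<close>, this \<open>h\<close> satisfies
      \<open>h p = f ^ l\<close>, so \<open>(f ^ l : h)\<close> is the ideal of \<open>p\<close>.
      The factor \<open>j ^ l\<close> transfers this to \<open>f ^ l J ^ l\<close>.\<close>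
    define h where "h = f ^ n * g"
    have hK: "h \<notin> K" unfolding h_def using prime_mult_iff[OF K] gK power_notin[OF fJ(1)] by blast
    have hp: "h * p - f ^ l \<in> K"
    proof -
      have "(- (f ^ n)) * (f - g * p) \<in> K" by (rule ideal_mult_left[OF idK g])
      then show ?thesis by (simp add: h_def n algebra_simps)
    qed
    have "P = quot (ipow K A l) (h * j ^ l)"
    proof
      show "P \<subseteq> quot (ipow K A l) (h * j ^ l)"
      proof
        fix r assume "r \<in> P"
        then obtain u where u: "r - u * p \<in> K" unfolding p gen_insert_iff[OF idK] by blast
        have "(h * j ^ l) * (r - u * p) + (u * j ^ l) * (h * p - f ^ l) \<in> K"
          by (rule ideal_add[OF idK ideal_mult_left[OF idK u] ideal_mult_left[OF idK hp]])
        then have "r * (h * j ^ l) - f ^ l * (j ^ l * u) \<in> K" by (simp add: algebra_simps)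
        moreover have "j ^ l * u \<in> ipow K J l" by (rule ideal_mult_right[OF ipow_ideal jn(1)])
        ultimately show "r \<in> quot (ipow K A l) (h * j ^ l)"
          unfolding pow quot_def mult_mod_def by blast
      qed
      show "quot (ipow K A l) (h * j ^ l) \<subseteq> P"
      proof
        fix r assume "r \<in> quot (ipow K A l) (h * j ^ l)"
        then obtain i where i: "r * (h * j ^ l) - f ^ l * i \<in> K" unfolding pow quot_def mult_mod_def by blast
        have "(r * (h * j ^ l) - f ^ l * i) - i * (h * p - f ^ l) \<in> K"
          by (rule ideal_diff[OF idK i ideal_mult_left[OF idK hp]])
        also have "(r * (h * j ^ l) - f ^ l * i) - i * (h * p - f ^ l) = h * (r * j ^ l - i * p)"
          by (simp add: algebra_simps)
        finally have "r * j ^ l - i * p \<in> K" using prime_mult_iff[OF K] hK by blast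
        then have "r * j ^ l \<in> P" unfolding p gen_insert_iff[OF idK] by blast
        then show "r \<in> P" using prime_mult_iff[OF w(1)] jn(2) by blast
      qed
    qed
    then show ?thesis using w(1) by (auto simp: assoc_primes_def)
  qed
qed

end

section \<open>Regular sequences and depth at \<open>M\<close>\<close>

context factorial_dim3 begin

text \<open>Let \<open>N\<close> consist of the elements that \<open>P\<close> kills modulo
  \<open>J\<close>. By Nakayama some \<open>n\<close> in \<open>N\<close> is not a multiple of
  \<open>x\<close> modulo \<open>J\<close>, even locally at \<open>M\<close>. Its annihilator modulo
  \<open>J\<close> and \<open>x\<close> contains \<open>P\<close> as well as \<open>x\<close>, and
  it extends to an associated prime inside \<open>M\<close>.\<close>

lemma assoc_prime_mod_regular:
  assumes J: "is_ideal J" "K \<subseteq> J" and P: "P \<in> assoc_primes J" "P \<subseteq> M"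
    and x: "x \<in> M" "quot J x = J"
  obtains Q where "Q \<in> assoc_primes (gen (insert x J))" "P \<subset> Q" "Q \<subseteq> M"
proof -
  obtain z where z: "prime_ideal P" "P = quot J z" using P by (auto simp: assoc_primes_def)
  let ?J = "gen (insert x J)"
  define N where "N = {n. P \<subseteq> quot J n}"
  have zN: "z \<in> N" using z by (simp add: N_def)
  have "\<exists>n\<in>N. quot ?J n \<subseteq> M"
  proof (rule ccontr)
    assume no: "\<not> ?thesis"
    have "\<exists>s. s \<notin> M \<and> s * z \<in> J"
    proof (rule principal_nakayama_prime[OF acc J M x(1) _ zN])
      fix n assume n: "n \<in> N"
      then obtain s where s: "s \<notin> M" "s * n \<in> ?J" using no by (auto simp: quot_def)
      then obtain r where r: "s * n - r * x \<in> J" using gen_insert_iff[OF J(1)] by blast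
      \<comment> \<open>As \<open>x\<close> is regular modulo \<open>J\<close>, division by
        \<open>x\<close> does not leave \<open>N\<close>.\<close>
      have "p \<in> quot J r" if p: "p \<in> P" for p
      proof -
        have "p * n \<in> J" using n p by (auto simp: N_def quot_def)
        then have "s * (p * n) \<in> J" by (rule ideal_mult_left[OF J(1)])
        moreover have "s * (p * n) - (p * r) * x = p * (s * n - r * x)" by (simp add: algebra_simps)
        ultimately have "(p * r) * x \<in> J"
          using ideal_minus_cancel[OF J(1)] ideal_mult_left[OF J(1) r, of p] by metis
        then have "p * r \<in> quot J x" by (simp add: quot_def)
        then have "p * r \<in> J" using x(2) by simp
        then show ?thesis by (simp add: quot_def)
      qed
      then have "r \<in> N" by (auto simp: N_def)
      then show "\<exists>s. s \<notin> M \<and> (\<exists>c'\<in>N. s * n - x * c' \<in> J)" 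
        using s(1) r by (intro exI[of _ s] conjI bexI[of _ r]) (simp_all add: mult.commute[of x])
    qed
    then show False using z(2) P(2) by (auto simp: quot_def)
  qed
  then obtain n where n: "n \<in> N" "quot ?J n \<subseteq> M" by blast
  have "K \<subseteq> ?J" using J(2) gen_insert_superset[of J x] by blast
  then obtain t where t: "prime_ideal (quot ?J (t * n))" "quot ?J (t * n) \<subseteq> M" "quot ?J n \<subseteq> quot ?J (t * n)"
    using exists_prime_quot_below[OF acc idl.subspace_span _ M n(2)] by metis
  have "P \<subseteq> quot ?J n" using n(1) gen_insert_superset[of J x] by (auto simp: N_def quot_def)
  moreover have "x \<in> quot ?J n"
    using gen_insert_mem[of x J] by (auto simp: quot_def intro: ideal_mult_right)
  moreover have "x \<notin> P"
  proof
    assume "x \<in> P"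
    then have "z * x \<in> J" unfolding z(2) by (simp add: quot_def mult.commute)
    then have "z \<in> J" using x(2) by (auto simp: quot_def)
    then have "1 \<in> P" unfolding z(2) by (simp add: quot_def)
    then show False using prime_idealD(2)[OF z(1)] by blast
  qed
  ultimately show ?thesis using that[of "quot ?J (t * n)"] t by (auto simp: assoc_primes_def)
qed

lemma assoc_not_regular:
  assumes J: "is_ideal J" and M: "M \<in> assoc_primes J" and y: "y \<in> M"
  shows "quot J y \<noteq> J"
proof
  assume eq: "quot J y = J"
  obtain w where w: "prime_ideal M" "M = quot J w" using M by (auto simp: assoc_primes_def)
  have "w * y \<in> J" using y w(2) by (auto simp: quot_def mult.commute)
  then have "w \<in> J" using eq by (auto simp: quot_def)
  then have "1 \<in> M" unfolding w(2) by (simp add: quot_def)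
  then show False using prime_idealD(2)[OF w(1)] by blast
qed

lemma reg_seqD:
  assumes "reg_seq N J ys" "is_ideal J"
  shows "0 < length ys \<Longrightarrow> quot J (ys ! 0) = J"
    "1 < length ys \<Longrightarrow> quot (gen (insert (ys ! 0) J)) (ys ! 1) = gen (insert (ys ! 0) J)"
    "2 < length ys \<Longrightarrow> quot (gen (insert (ys ! 1) (gen (insert (ys ! 0) J)))) (ys ! 2)
       = gen (insert (ys ! 1) (gen (insert (ys ! 0) J)))"
    "i < length ys \<Longrightarrow> ys ! i \<in> N"
proof -
  have *: "i < length ys \<Longrightarrow> quot (gen (J \<union> set (take i ys))) (ys ! i) = gen (J \<union> set (take i ys))" for i
    using assms by (simp add: reg_seq_def)
  show "0 < length ys \<Longrightarrow> quot J (ys ! 0) = J" using *[of 0] assms(2) by simp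
  have t1: "1 < length ys \<Longrightarrow> set (take 1 ys) = {ys ! 0}" by (cases ys) auto
  have t2: "2 < length ys \<Longrightarrow> set (take 2 ys) = {ys ! 0, ys ! 1}"
    by (cases ys; cases "tl ys") auto
  show "1 < length ys \<Longrightarrow> quot (gen (insert (ys ! 0) J)) (ys ! 1) = gen (insert (ys ! 0) J)"
    using *[of 1] t1 by simp
  show "2 < length ys \<Longrightarrow> quot (gen (insert (ys ! 1) (gen (insert (ys ! 0) J)))) (ys ! 2)
       = gen (insert (ys ! 1) (gen (insert (ys ! 0) J)))"
    using *[of 2] t2 by (simp add: gen_insert_gen insert_commute)
  show "i < length ys \<Longrightarrow> ys ! i \<in> N"
    using assms(1) by (meson nth_mem reg_seq_def subsetD)
qed

text \<open>\<open>P\<close> has height at least two, so the first element of the sequence produces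
  an associated prime strictly above \<open>P\<close> that the dimension forces to be
  \<open>M\<close>; then every element of \<open>M\<close> is a zero divisor. In
  \<open>reg_seq_length_le_2\<close> the height is at least one and there are two such
  ascents.\<close>

lemma reg_seq_length_le_1:
  assumes J: "is_ideal J" "K \<subseteq> J" and P: "P \<in> assoc_primes J" "P \<subseteq> M"
    and P1: "prime_ideal P1" "K \<subset> P1" "P1 \<subset> P" and ys: "reg_seq M J ys"
  shows "length ys \<le> 1"
proof (rule ccontr)
  assume len: "\<not> length ys \<le> 1"
  note r = reg_seqD[OF ys J(1)]
  have l: "0 < length ys" "1 < length ys" using len by linarith+
  note y0 = r(4)[OF l(1)] r(1)[OF l(1)] and y1 = r(4)[OF l(2)] r(2)[OF l(2)]
  obtain Q where Q: "Q \<in> assoc_primes (gen (insert (ys ! 0) J))" "P \<subset> Q" "Q \<subseteq> M"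
    using assoc_prime_mod_regular[OF J P y0] by metis
  have "Q = M" using dim[OF P1(1) _ _ P1(2,3) Q(2)] P(1) Q by (auto simp: assoc_primes_def)
  then show False using assoc_not_regular[OF _ _ r(4)[of 1]] Q(1) r(2) len by force
qed

lemma reg_seq_length_le_2:
  assumes J: "is_ideal J" "K \<subseteq> J" and P: "P \<in> assoc_primes J" "P \<subseteq> M" "K \<subset> P"
    and ys: "reg_seq M J ys"
  shows "length ys \<le> 2"
proof (rule ccontr)
  assume len: "\<not> length ys \<le> 2"
  note r = reg_seqD[OF ys J(1)]
  have l: "0 < length ys" "1 < length ys" using len by linarith+
  note y0 = r(4)[OF l(1)] r(1)[OF l(1)] and y1 = r(4)[OF l(2)] r(2)[OF l(2)]
  obtain Q where Q: "Q \<in> assoc_primes (gen (insert (ys ! 0) J))" "P \<subset> Q" "Q \<subseteq> M"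
    using assoc_prime_mod_regular[OF J P(1,2) y0] by metis
  have "K \<subseteq> gen (insert (ys ! 0) J)" using J(2) gen_insert_superset[of J] by blast
  then obtain Q' where Q': "Q' \<in> assoc_primes (gen (insert (ys ! 1) (gen (insert (ys ! 0) J))))" "Q \<subset> Q'" "Q' \<subseteq> M"
    using assoc_prime_mod_regular[OF idl.subspace_span _ Q(1,3) y1] by metis
  have "Q' = M" using dim[OF _ _ _ P(3) Q(2) Q'(2)] P(1) Q Q' by (auto simp: assoc_primes_def)
  then show False using assoc_not_regular[OF _ _ r(4)[of 2]] Q'(1) r(3) len by force
qed

lemma reg_seq_Nil: "is_ideal J \<Longrightarrow> J \<noteq> UNIV \<Longrightarrow> reg_seq N J []"
  by (simp add: reg_seq_def)

lemma seq_depth_eq: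
  assumes "reg_seq N J xs" "\<And>ys. reg_seq N J ys \<Longrightarrow> length ys \<le> length xs"
  shows "seq_depth N J = enat (length xs)"
  unfolding seq_depth_def by (rule antisym) (auto intro!: Sup_least Sup_upper assms)

lemma seq_depth_0:
  assumes J: "is_ideal J" "J \<noteq> UNIV" and M: "M \<in> assoc_primes J"
  shows "seq_depth M J = 0"
proof -
  have "length ys \<le> length []" if ys: "reg_seq M J ys" for ys :: "'a list"
    using reg_seqD(1)[OF ys J(1)] reg_seqD(4)[OF ys J(1), of 0] assoc_not_regular[OF J(1) M] by (cases ys) auto
  then show ?thesis using seq_depth_eq[OF reg_seq_Nil[OF J]] by (simp add: zero_enat_def)
qed

text \<open>Zero divisors modulo \<open>J\<close> lie in associated primes. Since \<open>T/K\<close>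
  need not be local, that these primes are inside \<open>M\<close> is taken from \<open>sub\<close>;
  prime avoidance then applies to \<open>M\<close>.\<close>

lemma exists_regular:
  assumes J: "is_ideal J" "K \<subseteq> J" and sub: "\<And>x. x \<notin> J \<Longrightarrow> quot J x \<subseteq> M"
    and Mnot: "M \<notin> assoc_primes J"
  shows "\<exists>y\<in>M. quot J y = J"
proof -
  have below: "P \<subseteq> M" if P: "P \<in> assoc_primes J" for P
  proof -
    obtain x where x: "prime_ideal P" "P = quot J x" using P unfolding assoc_primes_def by blast
    then have "x \<notin> J" using prime_idealD(2)[OF x(1)] by (auto simp: quot_def)
    then show ?thesis using sub x by blast
  qed
  have "\<exists>y\<in>M. \<forall>P\<in>assoc_primes J. y \<notin> P"
  proof (rule prime_avoidance[OF finite_assoc_primes[OF acc J]])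
    show "\<not> M \<subseteq> P" if "P \<in> assoc_primes J" for P using below[OF that] Mnot that by (metis subset_antisym)
  qed (auto simp: assoc_primes_def prime_idealD(1)[OF M])
  then obtain y where y: "y \<in> M" "\<And>P. P \<in> assoc_primes J \<Longrightarrow> y \<notin> P" by blast
  have "r \<in> J" if r: "r * y \<in> J" for r
  proof (rule ccontr)
    assume "r \<notin> J"
    then obtain t where t: "prime_ideal (quot J (t * r))" "quot J r \<subseteq> quot J (t * r)"
      using exists_prime_quot_below[OF acc J M sub] by metis
    have "y \<in> quot J r" using r by (simp add: quot_def mult.commute)
    then show False using y(2)[of "quot J (t * r)"] t by (auto simp: assoc_primes_def)
  qed
  then show ?thesis using y(1) quot_superset[OF J(1)] by (auto simp: quot_def)
qed

lemma reg_seq_single: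
  assumes J: "is_ideal J" "J \<subseteq> M" and y: "y \<in> M" "quot J y = J"
  shows "reg_seq M J [y]"
proof -
  have "gen (insert y J) \<subseteq> M" using J y prime_idealD(1)[OF M] by (intro gen_insert_minimal) auto
  then have "gen (insert y J) \<noteq> UNIV" using prime_idealD(2)[OF M] by auto
  then show ?thesis using J y by (simp add: reg_seq_def)
qed

text \<open>Multiplication by \<open>f ^ (k - 1)\<close> embeds \<open>T/(B + (f))\<close> into
  \<open>T/(B + (f ^ k))\<close>, which settles one direction; for the other,
  \<open>T/(B + (f ^ k))\<close> is filtered by \<open>k\<close> copies of
  \<open>T/(B + (f))\<close>.\<close>

lemma regular_power_iff:
  assumes B: "is_ideal B" and f: "quot B f = B" and k: "k > 0"
  shows "quot (gen (insert (f ^ k) B)) y = gen (insert (f ^ k) B) \<longleftrightarrow> quot (gen (insert f B)) y = gen (insert f B)"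
proof -
  let ?E = "\<lambda>k. gen (insert (f ^ k) B)"
  have E: "x \<in> ?E k \<longleftrightarrow> (\<exists>u. x - f ^ k * u \<in> B)" for x k
    using gen_insert_iff[OF B] by (simp add: mult.commute)
  have cancel: "f ^ n * x \<in> B \<Longrightarrow> x \<in> B" for n x
  proof (induction n)
    case (Suc n)
    then have "f ^ n * x \<in> quot B f" by (simp add: quot_def algebra_simps)
    then show ?case using f Suc.IH by simp
  qed simp
  have shift: "f ^ n * x \<in> ?E (n + k) \<longleftrightarrow> x \<in> ?E k" for n k x
  proof
    assume "f ^ n * x \<in> ?E (n + k)"
    then obtain u where "f ^ n * x - f ^ (n + k) * u \<in> B" unfolding E by blast
    then have "f ^ n * (x - f ^ k * u) \<in> B" by (simp add: power_add algebra_simps)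
    then show "x \<in> ?E k" unfolding E using cancel by blast
  next
    assume "x \<in> ?E k"
    then obtain u where "x - f ^ k * u \<in> B" unfolding E by blast
    then have "f ^ n * (x - f ^ k * u) \<in> B" by (rule ideal_mult_left[OF B])
    then have "f ^ n * x - f ^ (n + k) * u \<in> B" by (simp add: power_add algebra_simps)
    then show "f ^ n * x \<in> ?E (n + k)" unfolding E by blast
  qed
  have reg: "quot (?E k) y = ?E k \<longleftrightarrow> (\<forall>r. r * y \<in> ?E k \<longrightarrow> r \<in> ?E k)" for k
    using quot_superset[OF idl.subspace_span, of "insert (f ^ k) B" y] by (auto simp: quot_def)
  have E1: "gen (insert f B) = ?E 1" by simp
  show ?thesis
    unfolding E1
  proof
    assume R: "quot (?E k) y = ?E k"
    show "quot (?E 1) y = ?E 1"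
      unfolding reg
    proof (intro allI impI)
      fix r assume "r * y \<in> ?E 1"
      then have "f ^ (k - 1) * (r * y) \<in> ?E (k - 1 + 1)" using shift by blast
      then have "(f ^ (k - 1) * r) * y \<in> ?E k" using k by (simp add: mult.assoc)
      then have "f ^ (k - 1) * r \<in> ?E (k - 1 + 1)" using R k unfolding reg by simp
      then show "r \<in> ?E 1" using shift by blast
    qed
  next
    assume R: "quot (?E 1) y = ?E 1"
    have "quot (?E (Suc n)) y = ?E (Suc n)" for n
    proof (induction n)
      case 0 then show ?case using R by simp
    next
      case (Suc n)
      show ?case
        unfolding reg
      proof (intro allI impI)
        fix r assume r: "r * y \<in> ?E (Suc (Suc n))"
        then obtain u where "r * y - f ^ Suc (Suc n) * u \<in> B" unfolding E by blast
        then have "r * y - f ^ 1 * (f ^ Suc n * u) \<in> B" by (simp add: mult.assoc)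
        then have "r * y \<in> ?E 1" unfolding E by blast
        then have "r \<in> ?E 1" using R unfolding reg by blast
        then obtain r' where r': "r - f ^ 1 * r' \<in> B" unfolding E by blast
        have BE: "B \<subseteq> ?E n" for n by (rule gen_insert_superset)
        have rE: "r - f ^ 1 * r' \<in> ?E (Suc (Suc n))" by (rule subsetD[OF BE r'])
        have "y * (r - f ^ 1 * r') = r * y - f ^ 1 * (r' * y)" by (simp add: algebra_simps)
        then have "r * y - f ^ 1 * (r' * y) \<in> ?E (Suc (Suc n))"
          using ideal_mult_left[OF idl.subspace_span rE, of y] by simp
        then have "f ^ 1 * (r' * y) \<in> ?E (Suc (Suc n))" by (rule ideal_minus_cancel[OF idl.subspace_span r])
        then have "f ^ 1 * (r' * y) \<in> ?E (1 + Suc n)" by simp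
        then have "r' * y \<in> ?E (Suc n)" using shift by blast
        then have "r' \<in> ?E (Suc n)" using Suc.IH unfolding reg by blast
        then have "f ^ 1 * r' \<in> ?E (1 + Suc n)" using shift by blast
        then have "f ^ 1 * r' \<in> ?E (Suc (Suc n))" by simp
        from ideal_add[OF idl.subspace_span rE this] show "r \<in> ?E (Suc (Suc n))" by simp
      qed
    qed
    from this[of "k - 1"] show "quot (?E k) y = ?E k" using k by simp
  qed
qed

text \<open>Modulo a power of \<open>f\<close> longer sequences do not occur. The properness
  condition drops out because everything stays inside \<open>M\<close>.\<close>

lemma reg_seq_short_iff:
  assumes J: "is_ideal J" "J \<subseteq> M" and len: "length ys \<le> 2"
  shows "reg_seq M J ys \<longleftrightarrow> set ys \<subseteq> M \<and> (0 < length ys \<longrightarrow> quot J (ys ! 0) = J)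
     \<and> (1 < length ys \<longrightarrow> quot (gen (insert (ys ! 0) J)) (ys ! 1) = gen (insert (ys ! 0) J))"
proof
  assume "reg_seq M J ys"
  then show "set ys \<subseteq> M \<and> (0 < length ys \<longrightarrow> quot J (ys ! 0) = J)
     \<and> (1 < length ys \<longrightarrow> quot (gen (insert (ys ! 0) J)) (ys ! 1) = gen (insert (ys ! 0) J))"
    using reg_seqD[OF _ J(1), of M ys] by (simp add: reg_seq_def)
next
  assume r: "set ys \<subseteq> M \<and> (0 < length ys \<longrightarrow> quot J (ys ! 0) = J)
     \<and> (1 < length ys \<longrightarrow> quot (gen (insert (ys ! 0) J)) (ys ! 1) = gen (insert (ys ! 0) J))"
  then have "gen (J \<union> set ys) \<subseteq> M" using J prime_idealD(1)[OF M] by (intro idl.span_minimal) auto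
  then have "gen (J \<union> set ys) \<noteq> UNIV" using prime_idealD(2)[OF M] by auto
  moreover have "quot (gen (J \<union> set (take i ys))) (ys ! i) = gen (J \<union> set (take i ys))" if i: "i < length ys" for i
  proof -
    have "i = 0 \<or> i = 1" using i len by linarith
    moreover have "set (take 1 ys) = {ys ! 0}" using i by (cases ys) auto
    ultimately show ?thesis using r i J(1) by auto
  qed
  ultimately show "reg_seq M J ys" using r by (simp add: reg_seq_def)
qed

lemma power_ideal_in_M:
  assumes f: "f \<in> M" and n: "n > 0" shows "gen (insert (f ^ n) K) \<subseteq> M"
proof -
  have idM: "is_ideal M" using prime_idealD(1)[OF M] .
  obtain m where "n = Suc m" using n by (cases n) auto
  then have "f ^ n \<in> M" using ideal_mult_right[OF idM f] by simp
  then show ?thesis using idM KM by (intro gen_insert_minimal)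
qed

lemma reg_seq_principal_power_length:
  assumes f: "f \<in> M" "f \<notin> K" and k: "k > 0" and ys: "reg_seq M (gen (insert (f ^ k) K)) ys"
  shows "length ys \<le> 2"
proof -
  obtain Q where Q: "Q \<in> assoc_primes (gen (insert (f ^ k) K))" "gen (insert (f ^ k) K) \<subseteq> Q" "Q \<subseteq> M"
    using assoc_exists[OF idl.subspace_span gen_insert_superset M power_ideal_in_M[OF f(1) k]] by metis
  have "f ^ k \<in> Q" using Q(2) gen_insert_mem by blast
  then have "K \<subset> Q" using power_notin[OF f(2)] Q(2) gen_insert_superset[of K "f ^ k"] by blast
  then show ?thesis using reg_seq_length_le_2[OF idl.subspace_span gen_insert_superset Q(1,3) _ ys] by blast
qed

lemma reg_seq_principal_power:
  assumes f: "f \<in> M" "f \<notin> K" and k: "k > 0"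
  shows "reg_seq M (gen (insert (f ^ k) K)) ys \<longleftrightarrow> reg_seq M (gen (insert f K)) ys"
proof (cases "length ys \<le> 2")
  case False
  then show ?thesis using reg_seq_principal_power_length[OF f k, of ys]
      reg_seq_principal_power_length[OF f zero_less_one, of ys] by (auto simp: power_one_right)
next
  case len: True
  let ?E = "\<lambda>k. gen (insert (f ^ k) K)"
  have fK: "quot K f = K" using prime_mult_iff[OF K] f(2) by (auto simp: quot_def)
  have first: "quot (?E k) y = ?E k \<longleftrightarrow> quot (gen (insert f K)) y = gen (insert f K)" for y
    by (rule regular_power_iff[OF idK fK k])
  have comm: "gen (insert y (gen (insert x K))) = gen (insert x (gen (insert y K)))" for x y
    by (simp add: gen_insert_gen insert_commute)
  \<comment> \<open>If \<open>y\<close> is regular modulo \<open>f\<close>, then \<open>f\<close> is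
    regular modulo \<open>y\<close>, since both are read over the domain \<open>T/K\<close>. So
    \<open>f\<close> may be adjoined after \<open>y\<close>, where \<open>regular_power_iff\<close>
    changes its exponent.\<close>
  have second: "quot (gen (insert y (?E k))) z = gen (insert y (?E k))
      \<longleftrightarrow> quot (gen (insert y (gen (insert f K)))) z = gen (insert y (gen (insert f K)))"
    if y: "quot (gen (insert f K)) y = gen (insert f K)" for y z
  proof -
    let ?B = "gen (insert y K)"
    have "s \<in> ?B" if s: "s * f \<in> ?B" for s
    proof -
      obtain h where h: "s * f - h * y \<in> K" using s gen_insert_iff[OF idK] by blast
      then have "s * f - h * y \<in> gen (insert f K)" using gen_insert_superset by blast
      moreover have "s * f \<in> gen (insert f K)" by (rule ideal_mult_left[OF idl.subspace_span gen_insert_mem])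
      ultimately have "h * y \<in> gen (insert f K)" using ideal_minus_cancel[OF idl.subspace_span] by blast
      then have "h \<in> gen (insert f K)" using y by (auto simp: quot_def)
      then obtain g where g: "h - g * f \<in> K" using gen_insert_iff[OF idK] by blast
      have "(s * f - h * y) + y * (h - g * f) \<in> K" by (rule ideal_add[OF idK h ideal_mult_left[OF idK g]])
      also have "(s * f - h * y) + y * (h - g * f) = f * (s - g * y)" by (simp add: algebra_simps)
      finally have "s - g * y \<in> K" using prime_mult_iff[OF K] f(2) by blast
      then show ?thesis using gen_insert_iff[OF idK] by blast
    qed
    then have "quot ?B f = ?B" using quot_superset[OF idl.subspace_span, of "insert y K" f] by (auto simp: quot_def)
    from regular_power_iff[OF idl.subspace_span this k] show ?thesis unfolding comm[of y] .
  qed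
  have EM: "?E k \<subseteq> M" "gen (insert f K) \<subseteq> M"
    using power_ideal_in_M[OF f(1) k] power_ideal_in_M[OF f(1) zero_less_one] by auto
  show ?thesis
    unfolding reg_seq_short_iff[OF idl.subspace_span EM(1) len] reg_seq_short_iff[OF idl.subspace_span EM(2) len]
    using first second[of "ys ! 0" "ys ! 1"] by (cases "0 < length ys") auto
qed

theorem assoc_primes_eq_iff_depth_eq:
  assumes A: "is_ideal A" "K \<subset> A" "A \<noteq> UNIV"
    and sub: "\<And>k x. k > 0 \<Longrightarrow> x \<notin> ipow K A k \<Longrightarrow> quot (ipow K A k) x \<subseteq> M"
    and kl: "k > 0" "l > 0"
  shows "assoc_primes (ipow K A k) = assoc_primes (ipow K A l)
     \<longleftrightarrow> seq_depth M (ipow K A k) = seq_depth M (ipow K A l)"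
proof -
  obtain f J where fJ: "f \<notin> K" "is_ideal J" "K \<subset> J" "A = mult_mod K f J"
    and nop: "\<And>q. J \<subseteq> gen (insert q K) \<Longrightarrow> 1 \<in> gen (insert q K)"
    using factor_out[OF A(1,2)] by metis
  have KJ: "K \<subseteq> J" using fJ(3) by blast
  have pow: "ipow K A n = mult_mod K (f ^ n) (ipow K J n)" for n
    unfolding fJ(4) by (rule ipow_mult_mod[OF idK fJ(2) KJ])
  have powA: "ipow K B n \<subseteq> B" if "n > 0" "is_ideal B" "K \<subseteq> B" for n B
    using that ipow_subset by (cases n) blast+
  have proper: "ipow K A n \<noteq> UNIV" if "n > 0" for n using powA[OF that A(1)] A(2,3) by blast
  have inM: "ipow K A n \<subseteq> M" if n: "n > 0" for n
  proof -
    have "1 \<notin> ipow K A n" using proper[OF n] ideal_eq_UNIV[OF ipow_ideal] by blast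
    then show ?thesis using sub[OF n, of 1] by simp
  qed
  have below: "P \<subseteq> M" if n: "n > 0" and P: "P \<in> assoc_primes (ipow K A n)" for n P
  proof -
    obtain x where x: "prime_ideal P" "P = quot (ipow K A n) x" using P unfolding assoc_primes_def by blast
    then have "x \<notin> ipow K A n" using prime_idealD(2)[OF x(1)] by (auto simp: quot_def)
    then show ?thesis using sub[OF n] x by blast
  qed
  have assoc_sub: "assoc_primes (ipow K A i) \<subseteq> assoc_primes (ipow K A j)"
    if ij: "i > 0" "j > 0" and M': "M \<in> assoc_primes (ipow K A i) \<Longrightarrow> M \<in> assoc_primes (ipow K A j)" for i j
    using assoc_primes_power[OF A(1,2) _ _ ij(2)] below[OF ij(1)] M' by blast
  have "0 < seq_depth M (ipow K A n)" if n: "n > 0" and "M \<notin> assoc_primes (ipow K A n)" for n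
  proof -
    have "\<exists>y\<in>M. quot (ipow K A n) y = ipow K A n"
      by (rule exists_regular[OF ipow_ideal ipow_superset sub[OF n] that(2)])
    then obtain y where "y \<in> M" "quot (ipow K A n) y = ipow K A n" by blast
    then have "reg_seq M (ipow K A n) [y]" by (intro reg_seq_single ipow_ideal inM n)
    then have "enat (length [y]) \<le> seq_depth M (ipow K A n)" unfolding seq_depth_def by (blast intro: Sup_upper)
    then show ?thesis by (metis enat_0_iff(1) i0_less length_0_conv list.distinct(1) not_le zero_enat_def le_zero_eq)
  qed
  then have zero: "seq_depth M (ipow K A n) = 0 \<longleftrightarrow> M \<in> assoc_primes (ipow K A n)" if "n > 0" for n
    using seq_depth_0[OF ipow_ideal proper[OF that]] that by (metis less_irrefl)
  have both: "seq_depth M (ipow K A k) = seq_depth M (ipow K A l)"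
    if no: "M \<notin> assoc_primes (ipow K A k)" "M \<notin> assoc_primes (ipow K A l)"
  proof (cases "J = UNIV")
    case True
    have "ipow K J n = UNIV" for n
      using power_mem_ipow[of 1 J n K] True ideal_eq_UNIV[OF ipow_ideal] by simp
    then have principal: "ipow K A n = gen (insert (f ^ n) K)" for n
      unfolding pow by (simp add: mult_mod_UNIV[OF idK])
    have "f \<in> gen (insert (f ^ 1) K)" using gen_insert_mem by simp
    then have "f \<in> M" using inM[of 1] unfolding principal by auto
    then have "reg_seq M (ipow K A k) ys \<longleftrightarrow> reg_seq M (ipow K A l) ys" for ys
      unfolding principal using reg_seq_principal_power[OF _ fJ(1)] kl by blast
    then show ?thesis by (simp add: seq_depth_def)
  next
    case False
    have "seq_depth M (ipow K A n) = 1" if n: "n > 0" and M': "M \<notin> assoc_primes (ipow K A n)" for n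
    proof -
      have "\<exists>y\<in>M. quot (ipow K A n) y = ipow K A n"
        by (rule exists_regular[OF ipow_ideal ipow_superset sub[OF n] M'])
      then obtain y where "y \<in> M" "quot (ipow K A n) y = ipow K A n" by blast
      then have y: "reg_seq M (ipow K A n) [y]" by (intro reg_seq_single ipow_ideal inM n)
      \<comment> \<open>This exhibits the power of \<open>J\<close> as a colon ideal of the power of
        \<open>A\<close>, so \<open>sub\<close>, which speaks of \<open>A\<close> only, places it
        inside \<open>M\<close>.\<close>
      have JA: "quot (ipow K A n) (f ^ n) = ipow K J n"
        unfolding pow using quot_mult_mod[OF K ipow_ideal ipow_superset power_notin[OF fJ(1)], where w=1] by simp
      have "1 \<notin> ipow K J n" using powA[OF n fJ(2) KJ] False ideal_eq_UNIV[OF fJ(2)] by blast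
      then have "f ^ n \<notin> ipow K A n" unfolding JA[symmetric] by (simp add: quot_def)
      then have "ipow K J n \<subseteq> M" using sub[OF n] unfolding JA[symmetric] by blast
      then obtain Q where Q: "Q \<in> assoc_primes (ipow K J n)" "ipow K J n \<subseteq> Q" "Q \<subseteq> M"
        using assoc_exists[OF ipow_ideal ipow_superset M] by metis
      have QA: "Q \<in> assoc_primes (ipow K A n)"
        unfolding pow using Q(1) assoc_primes_mult_mod[OF ipow_ideal ipow_superset power_notin[OF fJ(1)]] by blast
      have prQ: "prime_ideal Q" using Q(1) by (simp add: assoc_primes_def)
      obtain P1 where P1: "prime_ideal P1" "K \<subset> P1" "P1 \<subset> Q"
        using height_two[OF fJ(2,3) nop prQ ipow_subset_prime[OF prQ Q(2)]] by metis
      have "length ys \<le> length [y]" if "reg_seq M (ipow K A n) ys" for ys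
        using reg_seq_length_le_1[OF ipow_ideal ipow_superset QA Q(3) P1 that] by simp
      from seq_depth_eq[OF y this] show ?thesis by (simp add: one_enat_def)
    qed
    then show ?thesis using no kl by simp
  qed
  show ?thesis
  proof
    assume "assoc_primes (ipow K A k) = assoc_primes (ipow K A l)"
    then show "seq_depth M (ipow K A k) = seq_depth M (ipow K A l)"
      using zero[OF kl(1)] zero[OF kl(2)] both by metis
  next
    assume "seq_depth M (ipow K A k) = seq_depth M (ipow K A l)"
    then have "M \<in> assoc_primes (ipow K A k) \<longleftrightarrow> M \<in> assoc_primes (ipow K A l)"
      using zero[OF kl(1)] zero[OF kl(2)] by simp
    then show "assoc_primes (ipow K A k) = assoc_primes (ipow K A l)"
      using assoc_sub[OF kl] assoc_sub[OF kl(2,1)] by blast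
  qed
qed

end

section \<open>Transfer to carrier-based rings\<close>

text \<open>\<open>R\<close> is the quotient of \<open>T\<close> by \<open>ker\<close>. Taking
  preimages is an order-preserving bijection from the ideals of \<open>R\<close> onto the ideals of
  \<open>T\<close> above \<open>ker\<close>, under which primes, colon ideals, powers and regular
  sequences correspond.\<close>

locale ring_cover = cring R for R (structure) +
  fixes \<phi> :: "'t::comm_ring_1 \<Rightarrow> 'a"
  assumes closed: "\<phi> x \<in> carrier R"
    and hom_add: "\<phi> (x + y) = \<phi> x \<oplus> \<phi> y"
    and hom_mult: "\<phi> (x * y) = \<phi> x \<otimes> \<phi> y"
    and hom_one: "\<phi> 1 = \<one>"
    and surj: "r \<in> carrier R \<Longrightarrow> \<exists>x. r = \<phi> x"
begin

definition ker :: "'t set" where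
  "ker = \<phi> -` {\<zero>}"

lemma hom_zero: "\<phi> 0 = \<zero>"
proof -
  have "\<phi> 0 \<oplus> \<phi> 0 = \<phi> 0" using hom_add[of 0 0] by simp
  then show ?thesis using closed by simp
qed

lemma hom_minus: "\<phi> (- x) = \<ominus> \<phi> x"
proof -
  have "\<phi> (- x) \<oplus> \<phi> x = \<zero>" using hom_add[of "- x" x] hom_zero by simp
  from minus_equality[OF this closed closed] show ?thesis by simp
qed

lemma image_vimage: "S \<subseteq> carrier R \<Longrightarrow> \<phi> ` (\<phi> -` S) = S"
  using surj by (auto simp: image_iff)

lemma vimage_inject: "S \<subseteq> carrier R \<Longrightarrow> S' \<subseteq> carrier R \<Longrightarrow> \<phi> -` S = \<phi> -` S' \<longleftrightarrow> S = S'"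
  by (metis image_vimage)

lemma vimage_subset_iff: "S \<subseteq> carrier R \<Longrightarrow> \<phi> -` S \<subseteq> \<phi> -` S' \<longleftrightarrow> S \<subseteq> S'"
  by (metis image_vimage image_subset_iff_subset_vimage vimage_mono)

lemma vimage_carrier: "\<phi> -` carrier R = UNIV"
  using closed by auto

lemma ideal_carr: "ideal J R \<Longrightarrow> J \<subseteq> carrier R"
  by (meson ideal.Icarr subsetI)

lemma vimage_ideal:
  assumes J: "ideal J R" shows "is_ideal (\<phi> -` J)" "ker \<subseteq> \<phi> -` J"
proof -
  interpret ideal J R by fact
  show "is_ideal (\<phi> -` J)"
    by (rule idl.subspaceI) (auto simp: hom_zero hom_add hom_mult closed I_l_closed)
  show "ker \<subseteq> \<phi> -` J" by (auto simp: ker_def)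
qed

lemma ker_ideal: "is_ideal ker"
  unfolding ker_def by (rule vimage_ideal[OF zeroideal])

lemma image_ideal:
  assumes A: "is_ideal A" shows "ideal (\<phi> ` A) R"
proof (rule idealI)
  show "ring R" by (rule ring_axioms)
  show "subgroup (\<phi> ` A) (add_monoid R)"
  proof
    show "\<phi> ` A \<subseteq> carrier (add_monoid R)" using closed by auto
    show "x \<otimes>\<^bsub>add_monoid R\<^esub> y \<in> \<phi> ` A" if "x \<in> \<phi> ` A" "y \<in> \<phi> ` A" for x y
      using that ideal_add[OF A] by (auto simp: hom_add[symmetric])
    show "\<one>\<^bsub>add_monoid R\<^esub> \<in> \<phi> ` A" using ideal_zero[OF A] hom_zero by (metis imageI monoid.simps(2))
    fix x assume "x \<in> \<phi> ` A"
    then obtain a where a: "a \<in> A" "x = \<phi> a" by blast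
    have "\<ominus> x = \<phi> (- a)" by (simp add: a hom_minus)
    then show "inv\<^bsub>add_monoid R\<^esub> x \<in> \<phi> ` A"
      using idl.subspace_neg[OF A a(1)] by (simp add: a_inv_def[symmetric])
  qed
  fix a x assume "a \<in> \<phi> ` A" "x \<in> carrier R"
  then obtain b y where "b \<in> A" "a = \<phi> b" "x = \<phi> y" using surj by blast
  then show "x \<otimes> a \<in> \<phi> ` A" "a \<otimes> x \<in> \<phi> ` A"
    using ideal_mult_left[OF A] ideal_mult_right[OF A] by (auto simp: hom_mult[symmetric])
qed

lemma vimage_image:
  assumes A: "is_ideal A" "ker \<subseteq> A" shows "\<phi> -` (\<phi> ` A) = A"
proof
  show "\<phi> -` \<phi> ` A \<subseteq> A"
  proof
    fix x assume "x \<in> \<phi> -` \<phi> ` A"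
    then obtain a where a: "a \<in> A" "\<phi> x = \<phi> a" by auto
    then have "\<phi> (x - a) = \<zero>" using hom_add[of x "- a"] hom_minus[of a] closed[of a] by (simp add: r_neg)
    then have "x - a \<in> A" using A(2) by (auto simp: ker_def)
    then show "x \<in> A" using ideal_add[OF A(1) _ a(1)] by fastforce
  qed
qed auto

lemma primeideal_iff: "P \<subseteq> carrier R \<Longrightarrow> primeideal P R \<longleftrightarrow> prime_ideal (\<phi> -` P)"
proof
  assume P: "P \<subseteq> carrier R"
  {
    assume "primeideal P R"
    then interpret primeideal P R .
    have "1 \<notin> \<phi> -` P" using I_notcarr one_imp_carrier hom_one by auto
    then show "prime_ideal (\<phi> -` P)"
      unfolding prime_ideal_def using vimage_ideal[OF is_ideal] I_prime closed by (auto simp: hom_mult)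
  }
  assume pr: "prime_ideal (\<phi> -` P)"
  have "ideal (\<phi> ` (\<phi> -` P)) R" by (rule image_ideal[OF prime_idealD(1)[OF pr]])
  then have I: "ideal P R" using image_vimage[OF P] by simp
  show "primeideal P R"
  proof (rule primeidealI[OF I is_cring])
    show "carrier R \<noteq> P" using prime_idealD(2)[OF pr] hom_one by auto
    fix a b assume "a \<in> carrier R" "b \<in> carrier R" "a \<otimes> b \<in> P"
    then obtain x y where "a = \<phi> x" "b = \<phi> y" "x * y \<in> \<phi> -` P" using surj by (metis hom_mult vimage_eq)
    then show "a \<in> P \<or> b \<in> P" using prime_idealD(3)[OF pr] by auto
  qed
qed

lemma vimage_colon: "\<phi> -` (colon R J (\<phi> x)) = quot (\<phi> -` J) x"
  by (auto simp: colon_def quot_def hom_mult closed)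

lemma colon_carr: "colon R J x \<subseteq> carrier R"
  by (auto simp: colon_def)

lemma vimage_genideal:
  assumes J: "ideal J R"
  shows "\<phi> -` (Idl (J \<union> \<phi> ` S)) = gen (\<phi> -` J \<union> S)"
proof
  let ?G = "gen (\<phi> -` J \<union> S)"
  have sub: "J \<union> \<phi> ` S \<subseteq> carrier R" using ideal_carr[OF J] closed by auto
  have "\<phi> -` J \<union> S \<subseteq> ?G" by (rule idl.span_superset)
  then have "J \<union> \<phi> ` S \<subseteq> \<phi> ` ?G" using image_vimage[OF ideal_carr[OF J]] by blast
  then have "Idl (J \<union> \<phi> ` S) \<subseteq> \<phi> ` ?G" by (intro genideal_minimal image_ideal) auto
  then have "\<phi> -` (Idl (J \<union> \<phi> ` S)) \<subseteq> \<phi> -` (\<phi> ` ?G)" by (rule vimage_mono)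
  moreover have "ker \<subseteq> ?G" using vimage_ideal(2)[OF J] \<open>\<phi> -` J \<union> S \<subseteq> ?G\<close> by blast
  ultimately show "\<phi> -` (Idl (J \<union> \<phi> ` S)) \<subseteq> ?G" using vimage_image[of ?G] by simp
  have "J \<union> \<phi> ` S \<subseteq> Idl (J \<union> \<phi> ` S)" by (rule genideal_self[OF sub])
  then show "?G \<subseteq> \<phi> -` (Idl (J \<union> \<phi> ` S))"
    by (intro idl.span_minimal vimage_ideal genideal_ideal sub) auto
qed

lemma ideal_pow_ideal: "ideal I R \<Longrightarrow> ideal (ideal_pow R I k) R"
  by (induction k) (auto intro: oneideal ideal_prod_is_ideal)

lemma vimage_ideal_pow:
  assumes I: "ideal I R"
  shows "\<phi> -` (ideal_pow R I k) = ipow ker (\<phi> -` I) k"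
proof (induction k)
  case 0
  then show ?case using closed by auto
next
  case (Suc k)
  let ?P = "ideal_pow R I k" and ?G = "ipow ker (\<phi> -` I) (Suc k)"
  have P: "ideal ?P R" by (rule ideal_pow_ideal[OF I])
  show ?case
  proof
    have "x \<in> \<phi> ` ?G" if "x \<in> ideal_prod R ?P I" for x
      using that
    proof (induction x rule: ideal_prod.induct)
      case (prod i j)
      obtain a b where ab: "i = \<phi> a" "j = \<phi> b"
        using prod surj ideal_carr[OF P] ideal_carr[OF I] by (metis subsetD)
      then have "a \<in> ipow ker (\<phi> -` I) k" "b \<in> \<phi> -` I" using prod Suc by auto
      then have "a * b \<in> ?G" by (rule ipow_prod)
      then show ?case using ab by (metis hom_mult imageI)
    next
      case (sum s t)
      then obtain a b where "a \<in> ?G" "b \<in> ?G" "s = \<phi> a" "t = \<phi> b" by blast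
      then show ?case using ideal_add[OF ipow_ideal] by (metis hom_add imageI)
    qed
    then show "\<phi> -` (ideal_pow R I (Suc k)) \<subseteq> ?G"
      using vimage_image[OF ipow_ideal ipow_superset, of "\<phi> -` I" "Suc k"] by auto
    show "?G \<subseteq> \<phi> -` (ideal_pow R I (Suc k))"
      unfolding ipow.simps(2)
    proof (rule idl.span_minimal)
      show "is_ideal (\<phi> -` (ideal_pow R I (Suc k)))" by (rule vimage_ideal[OF ideal_pow_ideal[OF I]])
      have "a * b \<in> \<phi> -` (ideal_pow R I (Suc k))" if "a \<in> ipow ker (\<phi> -` I) k" "b \<in> \<phi> -` I" for a b
        using that Suc[symmetric] by (auto simp: hom_mult intro: ideal_prod.prod)
      then show "ker \<union> {a * b |a b. a \<in> ipow ker (\<phi> -` I) k \<and> b \<in> \<phi> -` I} \<subseteq> \<phi> -` (ideal_pow R I (Suc k))"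
        using vimage_ideal(2)[OF ideal_pow_ideal[OF I, of "Suc k"]] by blast
    qed
  qed
qed

lemma assoc_primes_vimage: "assoc_primes (\<phi> -` J) = vimage \<phi> ` Ass R J"
proof
  show "vimage \<phi> ` Ass R J \<subseteq> assoc_primes (\<phi> -` J)"
  proof
    fix Q assume "Q \<in> vimage \<phi> ` Ass R J"
    then obtain P x where P: "primeideal P R" "x \<in> carrier R" "P = colon R J x" "Q = \<phi> -` P"
      by (auto simp: Ass_def)
    then obtain y where "x = \<phi> y" using surj by blast
    then show "Q \<in> assoc_primes (\<phi> -` J)"
      using P primeideal_iff[OF colon_carr] vimage_colon unfolding assoc_primes_def by blast
  qed
  show "assoc_primes (\<phi> -` J) \<subseteq> vimage \<phi> ` Ass R J"
  proof
    fix Q assume "Q \<in> assoc_primes (\<phi> -` J)"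
    then obtain x where x: "prime_ideal Q" "Q = quot (\<phi> -` J) x" by (auto simp: assoc_primes_def)
    then have Q: "Q = \<phi> -` (colon R J (\<phi> x))" using vimage_colon by simp
    then have "colon R J (\<phi> x) \<in> Ass R J"
      using x(1) primeideal_iff[OF colon_carr, of J "\<phi> x"] closed unfolding Ass_def by blast
    then show "Q \<in> vimage \<phi> ` Ass R J" using Q by blast
  qed
qed

lemma Ass_eq_iff: "Ass R J = Ass R J' \<longleftrightarrow> assoc_primes (\<phi> -` J) = assoc_primes (\<phi> -` J')"
proof
  assume eq: "assoc_primes (\<phi> -` J) = assoc_primes (\<phi> -` J')"
  have carr: "P \<subseteq> carrier R" if "P \<in> Ass R J \<union> Ass R J'" for P using that colon_carr by (auto simp: Ass_def)
  have "inj_on (vimage \<phi>) (Ass R J \<union> Ass R J')"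
    by (rule inj_onI) (metis carr vimage_inject)
  then show "Ass R J = Ass R J'"
    using eq unfolding assoc_primes_vimage by (simp add: inj_on_image_eq_iff)
qed (simp add: assoc_primes_vimage)

lemma regular_seq_iff:
  assumes J: "ideal J R"
  shows "regular_seq R N J (map \<phi> ys) \<longleftrightarrow> reg_seq (\<phi> -` N) (\<phi> -` J) ys"
proof -
  have G: "ideal (Idl (J \<union> \<phi> ` S)) R" for S
    using ideal_carr[OF J] closed by (intro genideal_ideal) auto
  have 1: "colon R (Idl (J \<union> \<phi> ` S)) (\<phi> y) = Idl (J \<union> \<phi> ` S)
      \<longleftrightarrow> quot (gen (\<phi> -` J \<union> S)) y = gen (\<phi> -` J \<union> S)" for S y
    using vimage_inject[OF colon_carr ideal_carr[OF G]] vimage_colon vimage_genideal[OF J] by metis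
  have 2: "Idl (J \<union> \<phi> ` S) = carrier R \<longleftrightarrow> gen (\<phi> -` J \<union> S) = UNIV" for S
    using vimage_inject[OF ideal_carr[OF G] order.refl] vimage_carrier vimage_genideal[OF J] by metis
  have "set (map \<phi> ys) = \<phi> ` set ys" "\<And>i. set (take i (map \<phi> ys)) = \<phi> ` set (take i ys)"
    by (auto simp: take_map)
  then show ?thesis
    unfolding regular_seq_def reg_seq_def using 1 2 by (auto simp: image_subset_iff subset_iff)
qed

lemma depth_eq:
  assumes J: "ideal J R" and N: "ideal N R" "J \<subseteq> N" "N \<noteq> carrier R"
  shows "depth R N J = seq_depth (\<phi> -` N) (\<phi> -` J)"
proof -
  have "Idl (J \<union> N) \<subseteq> N" using N by (intro genideal_minimal) auto
  then have ne: "Idl (J \<union> N) \<noteq> carrier R" using N(3) ideal_carr[OF N(1)] by blast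
  have "{enat (length xs) |xs. regular_seq R N J xs} = {enat (length ys) |ys. reg_seq (\<phi> -` N) (\<phi> -` J) ys}"
  proof
    show "{enat (length ys) |ys. reg_seq (\<phi> -` N) (\<phi> -` J) ys} \<subseteq> {enat (length xs) |xs. regular_seq R N J xs}"
    proof
      fix e assume "e \<in> {enat (length ys) |ys. reg_seq (\<phi> -` N) (\<phi> -` J) ys}"
      then obtain ys where "e = enat (length (map \<phi> ys))" "regular_seq R N J (map \<phi> ys)"
        using regular_seq_iff[OF J] by auto
      then show "e \<in> {enat (length xs) |xs. regular_seq R N J xs}" by blast
    qed
    show "{enat (length xs) |xs. regular_seq R N J xs} \<subseteq> {enat (length ys) |ys. reg_seq (\<phi> -` N) (\<phi> -` J) ys}"
    proof
      fix e assume "e \<in> {enat (length xs) |xs. regular_seq R N J xs}"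
      then obtain xs where xs: "e = enat (length xs)" "regular_seq R N J xs" by blast
      then have "set xs \<subseteq> range \<phi>" using ideal_carr[OF N(1)] surj by (auto simp: regular_seq_def)
      then obtain ys where "xs = map \<phi> ys" by (metis ex_map_conv rangeE subsetD)
      then show "e \<in> {enat (length ys) |ys. reg_seq (\<phi> -` N) (\<phi> -` J) ys}"
        using xs regular_seq_iff[OF J] by auto
    qed
  qed
  then show ?thesis using ne by (simp add: depth_def seq_depth_def)
qed

lemma acc_ker:
  assumes noeth: "noetherian_ring R" shows "acc_above ker"
  unfolding acc_above_def
proof (intro allI impI)
  interpret noetherian_ring R by fact
  fix FF :: "'t set set" assume S: "FF \<noteq> {} \<and> (\<forall>A\<in>FF. is_ideal A \<and> ker \<subseteq> A)"
  show "\<exists>A\<in>FF. \<forall>B\<in>FF. A \<subseteq> B \<longrightarrow> B = A"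
  proof (rule ccontr)
    assume no: "\<not> ?thesis"
    then have step: "\<exists>B. B \<in> FF \<and> A \<subset> B" if "A \<in> FF" for A using that by blast
    have "\<exists>F. \<forall>n::nat. F n \<in> FF \<and> F n \<subset> F (Suc n)"
      by (rule dependent_nat_choice) (use S step in blast)+
    then obtain F where F: "\<And>n. F n \<in> FF" "\<And>n. F n \<subset> F (Suc n)" by metis
    have "F n \<subseteq> F (Suc n)" for n using F(2)[of n] by (rule psubset_imp_subset)
    then have mono: "m \<le> n \<Longrightarrow> F m \<subseteq> F n" for m n by (rule lift_Suc_mono_le)
    let ?C = "range (\<lambda>n. \<phi> ` F n)"
    have "subset.chain {I. ideal I R} ?C"
      unfolding subset_chain_def
    proof (intro conjI ballI)
      show "?C \<subseteq> {I. ideal I R}" using S F(1) image_ideal by auto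
      fix U V assume "U \<in> ?C" "V \<in> ?C"
      then obtain m n where "U = \<phi> ` F m" "V = \<phi> ` F n" by blast
      then show "U \<subseteq> V \<or> V \<subseteq> U" using mono[of m n] mono[of n m] by (metis image_mono nat_le_linear)
    qed
    then have "\<Union>?C \<in> ?C" by (rule ideal_chain_is_trivial[rotated]) simp
    then obtain n where "\<Union>?C = \<phi> ` F n" by blast
    then have "\<phi> ` F (Suc n) \<subseteq> \<phi> ` F n" by blast
    then have "F (Suc n) \<subseteq> \<phi> -` (\<phi> ` F n)" by blast
    then have "F (Suc n) \<subseteq> F n" using S F(1)[of n] vimage_image by blast
    then show False using F(2)[of n] by blast
  qed
qed

lemma ipow_UNIV: "ipow K UNIV k = UNIV"
  using power_mem_ipow[of 1 UNIV k K] ideal_eq_UNIV[OF ipow_ideal] by simp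

lemma ipow_self: "is_ideal K \<Longrightarrow> k > 0 \<Longrightarrow> ipow K K k = K"
proof (cases k)
  case (Suc n)
  assume K: "is_ideal K"
  show ?thesis using ipow_subset[OF K order.refl, of n] ipow_superset[of K K k] Suc by blast
qed simp

theorem Ass_eq_iff_depth_eq:
  assumes fd: "factorial_dim3 ker (\<phi> -` m)" and m: "ideal m R"
    and I: "ideal I R"
    and sub: "\<And>k x. k > 0 \<Longrightarrow> x \<in> carrier R \<Longrightarrow> x \<notin> ideal_pow R I k \<Longrightarrow> colon R (ideal_pow R I k) x \<subseteq> m"
    and kl: "k > 0" "l > 0"
  shows "Ass R (ideal_pow R I k) = Ass R (ideal_pow R I l)
    \<longleftrightarrow> depth R m (ideal_pow R I k) = depth R m (ideal_pow R I l)"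
proof -
  interpret factorial_dim3 ker "\<phi> -` m" by fact
  note pow = vimage_ideal_pow[OF I]
  have carr: "ideal_pow R I n \<subseteq> carrier R" for n by (rule ideal_carr[OF ideal_pow_ideal[OF I]])
  \<comment> \<open>The unit ideal and the zero ideal are outside the general comparison, but all
    their positive powers coincide.\<close>
  consider "\<phi> -` I = UNIV" | "\<phi> -` I = ker" | "ker \<subset> \<phi> -` I" "\<phi> -` I \<noteq> UNIV"
    using vimage_ideal(2)[OF I] by blast
  then show ?thesis
  proof cases
    case 1
    have "\<phi> -` (ideal_pow R I k) = \<phi> -` (ideal_pow R I l)" unfolding pow 1 ipow_UNIV ..
    then have "ideal_pow R I k = ideal_pow R I l" using vimage_inject[OF carr carr] by blast
    then show ?thesis by simp
  next
    case 2
    have "\<phi> -` (ideal_pow R I k) = \<phi> -` (ideal_pow R I l)"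
      unfolding pow 2 using ipow_self[OF ker_ideal] kl by simp
    then have "ideal_pow R I k = ideal_pow R I l" using vimage_inject[OF carr carr] by blast
    then show ?thesis by simp
  next
    case 3
    have sub': "quot (ipow ker (\<phi> -` I) n) x \<subseteq> \<phi> -` m" if n: "n > 0" and x: "x \<notin> ipow ker (\<phi> -` I) n" for n x
    proof -
      have "\<phi> x \<notin> ideal_pow R I n" using x by (simp add: pow[symmetric])
      then have "colon R (ideal_pow R I n) (\<phi> x) \<subseteq> m" by (rule sub[OF n closed])
      then have "\<phi> -` (colon R (ideal_pow R I n) (\<phi> x)) \<subseteq> \<phi> -` m" by auto
      then show ?thesis by (simp add: vimage_colon pow)
    qed
    have "m \<noteq> carrier R" using prime_idealD(2)[OF M] closed by auto
    have "depth R m (ideal_pow R I n) = seq_depth (\<phi> -` m) (ipow ker (\<phi> -` I) n)" if n: "n > 0" for n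
    proof -
      obtain n' where n': "n = Suc n'" using n by (cases n) auto
      have "1 \<notin> ipow ker (\<phi> -` I) n"
        using ipow_subset[OF vimage_ideal[OF I], of n'] 3(2) ideal_eq_UNIV[OF vimage_ideal(1)[OF I]] n' by blast
      then have "ipow ker (\<phi> -` I) n \<subseteq> \<phi> -` m" using sub'[OF n, of 1] by simp
      then have "ideal_pow R I n \<subseteq> m" using vimage_subset_iff[OF carr] by (simp add: pow[symmetric])
      then show ?thesis
        using depth_eq[OF ideal_pow_ideal[OF I] m _ \<open>m \<noteq> carrier R\<close>] by (simp add: pow)
    qed
    then show ?thesis
      using assoc_primes_eq_iff_depth_eq[OF vimage_ideal(1)[OF I] 3 sub' kl] kl
      by (simp add: Ass_eq_iff pow)
  qed
qed

end

lemma astab_eq_dstab: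
  assumes "\<And>k l. k > 0 \<Longrightarrow> l > 0 \<Longrightarrow> Ass R (ideal_pow R I k) = Ass R (ideal_pow R I l)
    \<longleftrightarrow> depth R m (ideal_pow R I k) = depth R m (ideal_pow R I l)"
  shows "astab R I = dstab R m I"
proof -
  have "(0 < k \<and> (\<forall>l\<ge>k. Ass R (ideal_pow R I l) = Ass R (ideal_pow R I k)))
     = (0 < k \<and> (\<forall>l\<ge>k. depth R m (ideal_pow R I l) = depth R m (ideal_pow R I k)))" for k
    using assms by (metis less_le_trans)
  then show ?thesis by (simp add: astab_def dstab_def)
qed

section \<open>Every commutative ring as a quotient of a free one\<close>

lemma poly_mapping_additive_induct [case_names zero add]:
  assumes "P 0" "\<And>u c p. P p \<Longrightarrow> P (Poly_Mapping.single u c + p)"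
  shows "P p"
proof (induction p rule: update_induct)
  case (update f a b)
  have "Poly_Mapping.update a b f = Poly_Mapping.single a b + f"
    using update by (intro poly_mapping_eqI) (auto simp: lookup_update lookup_add lookup_single when_def in_keys_iff)
  then show ?case using assms(2) update by simp
qed (rule assms(1))

context cring begin

text \<open>The free ring has a variable for each element of the type, and a multiset is a monomial;
  variables outside the carrier are evaluated to one. The test on \<open>r\<close> makes the folded
  operation commute at every argument, in the carrier or not.\<close>

definition monomial_eval :: "'a multiset \<Rightarrow> 'a" where
  "monomial_eval = fold_mset (\<lambda>a r. if a \<in> carrier R \<and> r \<in> carrier R then a \<otimes> r else r) \<one>"

definition cover_map :: "('a multiset \<Rightarrow>\<^sub>0 int) \<Rightarrow> 'a" where
  "cover_map p = (\<Oplus>u\<in>Poly_Mapping.keys p. add_pow R (Poly_Mapping.lookup p u) (monomial_eval u))"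

lemma monomial_eval_add_mset:
  "monomial_eval (add_mset a u) = (if a \<in> carrier R \<and> monomial_eval u \<in> carrier R
     then a \<otimes> monomial_eval u else monomial_eval u)"
proof -
  interpret comp_fun_commute "\<lambda>a r. if a \<in> carrier R \<and> r \<in> carrier R then a \<otimes> r else r"
    by unfold_locales (auto simp: fun_eq_iff m_lcomm)
  show ?thesis by (simp add: monomial_eval_def)
qed

lemma monomial_eval_closed [simp]: "monomial_eval u \<in> carrier R"
  by (induction u) (simp_all add: monomial_eval_add_mset, simp add: monomial_eval_def)

lemma monomial_eval_empty: "monomial_eval {#} = \<one>"
  by (simp add: monomial_eval_def)

lemma monomial_eval_add: "monomial_eval (u + v) = monomial_eval u \<otimes> monomial_eval v"
  by (induction u) (simp_all add: monomial_eval_add_mset monomial_eval_empty m_assoc)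

lemma cover_map_closed: "cover_map p \<in> carrier R"
  unfolding cover_map_def by (rule finsum_closed) auto

lemma cover_map_superset:
  assumes "finite S" "Poly_Mapping.keys p \<subseteq> S"
  shows "cover_map p = (\<Oplus>u\<in>S. add_pow R (Poly_Mapping.lookup p u) (monomial_eval u))"
proof -
  have "add_pow R (0::int) x = \<zero>" for x by (simp add: add_pow_def)
  then show ?thesis
    unfolding cover_map_def
    by (intro add.finprod_mono_neutral_cong_left) (use assms in \<open>auto simp: in_keys_iff\<close>)
qed

lemma cover_map_add: "cover_map (p + q) = cover_map p \<oplus> cover_map q"
proof -
  let ?S = "Poly_Mapping.keys p \<union> Poly_Mapping.keys q"
  have "cover_map (p + q) = (\<Oplus>u\<in>?S. add_pow R (Poly_Mapping.lookup p u + Poly_Mapping.lookup q u) (monomial_eval u))"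
    using cover_map_superset[of ?S "p + q"] Poly_Mapping.keys_add[of p q] by (simp add: lookup_add)
  also have "\<dots> = (\<Oplus>u\<in>?S. add_pow R (Poly_Mapping.lookup p u) (monomial_eval u) \<oplus> add_pow R (Poly_Mapping.lookup q u) (monomial_eval u))"
    by (rule finsum_cong') (auto simp: add.int_pow_mult)
  also have "\<dots> = (\<Oplus>u\<in>?S. add_pow R (Poly_Mapping.lookup p u) (monomial_eval u)) \<oplus> (\<Oplus>u\<in>?S. add_pow R (Poly_Mapping.lookup q u) (monomial_eval u))"
    by (rule finsum_addf) auto
  finally show ?thesis using cover_map_superset[of ?S p] cover_map_superset[of ?S q] by simp
qed

lemma cover_map_single: "cover_map (Poly_Mapping.single u c) = add_pow R c (monomial_eval u)"
proof -
  have "cover_map (Poly_Mapping.single u c) = (\<Oplus>v\<in>{u}. add_pow R (Poly_Mapping.lookup (Poly_Mapping.single u c) v) (monomial_eval v))"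
    by (rule cover_map_superset) (auto split: if_splits)
  then show ?thesis by simp
qed

lemma cover_map_mult: "cover_map (p * q) = cover_map p \<otimes> cover_map q"
proof -
  have z: "cover_map 0 = \<zero>" by (simp add: cover_map_def)
  have ss: "cover_map (Poly_Mapping.single u c * Poly_Mapping.single v d)
      = cover_map (Poly_Mapping.single u c) \<otimes> cover_map (Poly_Mapping.single v d)" for u v c d
    by (simp add: mult_single cover_map_single monomial_eval_add add_pow_ldistr_int add_pow_rdistr_int
        add.int_pow_pow mult.commute)
  have s: "cover_map (Poly_Mapping.single u c * q) = cover_map (Poly_Mapping.single u c) \<otimes> cover_map q" for u c q
    by (induction q rule: poly_mapping_additive_induct)
      (simp_all add: z distrib_left cover_map_add ss r_distr cover_map_closed)
  show ?thesis
    by (induction p rule: poly_mapping_additive_induct)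
      (simp_all add: z distrib_right cover_map_add s l_distr cover_map_closed)
qed

lemma ring_cover_cover_map: "ring_cover R cover_map"
proof unfold_locales
  show "cover_map 1 = \<one>"
    using cover_map_single[of "0::'a multiset" 1] by (simp add: monomial_eval_empty)
  fix r assume r: "r \<in> carrier R"
  have "cover_map (Poly_Mapping.single {#r#} 1) = r"
    using r by (simp add: cover_map_single monomial_eval_add_mset monomial_eval_empty)
  then show "\<exists>x. r = cover_map x" by metis
qed (simp_all add: cover_map_closed cover_map_add cover_map_mult)

end

section \<open>Dimension and factoriality of regular local rings\<close>

context ring_cover begin

text \<open>A non-unit outside \<open>m\<close> would lie in a second maximal ideal.\<close>

lemma local_inverse:
  assumes loc: "local_ring R m" and s: "s \<notin> \<phi> -` m"
  shows "\<exists>u. 1 - u * s \<in> ker"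
proof -
  have max: "maximalideal m R" and uniq: "\<And>N. maximalideal N R \<Longrightarrow> N = m"
    and acc: "acc_above ker"
    using loc acc_ker by (auto simp: local_ring_def)
  have "1 \<in> gen (insert s ker)"
  proof (rule ccontr)
    assume "1 \<notin> gen (insert s ker)"
    then have "gen (insert s ker) \<in> {A. is_ideal A \<and> ker \<subseteq> A \<and> 1 \<notin> A}"
      using gen_insert_superset[of ker s] by simp
    then obtain N where N: "gen (insert s ker) \<subseteq> N" "is_ideal N" "ker \<subseteq> N" "1 \<notin> N"
      "\<And>B. is_ideal B \<Longrightarrow> 1 \<notin> B \<Longrightarrow> N \<subseteq> B \<Longrightarrow> B = N"
    proof -
      assume *: "gen (insert s ker) \<in> {A. is_ideal A \<and> ker \<subseteq> A \<and> 1 \<notin> A}"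
      let ?S = "{A. is_ideal A \<and> 1 \<notin> A \<and> gen (insert s ker) \<subseteq> A}"
      have S0: "gen (insert s ker) \<in> ?S" using * by simp
      have "\<And>A. A \<in> ?S \<Longrightarrow> is_ideal A \<and> ker \<subseteq> A" using gen_insert_superset[of ker s] by blast
      from acc_above_maximal[OF acc S0 this]
      obtain N where "N \<in> ?S" "\<forall>B\<in>?S. N \<subseteq> B \<longrightarrow> B = N" by blast
      then show thesis using that[of N] gen_insert_superset[of ker s] by blast
    qed
    have "maximalideal (\<phi> ` N) R"
    proof (rule maximalidealI[OF image_ideal[OF N(2)]])
      show "carrier R \<noteq> \<phi> ` N" using vimage_image[OF N(2,3)] vimage_carrier N(4) by auto
      fix J assume J: "ideal J R" "\<phi> ` N \<subseteq> J" "J \<subseteq> carrier R"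
      have NJ: "N \<subseteq> \<phi> -` J" using J(2) by auto
      show "J = \<phi> ` N \<or> J = carrier R"
      proof (cases "1 \<in> \<phi> -` J")
        case True
        then have "\<phi> -` J = \<phi> -` carrier R"
          using ideal_eq_UNIV[OF vimage_ideal(1)[OF J(1)]] vimage_carrier by simp
        then show ?thesis using vimage_inject[OF J(3) order.refl] by blast
      next
        case False
        then have "\<phi> -` J = N" using N(5)[OF vimage_ideal(1)[OF J(1)] _ NJ] by blast
        then show ?thesis using image_vimage[OF J(3)] by simp
      qed
    qed
    then have "\<phi> ` N = m" by (rule uniq)
    then show False using s N(1) gen_insert_mem[of s ker] by auto
  qed
  then show ?thesis using gen_insert_iff[OF ker_ideal] by blast
qed

lemma krull_dim_chain:
  assumes "krull_dim R \<le> enat d" and P: "\<And>i. i \<le> n \<Longrightarrow> prime_ideal (P i) \<and> ker \<subseteq> P i"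
    "\<And>i. i < n \<Longrightarrow> P i \<subset> P (Suc i)"
  shows "n \<le> d"
proof -
  have vi: "\<phi> -` (\<phi> ` P i) = P i" if "i \<le> n" for i
    using vimage_image P(1)[OF that] prime_idealD(1) by blast
  have "primeideal (\<phi> ` P i) R" if "i \<le> n" for i
    using primeideal_iff[of "\<phi> ` P i"] P(1)[OF that] vi[OF that] closed by auto
  moreover have "\<phi> ` P i \<subset> \<phi> ` P (Suc i)" if "i < n" for i
    using P(2)[OF that] vi[of i] vi[of "Suc i"] that by (metis image_mono less_imp_le_nat psubset_eq Suc_leI)
  ultimately have "enat n \<in> {enat n | n. \<exists>P. (\<forall>i \<le> n. primeideal (P i) R) \<and> (\<forall>i < n. P i \<subset> P (Suc i))}"
    by (intro CollectI exI[of _ n] conjI refl exI[of _ "\<lambda>i. \<phi> ` P i"]) auto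
  then have "enat n \<le> krull_dim R" unfolding krull_dim_def by (rule Sup_upper)
  then show ?thesis using assms(1) by (metis enat_ord_simps(1) order.trans)
qed

lemma krull_dim_attained:
  assumes dim: "krull_dim R = enat d" and P0: "primeideal P0 R"
  obtains P where "\<And>i. i \<le> d \<Longrightarrow> prime_ideal (P i) \<and> ker \<subseteq> P i" "\<And>i. i < d \<Longrightarrow> P i \<subset> P (Suc i)"
proof -
  let ?S = "{enat n | n. \<exists>P. (\<forall>i \<le> n. primeideal (P i) R) \<and> (\<forall>i < n. P i \<subset> P (Suc i))}"
  \<comment> \<open>The prime \<open>P0\<close> makes the set nonempty; the supremum of the empty
    set is \<open>0\<close> too, but is not attained.\<close>
  have "enat 0 \<in> ?S" using P0 by auto
  then have ne: "?S \<noteq> {}" by blast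
  have "Sup ?S = enat d" using dim by (simp add: krull_dim_def)
  then have fin: "finite ?S" and Max: "Max ?S = enat d"
    using ne unfolding Sup_enat_def by (auto split: if_splits)
  have "enat d \<in> ?S" using Max_in[OF fin ne] unfolding Max .
  then obtain P where P: "\<And>i. i \<le> d \<Longrightarrow> primeideal (P i) R" "\<And>i. i < d \<Longrightarrow> P i \<subset> P (Suc i)" by auto
  have I: "ideal (P i) R" if "i \<le> d" for i using P(1)[OF that] by (simp add: primeideal_def)
  have "prime_ideal (\<phi> -` P i) \<and> ker \<subseteq> \<phi> -` P i" if "i \<le> d" for i
    using primeideal_iff[OF ideal_carr[OF I]] P(1) vimage_ideal(2)[OF I] that by blast
  moreover have "\<phi> -` P i \<subset> \<phi> -` P (Suc i)" if "i < d" for i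
    using P(2)[OF that] vimage_inject[OF ideal_carr[OF I] ideal_carr[OF I], of i "Suc i"] that by auto
  ultimately show ?thesis using that[of "\<lambda>i. \<phi> -` P i"] by blast
qed

lemma regular_local_factorial:
  assumes reg: "regular_local_ring R m" and dim: "krull_dim R \<le> 3"
  shows "factorial_dim3 ker (\<phi> -` m)"
proof -
  have loc: "local_ring R m" using reg by (simp add: regular_local_ring_def)
  then have acc: "acc_above ker" and max: "maximalideal m R"
    using acc_ker by (auto simp: local_ring_def)
  have m: "ideal m R" using max by (simp add: maximalideal_def)
  have pm: "primeideal m R" by (rule maximalideal_prime[OF max])
  have M: "prime_ideal (\<phi> -` m)" using pm primeideal_iff[OF ideal_carr[OF m]] by blast
  note inv = local_inverse[OF loc]
  obtain xs where xs: "set xs \<subseteq> carrier R" "enat (length xs) = krull_dim R" "m = Idl (set xs)"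
    using reg by (auto simp: regular_local_ring_def)
  define d where "d = length xs"
  have "enat (length xs) \<le> enat 3" using xs(2) dim by (metis numeral_eq_enat)
  then have "length xs \<le> 3" by simp
  then have d: "krull_dim R = enat d" "d \<le> 3" using xs(2) by (simp_all add: d_def)
  have "set xs \<subseteq> range \<phi>" using xs(1) surj unfolding image_def by blast
  then obtain zs where zs: "xs = map \<phi> zs" by (metis ex_map_conv rangeE subsetD)
  have lz: "length zs = d" by (simp add: d_def zs)
  have "Idl ({\<zero>} \<union> \<phi> ` set zs) = Idl (set xs)"
  proof
    have sx: "set xs \<subseteq> Idl (set xs)" by (rule genideal_self[OF xs(1)])
    interpret I: ideal "Idl (set xs)" R by (rule genideal_ideal[OF xs(1)])
    show "Idl ({\<zero>} \<union> \<phi> ` set zs) \<subseteq> Idl (set xs)"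
      using sx I.zero_closed by (intro genideal_minimal I.is_ideal) (auto simp: zs)
    have c: "{\<zero>} \<union> \<phi> ` set zs \<subseteq> carrier R" using closed by auto
    show "Idl (set xs) \<subseteq> Idl ({\<zero>} \<union> \<phi> ` set zs)"
      using genideal_self[OF c] by (intro genideal_minimal genideal_ideal c) (auto simp: zs)
  qed
  then have Mgen: "\<phi> -` m = gen (ker \<union> set zs)"
    using vimage_genideal[OF zeroideal, of "set zs"] xs(3) by (simp add: ker_def)
  have proper: "A \<subseteq> \<phi> -` m" if A: "is_ideal A" "ker \<subseteq> A" "1 \<notin> A" for A
  proof (rule ccontr)
    assume "\<not> A \<subseteq> \<phi> -` m"
    then obtain s where s: "s \<in> A" "s \<notin> \<phi> -` m" by blast
    then obtain u where "1 - u * s \<in> ker" using inv by blast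
    then have "(1 - u * s) + u * s \<in> A" using A(2) s(1) by (intro ideal_add[OF A(1)] ideal_mult_left[OF A(1)]) auto
    then show False using A(3) by simp
  qed
  obtain P where P: "\<And>i. i \<le> d \<Longrightarrow> prime_ideal (P i) \<and> ker \<subseteq> P i" "\<And>i. i < d \<Longrightarrow> P i \<subset> P (Suc i)"
    using krull_dim_attained[OF d(1) pm] by metis
  \<comment> \<open>A chain of maximal length ends in \<open>m\<close>, which could otherwise be
    appended. By \<open>regular_local_primes\<close> it then starts in \<open>ker\<close>, so the
    ring is a domain.\<close>
  have top: "P d = \<phi> -` m"
  proof (rule ccontr)
    assume ne: "P d \<noteq> \<phi> -` m"
    have "P d \<subseteq> \<phi> -` m" using P(1)[of d] by (intro proper) (auto simp: prime_idealD)
    define Q where "Q i = (if i \<le> d then P i else \<phi> -` m)" for i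
    have "Suc d \<le> d"
    proof (rule krull_dim_chain[of d "Suc d" Q])
      show "krull_dim R \<le> enat d" using d(1) by simp
      show "prime_ideal (Q i) \<and> ker \<subseteq> Q i" if "i \<le> Suc d" for i
        using P(1)[of i] M vimage_ideal(2)[OF m] by (auto simp: Q_def)
      show "Q i \<subset> Q (Suc i)" if "i < Suc d" for i
        using that P(2)[of i] ne \<open>P d \<subseteq> \<phi> -` m\<close> by (auto simp: Q_def less_Suc_eq)
    qed
    then show False by simp
  qed
  have "ker = P 0 \<and> (\<exists>ys. length ys = length zs \<and> \<phi> -` m = gen (ker \<union> set ys)
     \<and> (\<forall>i\<le>length ys. prime_ideal (gen (ker \<union> set (take i ys))))
     \<and> (\<forall>i<length ys. ys ! i \<notin> gen (ker \<union> set (take i ys))))"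
  proof (rule regular_local_primes[OF acc _ ker_ideal order.refl])
    show "\<exists>u. 1 - u * s \<in> ker" if "s \<notin> \<phi> -` m" for s using inv[OF that] .
  qed (use P lz top Mgen in auto)
  then obtain ys where K: "ker = P 0" and ys: "length ys = d" "\<phi> -` m = gen (ker \<union> set ys)"
    "\<And>i. i \<le> length ys \<Longrightarrow> prime_ideal (gen (ker \<union> set (take i ys)))"
    "\<And>i. i < length ys \<Longrightarrow> ys ! i \<notin> gen (ker \<union> set (take i ys))"
    using lz by auto
  have prK: "prime_ideal ker" using K P(1)[of 0] by simp
  show ?thesis
  proof
    show "acc_above ker" "prime_ideal ker" "prime_ideal (\<phi> -` m)" "ker \<subseteq> \<phi> -` m"
      using acc prK M vimage_ideal(2)[OF m] by auto
    show "\<exists>c. quot (gen (insert a ker)) b = gen (insert c ker)" for a b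
    proof (rule local_colon_principal[OF acc prK M inv])
      show "length ys \<le> 3" using ys(1) d(2) by simp
    qed (use ys in auto)
    fix P Q N assume pr: "prime_ideal P" "prime_ideal Q" "prime_ideal N"
      "ker \<subset> P" "P \<subset> Q" "Q \<subset> N" "N \<subset> \<phi> -` m"
    define C where "C i = [ker, P, Q, N, \<phi> -` m] ! i" for i :: nat
    have "4 \<le> (3::nat)"
    proof (rule krull_dim_chain[of 3 4 C])
      show "krull_dim R \<le> enat 3" using dim by (simp add: numeral_eq_enat)
      show "prime_ideal (C i) \<and> ker \<subseteq> C i" if "i \<le> 4" for i
      proof -
        have "i = 0 \<or> i = 1 \<or> i = 2 \<or> i = 3 \<or> i = 4" using that by linarith
        moreover have "ker \<subseteq> P" "ker \<subseteq> Q" "ker \<subseteq> N" "ker \<subseteq> \<phi> -` m" using pr by blast+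
        ultimately show ?thesis using prK pr(1-3) M by (elim disjE) (simp_all add: C_def)
      qed
      show "C i \<subset> C (Suc i)" if "i < 4" for i
      proof -
        have "i = 0 \<or> i = 1 \<or> i = 2 \<or> i = 3" using that by linarith
        then show ?thesis using pr by (auto simp: C_def)
      qed
    qed
    then show False by simp
  qed
qed

end

theorem regular_local_astab_eq_dstab:
  assumes reg: "regular_local_ring R m" and dim: "krull_dim R \<le> 3" and I: "ideal I R"
  shows "astab R I = dstab R m I"
proof -
  have loc: "local_ring R m" using reg by (simp add: regular_local_ring_def)
  then interpret cring R by (simp add: local_ring_def)
  interpret ring_cover R cover_map by (rule ring_cover_cover_map)
  have m: "ideal m R" using loc by (simp add: local_ring_def maximalideal_def)
  show ?thesis
  proof (rule astab_eq_dstab, rule Ass_eq_iff_depth_eq[OF regular_local_factorial[OF reg dim] m I])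
    fix k x assume x: "x \<in> carrier R" "x \<notin> ideal_pow R I k"
    let ?J = "ideal_pow R I k"
    have J: "ideal ?J R" by (rule ideal_pow_ideal[OF I])
    obtain y where y: "x = cover_map y" using surj x(1) by blast
    show "colon R ?J x \<subseteq> m"
    proof
      fix r assume r: "r \<in> colon R ?J x"
      then obtain s where s: "r = cover_map s" using surj colon_carr by blast
      show "r \<in> m"
      proof (rule ccontr)
        assume "r \<notin> m"
        then obtain u where u: "1 - u * s \<in> ker" using local_inverse[OF loc, of s] s by auto
        let ?Q = "quot (cover_map -` ?J) y"
        note idJ = vimage_ideal[OF J]
        have "s \<in> ?Q" using r s y vimage_colon[of ?J y] by auto
        moreover have "1 - u * s \<in> ?Q" using u idJ(2) quot_superset[OF idJ(1)] by blast
        ultimately have "(1 - u * s) + u * s \<in> ?Q"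
          by (intro ideal_add ideal_mult_left quot_ideal idJ(1)) auto
        then show False using x(2) y by (simp add: quot_def)
      qed
    qed
  qed
qed

section \<open>Polynomial rings\<close>

text \<open>A copy of a field carrying the trivial Euclidean structure, so that the library
  recognises iterated polynomial rings over it as factorial.\<close>

datatype 'k fld = Fld (of_fld: 'k)

instantiation fld :: (field) field
begin
definition "0 = Fld 0"
definition "1 = Fld 1"
definition "x + y = Fld (of_fld x + of_fld y)"
definition "x - y = Fld (of_fld x - of_fld y)"
definition "- x = Fld (- of_fld x)"
definition "x * y = Fld (of_fld x * of_fld y)"
definition "inverse x = Fld (inverse (of_fld x))"
definition "x div y = Fld (of_fld x / of_fld y)"
instance
  by standard (auto simp: zero_fld_def one_fld_def plus_fld_def minus_fld_def uminus_fld_def times_fld_def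
      inverse_fld_def divide_fld_def field_simps fld.expand)
end

instantiation fld :: (field)
  "{unique_euclidean_ring, normalization_euclidean_semiring, normalization_semidom_multiplicative}"
begin
definition [simp]: "normalize_fld = (normalize_field :: 'a fld \<Rightarrow> _)"
definition [simp]: "unit_factor_fld = (unit_factor_field :: 'a fld \<Rightarrow> _)"
definition [simp]: "modulo_fld = (mod_field :: 'a fld \<Rightarrow> _)"
definition [simp]: "euclidean_size_fld = (euclidean_size_field :: 'a fld \<Rightarrow> _)"
definition [simp]: "division_segment (x :: 'a fld) = 1"
instance
  by standard (simp_all add: dvd_field_iff field_split_simps split: if_splits)
end

instantiation fld :: (field) euclidean_ring_gcd
begin
definition gcd_fld :: "'a fld \<Rightarrow> 'a fld \<Rightarrow> 'a fld" where "gcd_fld = Euclidean_Algorithm.gcd"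
definition lcm_fld :: "'a fld \<Rightarrow> 'a fld \<Rightarrow> 'a fld" where "lcm_fld = Euclidean_Algorithm.lcm"
definition Gcd_fld :: "'a fld set \<Rightarrow> 'a fld" where "Gcd_fld = Euclidean_Algorithm.Gcd"
definition Lcm_fld :: "'a fld set \<Rightarrow> 'a fld" where "Lcm_fld = Euclidean_Algorithm.Lcm"
instance by standard (simp_all add: gcd_fld_def lcm_fld_def Gcd_fld_def Lcm_fld_def)
end

instance fld :: (field) field_gcd ..

text \<open>The witness is \<open>a / gcd a b\<close>; if the gcd vanishes, so do \<open>a\<close>
  and \<open>b\<close>, and \<open>1\<close> serves.\<close>

lemma gcd_colon:
  fixes a b :: "'a::factorial_ring_gcd"
  shows "\<exists>c. \<forall>r. a dvd r * b \<longleftrightarrow> c dvd r"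
proof (cases "gcd a b = 0")
  case True
  then show ?thesis by (intro exI[of _ 1]) simp
next
  case False
  obtain a' b' where ab: "a = a' * gcd a b" "b = b' * gcd a b" "coprime a' b'"
    using gcd_coprime_exists[OF False] by blast
  have "a dvd r * b \<longleftrightarrow> a' dvd r" for r
  proof -
    have "a dvd r * b \<longleftrightarrow> a' * gcd a b dvd (r * b') * gcd a b"
      using ab(1,2) by (metis mult.assoc)
    also have "\<dots> \<longleftrightarrow> a' dvd r * b'" by (rule dvd_times_right_cancel_iff[OF False])
    also have "\<dots> \<longleftrightarrow> a' dvd r" using ab(3) by (simp add: coprime_dvd_mult_left_iff)
    finally show ?thesis .
  qed
  then show ?thesis by blast
qed

section \<open>Hilbert's basis theorem\<close>

lemma acc_aboveI:
  assumes "\<And>F. (\<And>n::nat. is_ideal (F n) \<and> K \<subseteq> F n \<and> F n \<subseteq> F (Suc n)) \<Longrightarrow> \<exists>n. F (Suc n) = F n"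
  shows "acc_above K"
  unfolding acc_above_def
proof (intro allI impI, rule ccontr)
  fix C :: "'a set set" assume C: "C \<noteq> {} \<and> (\<forall>A\<in>C. is_ideal A \<and> K \<subseteq> A)"
    and no: "\<not> (\<exists>A\<in>C. \<forall>B\<in>C. A \<subseteq> B \<longrightarrow> B = A)"
  have step: "\<exists>B. B \<in> C \<and> A \<subset> B" if "A \<in> C" for A using no that by blast
  have "\<exists>F. \<forall>n::nat. F n \<in> C \<and> F n \<subset> F (Suc n)"
    by (rule dependent_nat_choice) (use C step in blast)+
  then obtain F where F: "\<And>n. F n \<in> C" "\<And>n. F n \<subset> F (Suc n)" by metis
  have "\<exists>n. F (Suc n) = F n" by (rule assms) (use C F in blast)
  then show False using F(2) by blast
qed

lemma acc_above_stable:
  assumes acc: "acc_above K" and F: "\<And>n. is_ideal (F n)" "\<And>n. K \<subseteq> F n" "\<And>n::nat. F n \<subseteq> F (Suc n)"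
  shows "\<exists>N. \<forall>n\<ge>N. F n = F N"
proof -
  have "F 0 \<in> range F" "\<And>A. A \<in> range F \<Longrightarrow> is_ideal A \<and> K \<subseteq> A" using F by auto
  from acc_above_maximal[OF acc this]
  obtain N where N: "\<forall>B\<in>range F. F N \<subseteq> B \<longrightarrow> B = F N" by blast
  have "N \<le> n \<Longrightarrow> F N \<subseteq> F n" for n by (rule lift_Suc_mono_le) (rule F(3))
  then show ?thesis using N by blast
qed

definition top_coeffs :: "'a::comm_ring_1 poly set \<Rightarrow> nat \<Rightarrow> 'a set" where
  "top_coeffs I n = {Polynomial.coeff p n | p. p \<in> I \<and> Polynomial.degree p \<le> n}"

lemma top_coeffs_ideal: assumes I: "is_ideal I" shows "is_ideal (top_coeffs I n)"
proof (rule idl.subspaceI)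
  show "0 \<in> top_coeffs I n" using ideal_zero[OF I] unfolding top_coeffs_def by (force intro!: exI[of _ 0])
next
  fix x y assume "x \<in> top_coeffs I n" "y \<in> top_coeffs I n"
  then obtain p q where "p \<in> I" "q \<in> I" "Polynomial.degree p \<le> n" "Polynomial.degree q \<le> n"
    "x = Polynomial.coeff p n" "y = Polynomial.coeff q n" by (auto simp: top_coeffs_def)
  then show "x + y \<in> top_coeffs I n"
    unfolding top_coeffs_def using ideal_add[OF I] degree_add_le by (intro CollectI exI[of _ "p + q"]) auto
next
  fix c x assume "x \<in> top_coeffs I n"
  then obtain p where p: "p \<in> I" "Polynomial.degree p \<le> n" "x = Polynomial.coeff p n" by (auto simp: top_coeffs_def)
  have "[:c:] * p \<in> I" using ideal_mult_left[OF I p(1)] .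
  moreover have "Polynomial.degree ([:c:] * p) \<le> n" using p(2) degree_smult_le[of c p] by simp
  ultimately show "c * x \<in> top_coeffs I n"
    unfolding top_coeffs_def using p(3) by (intro CollectI exI[of _ "[:c:] * p"]) auto
qed

lemma top_coeffs_mono: "I \<subseteq> J \<Longrightarrow> top_coeffs I n \<subseteq> top_coeffs J n"
  by (auto simp: top_coeffs_def)

lemma top_coeffs_Suc: assumes I: "is_ideal I" shows "top_coeffs I n \<subseteq> top_coeffs I (Suc n)"
proof
  fix x assume "x \<in> top_coeffs I n"
  then obtain p where p: "p \<in> I" "Polynomial.degree p \<le> n" "x = Polynomial.coeff p n" by (auto simp: top_coeffs_def)
  have "[:0, 1:] * p \<in> I" using ideal_mult_left[OF I p(1)] .
  then have "pCons 0 p \<in> I" by simp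
  moreover have "Polynomial.degree (pCons 0 p) \<le> Suc n" using p(2) by (simp add: degree_pCons_le order.trans)
  ultimately show "x \<in> top_coeffs I (Suc n)"
    unfolding top_coeffs_def using p(3) by (intro CollectI exI[of _ "pCons 0 p"]) auto
qed

text \<open>The leading term of an element of \<open>J\<close> is cancelled by an element of
  \<open>I\<close>, and the degree drops.\<close>

lemma top_coeffs_determine:
  assumes IJ: "is_ideal I" "is_ideal J" "I \<subseteq> J" and eq: "\<And>n. top_coeffs J n \<subseteq> top_coeffs I n"
  shows "J \<subseteq> I"
proof
  fix p assume "p \<in> J"
  then show "p \<in> I"
  proof (induction "Polynomial.degree p" arbitrary: p rule: less_induct)
    case less
    let ?n = "Polynomial.degree p"
    have "Polynomial.coeff p ?n \<in> top_coeffs J ?n" using less.prems by (auto simp: top_coeffs_def)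
    then have "Polynomial.coeff p ?n \<in> top_coeffs I ?n" using eq by blast
    then obtain q where q: "q \<in> I" "Polynomial.degree q \<le> ?n" "Polynomial.coeff p ?n = Polynomial.coeff q ?n"
      by (auto simp: top_coeffs_def)
    have pq: "p - q \<in> J" using ideal_diff[OF IJ(2) less.prems] q(1) IJ(3) by blast
    have "p - q \<in> I"
    proof (cases "p - q = 0")
      case True then show ?thesis using ideal_zero[OF IJ(1)] by simp
    next
      case False
      have le: "Polynomial.degree (p - q) \<le> ?n" using q(2) by (intro degree_diff_le) auto
      moreover have "Polynomial.degree (p - q) \<noteq> ?n"
      proof
        assume e: "Polynomial.degree (p - q) = ?n"
        have "Polynomial.coeff (p - q) ?n = 0" using q(3) by simp
        then show False using False e by (metis leading_coeff_0_iff)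
      qed
      ultimately show ?thesis using less.hyps[of "p - q"] pq by simp
    qed
    then have "(p - q) + q \<in> I" using q(1) by (rule ideal_add[OF IJ(1)])
    then show ?case by simp
  qed
qed

text \<open>The ideals \<open>top_coeffs (F k) n\<close> increase in both indices. The diagonal
  becomes constant at some \<open>N\<close>, which settles all degrees from \<open>N\<close> on;
  each of the finitely many smaller degrees is settled separately.\<close>

theorem hilbert_basis:
  assumes acc: "acc_above ({0} :: 'a::comm_ring_1 set)"
  shows "acc_above ({0} :: 'a poly set)"
proof (rule acc_aboveI)
  fix F :: "nat \<Rightarrow> 'a poly set"
  assume F: "\<And>n. is_ideal (F n) \<and> {0} \<subseteq> F n \<and> F n \<subseteq> F (Suc n)"
  have "F n \<subseteq> F (Suc n)" for n using F by blast
  then have Fmono: "m \<le> n \<Longrightarrow> F m \<subseteq> F n" for m n by (rule lift_Suc_mono_le)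
  have id: "is_ideal (top_coeffs (F k) n)" for k n using F top_coeffs_ideal by blast
  have zero: "{0} \<subseteq> top_coeffs (F k) n" for k n using ideal_zero[OF id] by simp
  have mono1: "k \<le> k' \<Longrightarrow> top_coeffs (F k) n \<subseteq> top_coeffs (F k') n" for k k' n
    by (intro top_coeffs_mono Fmono)
  have "top_coeffs (F k) n \<subseteq> top_coeffs (F k) (Suc n)" for k n using F top_coeffs_Suc by blast
  then have mono2: "n \<le> n' \<Longrightarrow> top_coeffs (F k) n \<subseteq> top_coeffs (F k) n'" for k n n'
    by (rule lift_Suc_mono_le)
  have "\<exists>N. \<forall>n\<ge>N. top_coeffs (F n) n = top_coeffs (F N) N"
  proof (rule acc_above_stable[OF acc id zero])
    show "top_coeffs (F n) n \<subseteq> top_coeffs (F (Suc n)) (Suc n)" for n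
      using mono1[of n "Suc n" n] mono2[of n "Suc n" "Suc n"] by simp
  qed
  then obtain N where N: "\<And>n. n \<ge> N \<Longrightarrow> top_coeffs (F n) n = top_coeffs (F N) N" by blast
  have "\<exists>M. \<forall>k\<ge>M. top_coeffs (F k) n = top_coeffs (F M) n" for n
    by (rule acc_above_stable[OF acc id zero]) (intro mono1 le_SucI order.refl)
  then obtain M where M: "\<And>n k. k \<ge> M n \<Longrightarrow> top_coeffs (F k) n = top_coeffs (F (M n)) n" by metis
  define B where "B = Max (insert N (M ` {..<N}))"
  have B: "N \<le> B" "n < N \<Longrightarrow> M n \<le> B" for n by (auto simp: B_def)
  have "top_coeffs (F (Suc B)) n \<subseteq> top_coeffs (F B) n" for n
  proof (cases "n < N")
    case True
    then have "top_coeffs (F (Suc B)) n = top_coeffs (F B) n"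
      using M[of n "Suc B"] M[of n B] B(2)[OF True] by simp
    then show ?thesis by simp
  next
    case False
    let ?m = "max n (Suc B)"
    have "top_coeffs (F (Suc B)) n \<subseteq> top_coeffs (F ?m) ?m"
      using mono1[of "Suc B" ?m n] mono2[of n ?m ?m] by auto
    also have "\<dots> = top_coeffs (F N) N" using N[of ?m] B(1) by simp
    also have "\<dots> \<subseteq> top_coeffs (F B) n"
      using mono1[OF B(1), of N] mono2[of N n B] False by auto
    finally show ?thesis .
  qed
  then have "F (Suc B) \<subseteq> F B"
    using top_coeffs_determine[of "F B" "F (Suc B)"] F[of B] F[of "Suc B"] by blast
  then have "F (Suc B) = F B" using F[of B] by blast
  then show "\<exists>n. F (Suc n) = F n" by blast
qed

lemma acc_above_field: "acc_above ({0} :: 'a::field set)"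
proof (rule acc_aboveI)
  fix F :: "nat \<Rightarrow> 'a set"
  assume F: "\<And>n. is_ideal (F n) \<and> {0} \<subseteq> F n \<and> F n \<subseteq> F (Suc n)"
  have triv: "F n = {0} \<or> F n = UNIV" for n
  proof (cases "F n = {0}")
    case False
    then obtain x where x: "x \<in> F n" "x \<noteq> 0" using F[of n] by auto
    have id: "is_ideal (F n)" using F by blast
    have "inverse x * x \<in> F n" by (rule ideal_mult_left[OF id x(1)])
    then have "1 \<in> F n" using x(2) by simp
    then show ?thesis using ideal_eq_UNIV[OF id] by simp
  qed simp
  show "\<exists>n. F (Suc n) = F n"
  proof (cases "F 1 = F 0")
    case True then show ?thesis by (metis One_nat_def)
  next
    case False
    then have "F 1 = UNIV" using triv[of 0] triv[of 1] F[of 0] by auto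
    then have "F (Suc 1) = F 1" using F[of 1] by auto
    then show ?thesis by blast
  qed
qed

section \<open>Evaluation homomorphisms of polynomial rings\<close>

definition ring_hom_on :: "('a::comm_ring_1 \<Rightarrow> 'b::comm_ring_1) \<Rightarrow> bool" where
  "ring_hom_on h \<longleftrightarrow> h 1 = 1 \<and> (\<forall>x y. h (x + y) = h x + h y) \<and> (\<forall>x y. h (x * y) = h x * h y)"

lemma ring_hom_onD:
  assumes "ring_hom_on h"
  shows "h 1 = 1" "h (x + y) = h x + h y" "h (x * y) = h x * h y" "h 0 = 0"
  using assms by (auto simp: ring_hom_on_def) (metis add_cancel_right_right)

lemma ring_hom_on_sum: "ring_hom_on h \<Longrightarrow> h (sum f S) = (\<Sum>x\<in>S. h (f x))"
  by (induction S rule: infinite_finite_induct) (auto simp: ring_hom_onD)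

lemma ring_hom_on_prod: "ring_hom_on h \<Longrightarrow> h (prod f S) = (\<Prod>x\<in>S. h (f x))"
  by (induction S rule: infinite_finite_induct) (auto simp: ring_hom_onD)

lemma ring_hom_on_power: "ring_hom_on h \<Longrightarrow> h (x ^ n) = h x ^ n"
  by (induction n) (auto simp: ring_hom_onD)

lemma ring_hom_on_poly_eval:
  assumes h: "ring_hom_on h" shows "ring_hom_on (\<lambda>p. poly (map_poly h p) x)"
proof -
  note hd = ring_hom_onD[OF h]
  have c: "Polynomial.coeff (map_poly h p) n = h (Polynomial.coeff p n)" for p n
    by (rule coeff_map_poly) (rule hd(4))
  have "map_poly h (p + q) = map_poly h p + map_poly h q" for p q
    by (rule poly_eqI) (simp add: c hd)
  moreover have "map_poly h (p * q) = map_poly h p * map_poly h q" for p q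
    by (rule poly_eqI) (simp add: c hd coeff_mult ring_hom_on_sum[OF h])
  moreover have "map_poly h 1 = 1"
    by (rule poly_eqI) (simp add: c hd)
  ultimately show ?thesis by (simp add: ring_hom_on_def)
qed

lemma poly_map_poly_pCons:
  "ring_hom_on h \<Longrightarrow> poly (map_poly h (pCons a p)) x = h a + x * poly (map_poly h p) x"
  by (subst map_poly_pCons) (auto simp: ring_hom_onD)

lemma poly_map_poly_in:
  assumes h: "ring_hom_on h" and S: "0 \<in> S" "\<And>a b. a \<in> S \<Longrightarrow> b \<in> S \<Longrightarrow> a + b \<in> S \<and> a * b \<in> S"
    and "\<And>a. h a \<in> S" "x \<in> S"
  shows "poly (map_poly h p) x \<in> S"
  using assms by (induction p) (auto simp: poly_map_poly_pCons)

definition pm_eval :: "('k \<Rightarrow> 'b) \<Rightarrow> ('u \<Rightarrow> 'b) \<Rightarrow> ('u::comm_monoid_add \<Rightarrow>\<^sub>0 'k::comm_ring_1) \<Rightarrow> 'b::comm_ring_1" where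
  "pm_eval h \<mu> p = (\<Sum>u\<in>Poly_Mapping.keys p. h (Poly_Mapping.lookup p u) * \<mu> u)"

lemma pm_eval_superset:
  assumes "ring_hom_on h" "finite S" "Poly_Mapping.keys p \<subseteq> S"
  shows "pm_eval h \<mu> p = (\<Sum>u\<in>S. h (Poly_Mapping.lookup p u) * \<mu> u)"
  unfolding pm_eval_def
  by (rule sum.mono_neutral_left) (use assms in \<open>auto simp: in_keys_iff ring_hom_onD\<close>)

lemma pm_eval_single: "ring_hom_on h \<Longrightarrow> pm_eval h \<mu> (Poly_Mapping.single u c) = h c * \<mu> u"
  using pm_eval_superset[of h "{u}" "Poly_Mapping.single u c" \<mu>] by (auto split: if_splits)

lemma pm_eval_add:
  assumes h: "ring_hom_on h" shows "pm_eval h \<mu> (p + q) = pm_eval h \<mu> p + pm_eval h \<mu> q"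
proof -
  let ?S = "Poly_Mapping.keys p \<union> Poly_Mapping.keys q"
  show ?thesis
    using pm_eval_superset[OF h, of ?S "p + q" \<mu>] pm_eval_superset[OF h, of ?S p \<mu>]
      pm_eval_superset[OF h, of ?S q \<mu>] Poly_Mapping.keys_add[of p q]
    by (simp add: lookup_add ring_hom_onD[OF h] distrib_right sum.distrib)
qed

lemma ring_hom_on_pm_eval:
  assumes h: "ring_hom_on h" and \<mu>: "\<mu> 0 = 1" "\<And>u v. \<mu> (u + v) = \<mu> u * \<mu> v"
  shows "ring_hom_on (pm_eval h \<mu>)"
proof -
  have z: "pm_eval h \<mu> 0 = 0" by (simp add: pm_eval_def)
  have s: "pm_eval h \<mu> (Poly_Mapping.single u c * q) = pm_eval h \<mu> (Poly_Mapping.single u c) * pm_eval h \<mu> q" for u c q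
  proof (induction q rule: poly_mapping_additive_induct)
    case (add v d q)
    have "pm_eval h \<mu> (Poly_Mapping.single u c * Poly_Mapping.single v d)
        = pm_eval h \<mu> (Poly_Mapping.single u c) * pm_eval h \<mu> (Poly_Mapping.single v d)"
      by (simp add: mult_single pm_eval_single[OF h] ring_hom_onD[OF h] \<mu> mult_ac)
    then show ?case using add by (simp add: distrib_left pm_eval_add[OF h])
  qed (simp add: z)
  have "pm_eval h \<mu> (p * q) = pm_eval h \<mu> p * pm_eval h \<mu> q" for p q
    by (induction p rule: poly_mapping_additive_induct) (simp_all add: z s distrib_right pm_eval_add[OF h])
  moreover have "pm_eval h \<mu> 1 = 1"
    using pm_eval_single[OF h, of \<mu> 0 1] by (simp add: \<mu> ring_hom_onD[OF h])
  ultimately show ?thesis by (simp add: ring_hom_on_def pm_eval_add[OF h])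
qed

section \<open>The polynomial ring in \<open>n\<close> variables as a quotient of the threefold
  iterated one\<close>

definition const3 :: "'k::field \<Rightarrow> 'k fld poly poly poly" where
  "const3 c = [:[:[:Fld c:]:]:]"

definition var3 :: "nat \<Rightarrow> 'k::field fld poly poly poly" where
  "var3 i = (if i = 0 then [:[:[:0, 1:]:]:] else if i = 1 then [:[:0, 1:]:] else [:0, 1:])"

definition monom3 :: "(nat \<Rightarrow>\<^sub>0 nat) \<Rightarrow> 'k::field fld poly poly poly" where
  "monom3 u = (\<Prod>i<3. var3 i ^ Poly_Mapping.lookup u i)"

text \<open>Variables of index \<open>n\<close> or more become zero, so that one ring in three
  variables covers every \<open>n\<close> up to three.\<close>

definition mvar :: "nat \<Rightarrow> nat \<Rightarrow> 'k::field mpoly" where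
  "mvar n i = (if i < n then Poly_Mapping.single (Poly_Mapping.single i 1) 1 else 0)"

definition to_mpoly :: "nat \<Rightarrow> 'k::field fld poly poly poly \<Rightarrow> 'k mpoly" where
  "to_mpoly n = (\<lambda>p. poly (map_poly (\<lambda>p. poly (map_poly (\<lambda>p. poly (map_poly
     (\<lambda>c. Poly_Mapping.single 0 (of_fld c)) p) (mvar n 0)) p) (mvar n 1)) p) (mvar n 2))"

text \<open>For \<open>n\<close> up to three this is a section of \<open>to_mpoly n\<close> on the
  carrier. That it is a ring homomorphism allows divisibility to be decided in the iterated
  polynomial ring.\<close>

definition from_mpoly :: "'k::field mpoly \<Rightarrow> 'k fld poly poly poly" where
  "from_mpoly = pm_eval const3 monom3"

lemma ring_hom_const3: "ring_hom_on const3"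
  by (simp add: ring_hom_on_def const3_def one_fld_def[symmetric] plus_fld_def times_fld_def one_pCons)

lemma ring_hom_single_fld: "ring_hom_on (\<lambda>c. Poly_Mapping.single 0 (of_fld c) :: 'k::field mpoly)"
  by (simp add: ring_hom_on_def one_fld_def plus_fld_def times_fld_def single_add mult_single)

lemma ring_hom_to_mpoly: "ring_hom_on (to_mpoly n)"
  unfolding to_mpoly_def by (intro ring_hom_on_poly_eval ring_hom_single_fld)

lemma ring_hom_from_mpoly: "ring_hom_on from_mpoly"
  unfolding from_mpoly_def
  by (rule ring_hom_on_pm_eval[OF ring_hom_const3]) (simp_all add: monom3_def lookup_add power_add prod.distrib)

lemma to_mpoly_const3: "to_mpoly n (const3 c) = Poly_Mapping.single 0 c"
  by (simp add: to_mpoly_def const3_def poly_map_poly_pCons ring_hom_on_poly_eval ring_hom_single_fld)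

lemma to_mpoly_var3: "i < 3 \<Longrightarrow> to_mpoly n (var3 i) = mvar n i"
proof -
  assume "i < 3"
  then have "i = 0 \<or> i = 1 \<or> i = 2" by linarith
  then show ?thesis
    by (elim disjE) (simp_all add: to_mpoly_def var3_def poly_map_poly_pCons ring_hom_on_poly_eval
        ring_hom_single_fld zero_fld_def one_fld_def one_pCons)
qed

abbreviation mcarrier :: "nat \<Rightarrow> 'k::field mpoly set" where
  "mcarrier n \<equiv> carrier (mpoly_ring n)"

lemma mcarrier_iff: "p \<in> mcarrier n \<longleftrightarrow> (\<forall>u\<in>Poly_Mapping.keys p. Poly_Mapping.keys u \<subseteq> {..<n})"
  by (simp add: mpoly_ring_def)

lemma mcarrier_add: "p \<in> mcarrier n \<Longrightarrow> q \<in> mcarrier n \<Longrightarrow> p + q \<in> mcarrier n"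
  using Poly_Mapping.keys_add[of p q] unfolding mcarrier_iff by blast

lemma mcarrier_mult: "p \<in> mcarrier n \<Longrightarrow> q \<in> mcarrier n \<Longrightarrow> p * q \<in> mcarrier n"
  unfolding mcarrier_iff
proof
  fix w assume p: "\<forall>u\<in>Poly_Mapping.keys p. Poly_Mapping.keys u \<subseteq> {..<n}"
    and q: "\<forall>u\<in>Poly_Mapping.keys q. Poly_Mapping.keys u \<subseteq> {..<n}" and "w \<in> Poly_Mapping.keys (p * q)"
  then obtain u v where "w = u + v" "u \<in> Poly_Mapping.keys p" "v \<in> Poly_Mapping.keys q"
    using keys_mult[of p q] by blast
  then show "Poly_Mapping.keys w \<subseteq> {..<n}" using p q Poly_Mapping.keys_add[of u v] by blast
qed

lemma mcarrier_uminus: "p \<in> mcarrier n \<Longrightarrow> - p \<in> mcarrier n"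
  by (simp add: mcarrier_iff in_keys_iff)

lemma mcarrier_single: "Poly_Mapping.keys u \<subseteq> {..<n} \<Longrightarrow> Poly_Mapping.single u c \<in> mcarrier n"
  by (simp add: mcarrier_iff)

lemma mcarrier_0: "0 \<in> mcarrier n"
  by (simp add: mcarrier_iff)

lemma mcarrier_1: "1 \<in> mcarrier n"
  by (simp add: mcarrier_iff)

lemma mpoly_ring_simps:
  "x \<otimes>\<^bsub>mpoly_ring n\<^esub> y = x * y" "x \<oplus>\<^bsub>mpoly_ring n\<^esub> y = x + y"
  "\<one>\<^bsub>mpoly_ring n\<^esub> = 1" "\<zero>\<^bsub>mpoly_ring n\<^esub> = 0"
  by (simp_all add: mpoly_ring_def)

lemma cring_mpoly_ring: "cring (mpoly_ring n :: 'k::field mpoly ring)"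
proof (rule cringI)
  show "abelian_group (mpoly_ring n :: 'k mpoly ring)"
  proof (rule abelian_groupI)
    fix x :: "'k mpoly" assume x: "x \<in> mcarrier n"
    show "\<exists>y\<in>mcarrier n. y \<oplus>\<^bsub>mpoly_ring n\<^esub> x = \<zero>\<^bsub>mpoly_ring n\<^esub>"
      using mcarrier_uminus[OF x] by (intro bexI[of _ "- x"]) (simp_all add: mpoly_ring_simps)
  qed (simp_all add: mpoly_ring_simps mcarrier_add mcarrier_0 algebra_simps)
  show "Group.comm_monoid (mpoly_ring n :: 'k mpoly ring)"
    by (rule comm_monoidI) (simp_all add: mpoly_ring_simps mcarrier_mult mcarrier_1 algebra_simps)
qed (simp_all add: mpoly_ring_simps algebra_simps)

lemma mvar_carrier: "mvar n i \<in> mcarrier n"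
  by (simp add: mvar_def mcarrier_single mcarrier_0)

lemma to_mpoly_carrier: "to_mpoly n p \<in> mcarrier n"
  unfolding to_mpoly_def
  by (intro poly_map_poly_in ring_hom_on_poly_eval ring_hom_single_fld mcarrier_0 mvar_carrier
      mcarrier_single conjI mcarrier_add mcarrier_mult) simp_all

lemma sum_of_singles: "(\<Sum>u\<in>Poly_Mapping.keys p. Poly_Mapping.single u (Poly_Mapping.lookup p u)) = p"
  by (rule poly_mapping_eqI) (simp add: lookup_sum lookup_single when_def sum.delta' in_keys_iff)

lemma prod_single: "(\<Prod>i\<in>S. Poly_Mapping.single (f i) (1::'k::comm_ring_1)) = Poly_Mapping.single (\<Sum>i\<in>S. f i) 1"
  for f :: "'i \<Rightarrow> 'u::comm_monoid_add"
  by (induction S rule: infinite_finite_induct) (simp_all add: mult_single)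

lemma mvar_power:
  assumes "i < n \<or> k = 0" shows "mvar n i ^ k = Poly_Mapping.single (Poly_Mapping.single i k) 1"
proof (cases "i < n")
  case True
  then show ?thesis
    by (induction k) (simp_all add: mvar_def mult_single single_add[symmetric])
qed (use assms in simp)

lemma to_mpoly_monom3:
  assumes n: "n \<le> 3" and u: "Poly_Mapping.keys u \<subseteq> {..<n}"
  shows "to_mpoly n (monom3 u) = Poly_Mapping.single u 1"
proof -
  have small: "i < n \<or> Poly_Mapping.lookup u i = 0" for i
    using u by (metis in_keys_iff lessThan_iff subsetD)
  have "to_mpoly n (monom3 u) = (\<Prod>i<3. mvar n i ^ Poly_Mapping.lookup u i)"
    by (simp add: monom3_def ring_hom_on_prod[OF ring_hom_to_mpoly] ring_hom_on_power[OF ring_hom_to_mpoly]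
        to_mpoly_var3)
  also have "\<dots> = (\<Prod>i<3. Poly_Mapping.single (Poly_Mapping.single i (Poly_Mapping.lookup u i)) 1)"
    by (rule prod.cong) (simp_all add: mvar_power[OF small])
  also have "\<dots> = Poly_Mapping.single (\<Sum>i<3. Poly_Mapping.single i (Poly_Mapping.lookup u i)) 1"
    by (rule prod_single)
  also have "(\<Sum>i<3. Poly_Mapping.single i (Poly_Mapping.lookup u i)) = u"
  proof (rule poly_mapping_eqI)
    fix k
    have "Poly_Mapping.lookup u k = 0" if "\<not> k < 3" using small[of k] that n by linarith
    then show "Poly_Mapping.lookup (\<Sum>i<3. Poly_Mapping.single i (Poly_Mapping.lookup u i)) k = Poly_Mapping.lookup u k"
      by (cases "k < 3") (simp_all add: lookup_sum lookup_single when_def sum.delta')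
  qed
  finally show ?thesis .
qed

lemma to_from_mpoly:
  assumes n: "n \<le> 3" and p: "p \<in> mcarrier n" shows "to_mpoly n (from_mpoly p) = p"
proof -
  have "to_mpoly n (from_mpoly p) = (\<Sum>u\<in>Poly_Mapping.keys p. to_mpoly n (const3 (Poly_Mapping.lookup p u) * monom3 u))"
    by (simp add: from_mpoly_def pm_eval_def ring_hom_on_sum[OF ring_hom_to_mpoly])
  also have "\<dots> = (\<Sum>u\<in>Poly_Mapping.keys p. Poly_Mapping.single u (Poly_Mapping.lookup p u))"
    using p by (intro sum.cong refl)
      (simp add: ring_hom_onD[OF ring_hom_to_mpoly] to_mpoly_const3 to_mpoly_monom3[OF n] mcarrier_iff mult_single)
  finally show ?thesis by (simp add: sum_of_singles)
qed

lemma ring_cover_to_mpoly: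
  assumes n: "n \<le> 3" shows "ring_cover (mpoly_ring n) (to_mpoly n)"
proof (intro ring_cover.intro cring_mpoly_ring ring_cover_axioms.intro)
  fix r :: "'a mpoly" assume "r \<in> mcarrier n"
  then show "\<exists>x. r = to_mpoly n x" using to_from_mpoly[OF n] by metis
qed (simp_all add: to_mpoly_carrier mpoly_ring_simps ring_hom_onD[OF ring_hom_to_mpoly])

lemma ring_hom_constant_coeff: "ring_hom_on (\<lambda>p::'k::field mpoly. Poly_Mapping.lookup p 0)"
proof -
  have id: "ring_hom_on (\<lambda>c::'k. c)" by (simp add: ring_hom_on_def)
  have z: "u + v = 0 \<longleftrightarrow> u = 0 \<and> v = 0" for u v :: "nat \<Rightarrow>\<^sub>0 nat"
    by (auto simp: poly_mapping_eq_iff fun_eq_iff lookup_add)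
  have "ring_hom_on (pm_eval (\<lambda>c::'k. c) (\<lambda>u::nat \<Rightarrow>\<^sub>0 nat. if u = 0 then 1 else 0))"
    by (rule ring_hom_on_pm_eval[OF id]) (auto simp: z)
  moreover have "pm_eval (\<lambda>c::'k. c) (\<lambda>u::nat \<Rightarrow>\<^sub>0 nat. if u = 0 then 1 else 0) = (\<lambda>p. Poly_Mapping.lookup p 0)"
    by (rule ext) (simp add: pm_eval_def if_distrib[of "(*) _"] sum.delta' in_keys_iff cong: if_cong)
  ultimately show ?thesis by simp
qed

lemma vimage_prime_ideal:
  fixes h :: "'a::comm_ring_1 \<Rightarrow> 'b::idom"
  assumes h: "ring_hom_on h" shows "prime_ideal {x. h x = 0}"
  unfolding prime_ideal_def
  by (auto intro!: idl.subspaceI simp: ring_hom_onD[OF h])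

lemma ring_hom_on_comp: "ring_hom_on g \<Longrightarrow> ring_hom_on h \<Longrightarrow> ring_hom_on (\<lambda>x. g (h x))"
  by (simp add: ring_hom_on_def)

lemma vimage_graded_max:
  "to_mpoly n -` graded_max n = {t. Poly_Mapping.lookup (to_mpoly n t) 0 = 0}"
  by (auto simp: graded_max_def to_mpoly_carrier)

text \<open>Modulo the kernel, \<open>t\<close> equals its image under the section, and a
  nonconstant monomial is divisible by a variable. The number of generators will bound the length of
  chains of primes below.\<close>

lemma graded_max_generators:
  assumes n: "n \<le> 3"
  shows "to_mpoly n -` (graded_max n :: 'k::field mpoly set) = gen ({t. to_mpoly n t = 0} \<union> var3 ` {..<n})"
proof
  let ?G = "gen ({t. to_mpoly n t = (0 :: 'k mpoly)} \<union> var3 ` {..<n})"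
    and ?M = "to_mpoly n -` (graded_max n :: 'k mpoly set)"
  have "prime_ideal {t. Poly_Mapping.lookup (to_mpoly n t :: 'k mpoly) 0 = 0}"
    by (rule vimage_prime_ideal[OF ring_hom_on_comp[OF ring_hom_constant_coeff ring_hom_to_mpoly]])
  then have "is_ideal (?M)" unfolding vimage_graded_max by (rule prime_idealD(1))
  moreover have "var3 i \<in> ?M" if "i < n" for i
  proof -
    have "Poly_Mapping.single i (1::nat) \<noteq> 0" by (metis lookup_single_eq lookup_zero zero_neq_one)
    then show ?thesis
      using that n by (simp add: vimage_graded_max to_mpoly_var3 mvar_def lookup_single when_def)
  qed
  ultimately show "?G \<subseteq> ?M"
    by (intro idl.span_minimal) (auto simp: vimage_graded_max)
  show "?M \<subseteq> ?G"
  proof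
    fix t assume t: "t \<in> ?M"
    let ?p = "to_mpoly n t"
    have "from_mpoly ?p \<in> ?G"
      unfolding from_mpoly_def pm_eval_def
    proof (rule idl.subspace_sum[OF idl.subspace_span], rule ideal_mult_left[OF idl.subspace_span])
      fix u assume u: "u \<in> Poly_Mapping.keys ?p"
      then have "u \<noteq> 0" using t by (auto simp: vimage_graded_max in_keys_iff)
      then obtain i where i: "i \<in> Poly_Mapping.keys u"
        by (metis in_keys_iff lookup_zero poly_mapping_eqI)
      then have "i < n" using to_mpoly_carrier[of n t] u by (auto simp: mcarrier_iff)
      then have "var3 i \<in> ?G" by (intro idl.span_base) auto
      obtain k where k: "Poly_Mapping.lookup u i = Suc k"
        using i by (cases "Poly_Mapping.lookup u i") (auto simp: in_keys_iff)
      moreover have "(monom3 u :: 'k fld poly poly poly) = var3 i ^ Poly_Mapping.lookup u i * (\<Prod>j\<in>{..<3} - {i}. var3 j ^ Poly_Mapping.lookup u j)"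
        unfolding monom3_def using \<open>i < n\<close> n by (intro prod.remove) auto
      ultimately have "(monom3 u :: 'k fld poly poly poly) = var3 i * (var3 i ^ k * (\<Prod>j\<in>{..<3} - {i}. var3 j ^ Poly_Mapping.lookup u j))"
        by (simp add: mult.assoc)
      then show "monom3 u \<in> ?G" using ideal_mult_right[OF idl.subspace_span \<open>var3 i \<in> ?G\<close>] by simp
    qed
    moreover have "t - from_mpoly ?p \<in> ?G"
    proof -
      have "to_mpoly n (t - from_mpoly ?p) = 0"
      proof -
        have "to_mpoly n (t - from_mpoly ?p) + to_mpoly n (from_mpoly ?p) = ?p"
          using ring_hom_onD(2)[OF ring_hom_to_mpoly, of n "t - from_mpoly ?p" "from_mpoly ?p"] by simp
        then show ?thesis unfolding to_from_mpoly[OF n to_mpoly_carrier] by simp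
      qed
      then show ?thesis by (intro idl.span_base) auto
    qed
    ultimately have "(t - from_mpoly ?p) + from_mpoly ?p \<in> ?G" by (intro ideal_add[OF idl.subspace_span])
    then show "t \<in> ?G" by simp
  qed
qed

lemma mpoly_factorial:
  assumes n: "n \<le> 3"
  shows "factorial_dim3 {t. to_mpoly n t = (0 :: 'k::field mpoly)} (to_mpoly n -` graded_max n)"
proof
  let ?K = "{t. to_mpoly n t = (0 :: 'k mpoly)}" and ?M = "to_mpoly n -` (graded_max n :: 'k mpoly set)"
  note hom = ring_hom_onD[OF ring_hom_to_mpoly, of n]
  have "acc_above ({0} :: 'k fld poly poly poly set)"
    by (intro hilbert_basis acc_above_field)
  then show acc: "acc_above ?K" by (rule acc_above_mono) (simp add: hom)
  show K: "prime_ideal ?K" by (rule vimage_prime_ideal[OF ring_hom_to_mpoly])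
  show "prime_ideal ?M"
    unfolding vimage_graded_max
    by (rule vimage_prime_ideal[OF ring_hom_on_comp[OF ring_hom_constant_coeff ring_hom_to_mpoly]])
  show "?K \<subseteq> ?M" by (auto simp: vimage_graded_max)
  have idK: "is_ideal ?K" by (rule prime_idealD(1)[OF K])
  show "\<exists>c. quot (gen (insert a ?K)) b = gen (insert c ?K)" for a b
  proof -
    \<comment> \<open>The gcd is formed in three variables, for the representatives
      \<open>?\<rho> a\<close> and \<open>?\<rho> b\<close>. As \<open>?\<rho>\<close> is
      multiplicative and depends only on classes modulo \<open>?K\<close>, an equation modulo
      \<open>?K\<close> lifts to an exact one.\<close>
    let ?\<rho> = "\<lambda>t. from_mpoly (to_mpoly n t)"
    have \<rho>: "to_mpoly n (?\<rho> t) = to_mpoly n t" for t by (rule to_from_mpoly[OF n to_mpoly_carrier])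
    obtain c where c: "\<And>r. ?\<rho> a dvd r * ?\<rho> b \<longleftrightarrow> c dvd r" using gcd_colon by metis
    have diff: "x - y \<in> ?K \<longleftrightarrow> to_mpoly n x = to_mpoly n y" for x y
      using hom(2)[of "x - y" y] by auto
    have "r \<in> quot (gen (insert a ?K)) b \<longleftrightarrow> r \<in> gen (insert c ?K)" for r
    proof
      assume "r \<in> quot (gen (insert a ?K)) b"
      then obtain s where "r * b - s * a \<in> ?K" unfolding quot_def mem_Collect_eq gen_insert_iff[OF idK] by blast
      then have "to_mpoly n r * to_mpoly n b = to_mpoly n s * to_mpoly n a" unfolding diff hom(3) .
      then have "?\<rho> r * ?\<rho> b = ?\<rho> s * ?\<rho> a" using ring_hom_onD(3)[OF ring_hom_from_mpoly] by metis
      then have "c dvd ?\<rho> r" using c by (metis dvd_triv_right)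
      then obtain d where "?\<rho> r = d * c" by (metis dvdE mult.commute)
      then have "to_mpoly n r = to_mpoly n (d * c)" using \<rho> by metis
      then show "r \<in> gen (insert c ?K)" using diff gen_insert_iff[OF idK] by blast
    next
      assume "r \<in> gen (insert c ?K)"
      then obtain d where d: "to_mpoly n r = to_mpoly n (d * c)" using diff gen_insert_iff[OF idK] by blast
      have "?\<rho> a dvd (d * c) * ?\<rho> b" using c by simp
      then obtain s where "(d * c) * ?\<rho> b = s * ?\<rho> a" by (metis dvdE mult.commute)
      then have "to_mpoly n ((d * c) * ?\<rho> b) = to_mpoly n (s * ?\<rho> a)" by simp
      then have "to_mpoly n (r * b) = to_mpoly n (s * a)" using d by (simp only: hom(3) \<rho>)
      then have "r * b - s * a \<in> ?K" by (simp only: diff)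
      then have "r * b \<in> gen (insert a ?K)" using gen_insert_iff[OF idK] by blast
      then show "r \<in> quot (gen (insert a ?K)) b" by (simp add: quot_def)
    qed
    then show ?thesis by blast
  qed
  fix P Q N assume pr: "prime_ideal P" "prime_ideal Q" "prime_ideal N"
    "?K \<subset> P" "P \<subset> Q" "Q \<subset> N" "N \<subset> ?M"
  define C where "C i = [?K, P, Q, N, ?M] ! i" for i :: nat
  \<comment> \<open>Together with \<open>?K\<close> and \<open>?M\<close> the chain has four strict
    inclusions, while \<open>?M\<close> has only \<open>n\<close> generators over
    \<open>?K\<close>.\<close>
  have "4 \<le> length (map var3 [0..<n] :: 'k fld poly poly poly list)"
  proof (rule chain_length_bound[OF acc, of C])
    show "?K \<subseteq> C 0" by (simp add: C_def)
    show "prime_ideal (C i)" if "i \<le> 4" for i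
    proof -
      have "i = 0 \<or> i = 1 \<or> i = 2 \<or> i = 3 \<or> i = 4" using that by linarith
      then show ?thesis using K pr(1-3) \<open>prime_ideal ?M\<close> by (elim disjE) (simp_all add: C_def)
    qed
    show "C i \<subset> C (Suc i)" if "i < 4" for i
    proof -
      have "i = 0 \<or> i = 1 \<or> i = 2 \<or> i = 3" using that by linarith
      then show ?thesis using pr(4-7) by (elim disjE) (simp_all add: C_def numeral_3_eq_3 numeral_2_eq_2)
    qed
    show "C 4 = gen (C 0 \<union> set (map var3 [0..<n]))"
      using graded_max_generators[OF n] by (simp add: C_def atLeast0LessThan)
  qed
  then show False using n by simp
qed

section \<open>Homogeneous components and graded ideals\<close>

lemma mon_deg_superset: "finite S \<Longrightarrow> Poly_Mapping.keys u \<subseteq> S \<Longrightarrow> mon_deg u = (\<Sum>i\<in>S. Poly_Mapping.lookup u i)"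
  unfolding mon_deg_def by (rule sum.mono_neutral_left) (auto simp: in_keys_iff)

lemma mon_deg_add: "mon_deg (u + v) = mon_deg u + mon_deg v"
  using mon_deg_superset[of "Poly_Mapping.keys u \<union> Poly_Mapping.keys v" "u + v"]
    mon_deg_superset[of "Poly_Mapping.keys u \<union> Poly_Mapping.keys v" u]
    mon_deg_superset[of "Poly_Mapping.keys u \<union> Poly_Mapping.keys v" v] Poly_Mapping.keys_add[of u v]
  by (simp add: lookup_add sum.distrib)

lemma mon_deg_eq_0: "mon_deg u = 0 \<longleftrightarrow> u = 0"
  by (auto simp: mon_deg_def in_keys_iff) (metis finite_keys in_keys_iff keys_eq_empty equals0I)

lemma lookup_hom_comp: "Poly_Mapping.lookup (hom_comp d p) u = (if mon_deg u = d then Poly_Mapping.lookup p u else 0)"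
  by (simp add: hom_comp_def lookup_mapp when_def in_keys_iff)

lemma hom_comp_add: "hom_comp d (p + q) = hom_comp d p + hom_comp d q"
  by (rule poly_mapping_eqI) (simp add: lookup_hom_comp lookup_add)

lemma hom_comp_0: "hom_comp d 0 = 0"
  by (rule poly_mapping_eqI) (simp add: lookup_hom_comp)

lemma hom_comp_single: "hom_comp d (Poly_Mapping.single u c) = (if mon_deg u = d then Poly_Mapping.single u c else 0)"
  by (rule poly_mapping_eqI) (auto simp: lookup_hom_comp lookup_single when_def)

lemma hom_comp_mult: "hom_comp d (p * q) = (\<Sum>i\<le>d. hom_comp i p * hom_comp (d - i) q)"
proof (induction p rule: poly_mapping_additive_induct)
  case zero
  then show ?case by (simp add: hom_comp_0)
next
  case (add u c p)
  have s: "hom_comp d (Poly_Mapping.single u c * q)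
      = (\<Sum>i\<le>d. hom_comp i (Poly_Mapping.single u c) * hom_comp (d - i) q)"
  proof (induction q rule: poly_mapping_additive_induct)
    case zero
    then show ?case by (simp add: hom_comp_0)
  next
    case (add v e q)
    have "(\<Sum>i\<le>d. hom_comp i (Poly_Mapping.single u c) * hom_comp (d - i) (Poly_Mapping.single v e))
        = (\<Sum>i\<le>d. if i = mon_deg u then (if mon_deg v = d - mon_deg u then Poly_Mapping.single u c * Poly_Mapping.single v e else 0) else 0)"
      by (rule sum.cong) (auto simp: hom_comp_single)
    also have "\<dots> = hom_comp d (Poly_Mapping.single u c * Poly_Mapping.single v e)"
      by (auto simp: sum.delta' mult_single hom_comp_single mon_deg_add)
    finally show ?case using add by (simp add: distrib_left hom_comp_add sum.distrib)
  qed
  show ?case using add s by (simp add: distrib_right hom_comp_add sum.distrib)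
qed

lemma sum_hom_comp: "(\<Sum>d\<in>mon_deg ` Poly_Mapping.keys p. hom_comp d p) = p"
  by (rule poly_mapping_eqI) (auto simp: lookup_sum lookup_hom_comp sum.delta in_keys_iff)

lemma hom_comp_carrier: "p \<in> mcarrier n \<Longrightarrow> hom_comp d p \<in> mcarrier n"
  by (auto simp: mcarrier_iff in_keys_iff lookup_hom_comp split: if_splits)

lemma mpoly_ideal_add: "ideal A (mpoly_ring n) \<Longrightarrow> p \<in> A \<Longrightarrow> q \<in> A \<Longrightarrow> p + q \<in> A"
  using additive_subgroup.a_closed[OF ideal.axioms(1)] by (metis mpoly_ring_simps(2))

lemma mpoly_ideal_mult: "ideal A (mpoly_ring n) \<Longrightarrow> p \<in> A \<Longrightarrow> q \<in> mcarrier n \<Longrightarrow> q * p \<in> A"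
  using ideal.I_l_closed by (metis mpoly_ring_simps(1))

lemma mpoly_ideal_0: "ideal A (mpoly_ring n) \<Longrightarrow> 0 \<in> A"
  using additive_subgroup.zero_closed[OF ideal.axioms(1)] by (metis mpoly_ring_simps(4))

lemma mpoly_ideal_sum: "ideal A (mpoly_ring n) \<Longrightarrow> (\<And>i. i \<in> S \<Longrightarrow> f i \<in> A) \<Longrightarrow> sum f S \<in> A"
  by (induction S rule: infinite_finite_induct) (auto intro: mpoly_ideal_0 mpoly_ideal_add)

lemma graded_ideal_pow:
  assumes n: "n \<le> 3" and I: "graded_ideal n I"
  shows "graded_ideal n (ideal_pow (mpoly_ring n) I k)"
proof (induction k)
  case 0
  have "ideal (mcarrier n) (mpoly_ring n)" by (rule ring.oneideal[OF cring.axioms(1)[OF cring_mpoly_ring]])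
  then show ?case by (simp add: graded_ideal_def hom_comp_carrier)
next
  case (Suc k)
  let ?J = "ideal_pow (mpoly_ring n) I k" and ?P = "ideal_pow (mpoly_ring n) I (Suc k)"
  have J: "ideal ?J (mpoly_ring n)" and hJ: "\<And>p d. p \<in> ?J \<Longrightarrow> hom_comp d p \<in> ?J"
    using Suc by (auto simp: graded_ideal_def)
  have iI: "ideal I (mpoly_ring n)" and hI: "\<And>p d. p \<in> I \<Longrightarrow> hom_comp d p \<in> I"
    using I by (auto simp: graded_ideal_def)
  have P: "ideal ?P (mpoly_ring n)"
    using ring.ideal_prod_is_ideal[OF cring.axioms(1)[OF cring_mpoly_ring] J iI] by simp
  have "\<forall>d. hom_comp d p \<in> ?P" if "p \<in> ideal_prod (mpoly_ring n) ?J I" for p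
    using that
  proof (induction p rule: ideal_prod.induct)
    case (prod a b)
    have "hom_comp i a * hom_comp j b \<in> ?P" for i j
      using ideal_prod.prod[OF hJ[OF prod(1), of i] hI[OF prod(2), of j], of "mpoly_ring n"]
      by (simp add: mpoly_ring_simps)
    then show ?case by (simp only: mpoly_ring_simps hom_comp_mult) (intro allI mpoly_ideal_sum[OF P])
  next
    case (sum p q)
    then show ?case using mpoly_ideal_add[OF P] by (simp only: mpoly_ring_simps hom_comp_add) blast
  qed
  then show ?case using P by (simp add: graded_ideal_def)
qed

text \<open>If \<open>p x \<in> A\<close> but \<open>x \<notin> A\<close>, compare the lowest homogeneous component of \<open>x\<close> outside \<open>A\<close>
  with the constant term of \<open>p\<close>.\<close>

lemma graded_colon_subset:
  assumes A: "graded_ideal n A" and x: "x \<in> mcarrier n" "x \<notin> A"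
  shows "colon (mpoly_ring n) A x \<subseteq> graded_max n"
proof
  have id: "ideal A (mpoly_ring n)" and hA: "\<And>p d. p \<in> A \<Longrightarrow> hom_comp d p \<in> A"
    using A by (auto simp: graded_ideal_def)
  fix p assume "p \<in> colon (mpoly_ring n) A x"
  then have p: "p \<in> mcarrier n" "p * x \<in> A" by (auto simp: colon_def mpoly_ring_simps)
  have "\<exists>d. hom_comp d x \<notin> A" using mpoly_ideal_sum[OF id, of "mon_deg ` Poly_Mapping.keys x" "\<lambda>d. hom_comp d x"]
      sum_hom_comp[of x] x(2) by metis
  then obtain d where d: "hom_comp d x \<notin> A" "\<And>e. e < d \<Longrightarrow> hom_comp e x \<in> A"
    using exists_least_iff[of "\<lambda>d. hom_comp d x \<notin> A"] by blast
  let ?c = "Poly_Mapping.lookup p 0"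
  have "Poly_Mapping.lookup p 0 = 0"
  proof (rule ccontr)
    assume c: "?c \<noteq> 0"
    have c0: "hom_comp 0 p = Poly_Mapping.single 0 ?c"
      by (rule poly_mapping_eqI) (auto simp: lookup_hom_comp mon_deg_eq_0 lookup_single when_def)
    \<comment> \<open>Apart from the term with \<open>hom_comp 0 p\<close>, only components of
      \<open>x\<close> below degree \<open>d\<close> occur, and these lie in
      \<open>A\<close>.\<close>
    have "hom_comp d (p * x) = hom_comp 0 p * hom_comp d x + (\<Sum>i\<in>{..d} - {0}. hom_comp i p * hom_comp (d - i) x)"
      unfolding hom_comp_mult by (subst sum.remove[of _ 0]) auto
    moreover have S: "(\<Sum>i\<in>{..d} - {0}. hom_comp i p * hom_comp (d - i) x) \<in> A"
      using d(2) by (intro mpoly_ideal_sum[OF id] mpoly_ideal_mult[OF id] hom_comp_carrier p(1)) auto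
    have "(-1) * (\<Sum>i\<in>{..d} - {0}. hom_comp i p * hom_comp (d - i) x) \<in> A"
      by (rule mpoly_ideal_mult[OF id S mcarrier_uminus[OF mcarrier_1]])
    then have "hom_comp d (p * x) + (-1) * (\<Sum>i\<in>{..d} - {0}. hom_comp i p * hom_comp (d - i) x) \<in> A"
      by (rule mpoly_ideal_add[OF id hA[OF p(2)]])
    ultimately have "Poly_Mapping.single 0 ?c * hom_comp d x \<in> A" by (simp add: c0)
    then have "Poly_Mapping.single 0 (inverse ?c) * (Poly_Mapping.single 0 ?c * hom_comp d x) \<in> A"
      by (rule mpoly_ideal_mult[OF id]) (simp add: mcarrier_single)
    also have "Poly_Mapping.single 0 (inverse ?c) * (Poly_Mapping.single 0 ?c * hom_comp d x) = hom_comp d x"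
      using c by (simp add: mult.assoc[symmetric] mult_single)
    finally show False using d(1) by blast
  qed
  then show "p \<in> graded_max n" using p(1) by (simp add: graded_max_def)
qed

theorem graded_astab_eq_dstab:
  fixes I :: "'k::field mpoly set"
  assumes n: "n \<le> 3" and I: "graded_ideal n I"
  shows "astab (mpoly_ring n) I = dstab (mpoly_ring n) (graded_max n) I"
proof -
  let ?m = "graded_max n :: 'k mpoly set"
  interpret ring_cover "mpoly_ring n :: 'k mpoly ring" "to_mpoly n" by (rule ring_cover_to_mpoly[OF n])
  have ker: "ker = {t. to_mpoly n t = (0 :: 'k mpoly)}" by (auto simp: ker_def mpoly_ring_simps)
  have fd: "factorial_dim3 ker (to_mpoly n -` ?m)" unfolding ker by (rule mpoly_factorial[OF n])
  have "is_ideal (to_mpoly n -` ?m)"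
    by (rule prime_idealD(1)[OF factorial_dim3.M[OF fd]])
  then have "ideal (to_mpoly n ` (to_mpoly n -` ?m)) (mpoly_ring n)" by (rule image_ideal)
  moreover have "to_mpoly n ` (to_mpoly n -` ?m) = ?m"
    by (rule image_vimage) (auto simp: graded_max_def)
  ultimately have m: "ideal ?m (mpoly_ring n)" by simp
  have iI: "ideal I (mpoly_ring n)" using I by (simp add: graded_ideal_def)
  show ?thesis
    by (rule astab_eq_dstab, rule Ass_eq_iff_depth_eq[OF fd m iI])
      (rule graded_colon_subset[OF graded_ideal_pow[OF n I]])
qed

theorem theorem1p2:
  shows "(\<forall>(R :: ('a, 'b) ring_scheme) m I.
            regular_local_ring R m \<and> krull_dim R \<le> 3 \<and> ideal I R
              \<longrightarrow> astab R I = dstab R m I)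
       \<and> (\<forall>n (I :: ('k::field) mpoly set).
            n \<le> 3 \<and> graded_ideal n I
              \<longrightarrow> astab (mpoly_ring n) I = dstab (mpoly_ring n) (graded_max n) I)"
  using regular_local_astab_eq_dstab graded_astab_eq_dstab by blast

end
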